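(* Let $\Lambda\subset\mathbb{R}$ be such that $\{e^{i\lambda t}\}_{\lambda\in\Lambda}$ is a complete and minimal system in $L^2(-\pi,\pi)$, and let $\{w_\lambda\}_{\lambda\in\Lambda}$ be its biorthogonal system. Assume that $\Lambda_1\subset\Lambda$ and that there exists $\tilde\Lambda_2\subset\mathbb{R}$ such that $\{e^{i\lambda t}\}_{\lambda\in\Lambda_1\cup\tilde\Lambda_2}$ is a Riesz basis in $L^2(-\pi,\pi)$ whose generating function $F$ satisfies $\sup_{\zeta\in\mathcal{Z}_F}|F'(\zeta)|<\infty$, where $\mathcal{Z}_F=\Lambda_1\cup\tilde\Lambda_2$ is the zero set of $F$. Put $\Lambda_2=\Lambda\setminus\Lambda_1$. Then the system $$\{e^{i\lambda t}\}_{\lambda\in\Lambda_1}\cup\{w_\lambda\}_{\lambda\in\Lambda_2}$$ is complete in $L^2(-\pi,\pi)$.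
   Context: A system of vectors in a Hilbert space is complete if its closed linear span is the whole space, and minimal if no vector of the system lies in the closed linear span of the others. A complete and minimal system $\{v_\lambda\}$ has a unique biorthogonal system $\{w_\lambda\}$, i.e. $(v_\lambda,w_\mu)=\delta_{\lambda\mu}$. The set $\Lambda_1\cup\tilde\Lambda_2$ is understood as a disjoint union of sets (each exponential occurs once). If $\{e^{i\lambda t}\}_{\lambda\in S}$ ($S\subset\mathbb{C}$) is complete and minimal in $L^2(-\pi,\pi)$, in particular if it is a Riesz basis, its generating function is the entire function $$F(z)=\lim_{R\to\infty}\prod_{\lambda\in S,\ |\lambda|<R}\Bigl(1-\frac z\lambda\Bigr)$$ (the limit is known to exist), where the factor $1-z/\lambda$ is replaced by $z$ if $\lambda=0$. *)

theory Defs
  imports "HOL-Analysis.Analysis"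
begin

(* Elements of L^2(-pi,pi) are represented by functions real => complex, which are only
   relevant up to equality almost everywhere on (-pi,pi); all notions below are invariant
   under that equivalence (for members of L2). *)

abbreviation leb :: "real measure" where
  "leb \<equiv> lebesgue_on {-pi<..<pi}"

definition L2 :: "(real \<Rightarrow> complex) set" where
  "L2 = {f \<in> borel_measurable leb. integrable leb (\<lambda>t. (cmod (f t))\<^sup>2)}"

definition eq_L2 :: "(real \<Rightarrow> complex) \<Rightarrow> (real \<Rightarrow> complex) \<Rightarrow> bool" where
  "eq_L2 f g \<longleftrightarrow> (AE t in leb. f t = g t)"

definition inner_L2 :: "(real \<Rightarrow> complex) \<Rightarrow> (real \<Rightarrow> complex) \<Rightarrow> complex" where
  "inner_L2 f g = (LINT t|leb. f t * cnj (g t))"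

definition norm_L2 :: "(real \<Rightarrow> complex) \<Rightarrow> real" where
  "norm_L2 f = sqrt (LINT t|leb. (cmod (f t))\<^sup>2)"

definition lin_span :: "(real \<Rightarrow> complex) set \<Rightarrow> (real \<Rightarrow> complex) set" where
  "lin_span V = {(\<lambda>t. \<Sum>v\<in>T. c v * v t) |T c. finite T \<and> T \<subseteq> V}"

definition closed_span :: "(real \<Rightarrow> complex) set \<Rightarrow> (real \<Rightarrow> complex) set" where
  "closed_span V = {f \<in> L2. \<forall>\<epsilon>>0. \<exists>g\<in>lin_span V. norm_L2 (\<lambda>t. f t - g t) < \<epsilon>}"

definition complete_L2 :: "(real \<Rightarrow> complex) set \<Rightarrow> bool" where
  "complete_L2 V \<longleftrightarrow> V \<subseteq> L2 \<and> closed_span V = L2"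

definition minimal_L2 :: "'i set \<Rightarrow> ('i \<Rightarrow> real \<Rightarrow> complex) \<Rightarrow> bool" where
  "minimal_L2 I v \<longleftrightarrow> v ` I \<subseteq> L2 \<and> (\<forall>i\<in>I. v i \<notin> closed_span (v ` (I - {i})))"

definition biorthogonal ::
  "'i set \<Rightarrow> ('i \<Rightarrow> real \<Rightarrow> complex) \<Rightarrow> ('i \<Rightarrow> real \<Rightarrow> complex) \<Rightarrow> bool" where
  "biorthogonal I v w \<longleftrightarrow> v ` I \<subseteq> L2 \<and> w ` I \<subseteq> L2 \<and>
     (\<forall>i\<in>I. \<forall>j\<in>I. inner_L2 (v i) (w j) = (if i = j then 1 else 0))"

definition orthonormal_basis :: "'i set \<Rightarrow> ('i \<Rightarrow> real \<Rightarrow> complex) \<Rightarrow> bool" where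
  "orthonormal_basis I u \<longleftrightarrow> complete_L2 (u ` I) \<and>
     (\<forall>i\<in>I. \<forall>j\<in>I. inner_L2 (u i) (u j) = (if i = j then 1 else 0))"

definition bounded_operator :: "((real \<Rightarrow> complex) \<Rightarrow> (real \<Rightarrow> complex)) \<Rightarrow> bool" where
  "bounded_operator T \<longleftrightarrow>
     (\<forall>f\<in>L2. T f \<in> L2) \<and>
     (\<forall>f\<in>L2. \<forall>g\<in>L2. \<forall>a b.
        eq_L2 (T (\<lambda>t. a * f t + b * g t)) (\<lambda>t. a * T f t + b * T g t)) \<and>
     (\<exists>C. \<forall>f\<in>L2. norm_L2 (T f) \<le> C * norm_L2 f)"

(* The image of an orthonormal basis under a bounded linear operator T
   with bounded inverse S. *)
definition riesz_basis :: "'i set \<Rightarrow> ('i \<Rightarrow> real \<Rightarrow> complex) \<Rightarrow> bool" where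
  "riesz_basis I v \<longleftrightarrow> v ` I \<subseteq> L2 \<and>
     (\<exists>u T S. orthonormal_basis I u \<and> bounded_operator T \<and> bounded_operator S \<and>
        (\<forall>f\<in>L2. eq_L2 (S (T f)) f \<and> eq_L2 (T (S f)) f) \<and>
        (\<forall>i\<in>I. eq_L2 (T (u i)) (v i)))"

definition expo :: "complex \<Rightarrow> real \<Rightarrow> complex" where
  "expo \<mu> t = exp (\<i> * \<mu> * of_real t)"

(* If the exponentials with frequencies in S are complete and minimal, S has finitely many
   points in each disc, so the products are genuine, and the limit exists for every z. *)
definition generating_function :: "complex set \<Rightarrow> (complex \<Rightarrow> complex) \<Rightarrow> bool" where
  "generating_function S F \<longleftrightarrow>
     (\<forall>z. ((\<lambda>R. \<Prod>\<mu> | \<mu> \<in> S \<and> cmod \<mu> < R. if \<mu> = 0 then z else 1 - z / \<mu>)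
             \<longlongrightarrow> F z) (at_top :: real filter))"

end

theory Submission
  imports Defs
begin

text \<open>
  Write \<open>ft f\<close> for the entire function \<open>z \<mapsto> \<integral> f(t) exp (- \<i> z t) dt\<close>, \<open>Z = \<Lambda>\<^sub>1 \<union> \<Lambda>\<^sub>2'\<close>, and \<open>d\<close> for the system
  biorthogonal to the Riesz basis. Since a root of \<open>ft f\<close> can be divided out within the space,
  \<open>(z - \<zeta>) ft (d \<zeta>) z\<close> is, up to a factor, one and the same function \<open>\<Phi>\<close>, and \<open>ft (d \<zeta>) z = \<Phi>(z) / (\<Phi>'(\<zeta>) (z - \<zeta>))\<close>;
  likewise for \<open>w\<close>. Let \<open>h\<close> be orthogonal to the mixed system and \<open>\<beta> \<zeta> = (d \<zeta>, h)\<close>, which is square summable.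
  For \<open>\<nu> \<in> \<Lambda> - \<Lambda>\<^sub>1\<close> let \<open>f\<close> interpolate \<open>\<Phi>'(\<zeta>) \<beta> \<zeta> ft (w \<nu>) \<zeta>\<close> on \<open>Z\<close>; this is where \<open>\<Phi>'\<close> has to be bounded.
  The orthogonality relations force \<open>ft f\<close> to vanish on \<open>\<Lambda> - {\<nu>}\<close>, so \<open>f\<close> is a multiple of \<open>w \<nu>\<close>, and \<open>\<Phi>' \<beta>\<close> is constant
  on \<open>\<Lambda>\<^sub>2'\<close>. Square summability makes the constant zero if \<open>\<Lambda>\<^sub>2'\<close> is infinite; the finite case is linear algebra.

  For the bound on \<open>\<Phi>'\<close> compare \<open>\<Phi>\<close> with the generating function \<open>F\<close>: interpolating the derivative of \<open>ft (d a)\<close> gives its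
  logarithmic derivative as a series over the frequencies, hence a product formula and \<open>F(z) = c exp (k z) \<Phi>(z)\<close>.
  A growth comparison along the frequencies, which are unbounded in both directions, shows that \<open>k\<close> is purely imaginary.
\<close>

section \<open>The space \<open>L\<^sup>2(-\<pi>, \<pi>)\<close>\<close>

text \<open>The points of \<open>\<Lambda>2'\<close> may meet \<open>\<Lambda>\<close>, and this
  overlap shapes the final argument. Comparing \<open>ft f\<close> with \<open>ft (w \<nu>)\<close>
  says something only where \<open>ft (w \<nu>)\<close> does not vanish, that is, off
  \<open>\<Lambda>\<close> and at \<open>\<nu>\<close> itself. So each point of
  \<open>\<Lambda>2'\<close> in \<open>\<Lambda>\<close> needs its own \<open>\<nu>\<close>, and the
  resulting constants are matched at one point of \<open>\<Lambda>2'\<close> outside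
  \<open>\<Lambda>\<close>; if there is no such point, the two systems coincide. That
  \<open>ft f\<close> vanishes at \<open>\<mu>\<close> outside \<open>Z\<close> has a simple origin:
  the relations for \<open>w \<mu>\<close> and \<open>w \<nu>\<close>, expanded along the Riesz
  basis, are two series with sum zero, and partial fractions merge them into the interpolation
  series of \<open>ft f\<close> at \<open>\<mu>\<close>. Vectors are functions given up to null
  sets. Equality of vectors therefore appears as a vanishing norm of the difference, and identities
  are carried by the transforms, which do not depend on the representative.\<close>

interpretation leb: finite_measure leb
  by (intro finite_measure_lebesgue_on) auto

lemma L2_mult_integrable:
  assumes "f \<in> L2" "g \<in> L2"
  shows "integrable leb (\<lambda>t. f t * cnj (g t))" "integrable leb (\<lambda>t. cmod (f t) * cmod (g t))"
proof -
  have m: "f \<in> borel_measurable leb" "g \<in> borel_measurable leb"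
    using assms by (auto simp: L2_def)
  have i: "integrable leb (\<lambda>t. (cmod (f t))\<^sup>2 + (cmod (g t))\<^sup>2)"
    using assms by (auto simp: L2_def)
  have b: "cmod (f t) * cmod (g t) \<le> (cmod (f t))\<^sup>2 + (cmod (g t))\<^sup>2" for t
    using sum_squares_bound[of "cmod (f t)" "cmod (g t)"]
      mult_nonneg_nonneg[OF norm_ge_zero[of "f t"] norm_ge_zero[of "g t"]] by linarith
  show "integrable leb (\<lambda>t. f t * cnj (g t))"
  proof (rule Bochner_Integration.integrable_bound[OF i])
    show "(\<lambda>t. f t * cnj (g t)) \<in> borel_measurable leb"
      by (intro borel_measurable_times measurable_compose[OF m(2)] m borel_measurable_continuous_onI
          continuous_on_cnj continuous_on_id)
    show "AE t in leb. norm (f t * cnj (g t)) \<le> norm ((cmod (f t))\<^sup>2 + (cmod (g t))\<^sup>2)"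
      using b by (intro AE_I2) (simp add: norm_mult)
  qed
  show "integrable leb (\<lambda>t. cmod (f t) * cmod (g t))"
    by (rule Bochner_Integration.integrable_bound[OF i]) (use m b in \<open>auto intro!: AE_I2\<close>)
qed

lemma L2_I:
  assumes "f \<in> borel_measurable leb" "h \<in> L2"
    "\<And>t. t \<in> {-pi<..<pi} \<Longrightarrow> cmod (f t) \<le> C * cmod (h t)"
  shows "f \<in> L2"
proof -
  have "integrable leb (\<lambda>t. C\<^sup>2 * (cmod (h t))\<^sup>2)" using assms by (auto simp: L2_def)
  then have "integrable leb (\<lambda>t. (cmod (f t))\<^sup>2)"
  proof (rule Bochner_Integration.integrable_bound)
    show "AE t in leb. norm ((cmod (f t))\<^sup>2) \<le> norm (C\<^sup>2 * (cmod (h t))\<^sup>2)"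
      using power_mono[OF assms(3) norm_ge_zero, of _ 2]
      by (intro AE_I2) (simp add: power_mult_distrib)
  qed (use assms in auto)
  then show ?thesis using assms by (simp add: L2_def)
qed

lemma L2_meas: "f \<in> L2 \<Longrightarrow> f \<in> borel_measurable leb" by (simp add: L2_def)

lemma L2_add: assumes "f \<in> L2" "g \<in> L2" shows "(\<lambda>t. f t + g t) \<in> L2"
proof -
  have i: "integrable leb (\<lambda>t. 2 * (cmod (f t))\<^sup>2 + 2 * (cmod (g t))\<^sup>2)"
    using assms by (auto simp: L2_def)
  have b: "(cmod (f t + g t))\<^sup>2 \<le> 2 * (cmod (f t))\<^sup>2 + 2 * (cmod (g t))\<^sup>2" for t
  proof -
    have "(cmod (f t + g t))\<^sup>2 \<le> (cmod (f t) + cmod (g t))\<^sup>2"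
      by (intro power_mono norm_triangle_ineq) auto
    also have "\<dots> \<le> 2 * (cmod (f t))\<^sup>2 + 2 * (cmod (g t))\<^sup>2"
      using sum_squares_bound[of "cmod (f t)" "cmod (g t)"] by (simp add: power2_sum)
    finally show ?thesis .
  qed
  have "integrable leb (\<lambda>t. (cmod (f t + g t))\<^sup>2)"
    by (rule Bochner_Integration.integrable_bound[OF i])
      (use assms[THEN L2_meas] b in \<open>auto intro!: AE_I2\<close>)
  then show ?thesis using assms[THEN L2_meas] by (simp add: L2_def borel_measurable_add)
qed

lemma L2_cmult: assumes "f \<in> L2" shows "(\<lambda>t. c * f t) \<in> L2"
  by (rule L2_I[OF _ assms, of _ "cmod c"]) (use assms in \<open>auto simp: L2_def norm_mult\<close>)

lemma L2_zero: "(\<lambda>t. 0) \<in> L2" by (simp add: L2_def)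

lemma L2_minus: "f \<in> L2 \<Longrightarrow> (\<lambda>t. - f t) \<in> L2"
  using L2_cmult[of f "-1"] by simp

lemma L2_diff: "f \<in> L2 \<Longrightarrow> g \<in> L2 \<Longrightarrow> (\<lambda>t. f t - g t) \<in> L2"
  using L2_add[of f "\<lambda>t. - g t"] L2_minus[of g] by simp

lemma L2_sum: "(\<And>i. i \<in> A \<Longrightarrow> f i \<in> L2) \<Longrightarrow> (\<lambda>t. \<Sum>i\<in>A. f i t) \<in> L2"
  by (induction A rule: infinite_finite_induct) (auto intro!: L2_add L2_zero)

lemmas L2_intros = L2_add L2_cmult L2_zero L2_minus L2_diff L2_sum

lemma inner_L2_add_left: "f \<in> L2 \<Longrightarrow> g \<in> L2 \<Longrightarrow> h \<in> L2 \<Longrightarrow>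
    inner_L2 (\<lambda>t. f t + g t) h = inner_L2 f h + inner_L2 g h"
  by (simp add: inner_L2_def distrib_right L2_mult_integrable)

lemma inner_L2_cmult_left: "inner_L2 (\<lambda>t. c * f t) h = c * inner_L2 f h"
  by (simp add: inner_L2_def mult.assoc)

lemma inner_L2_zero_left [simp]: "inner_L2 (\<lambda>t. 0) h = 0"
  by (simp add: inner_L2_def)

lemma inner_L2_cnj: "cnj (inner_L2 f g) = inner_L2 g f"
  unfolding inner_L2_def by (subst Bochner_Integration.integral_cnj[symmetric]) (simp del: Bochner_Integration.integral_cnj add: mult.commute)

lemma inner_L2_diff_left: "f \<in> L2 \<Longrightarrow> g \<in> L2 \<Longrightarrow> h \<in> L2 \<Longrightarrow>
    inner_L2 (\<lambda>t. f t - g t) h = inner_L2 f h - inner_L2 g h"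
  by (simp add: inner_L2_def left_diff_distrib L2_mult_integrable)

lemma inner_L2_sum_left: "(\<And>i. i \<in> A \<Longrightarrow> f i \<in> L2) \<Longrightarrow> h \<in> L2 \<Longrightarrow>
    inner_L2 (\<lambda>t. \<Sum>i\<in>A. f i t) h = (\<Sum>i\<in>A. inner_L2 (f i) h)"
  by (induction A rule: infinite_finite_induct) (auto simp: inner_L2_add_left L2_sum)

lemma inner_L2_diff_right: "f \<in> L2 \<Longrightarrow> g \<in> L2 \<Longrightarrow> h \<in> L2 \<Longrightarrow>
    inner_L2 h (\<lambda>t. f t - g t) = inner_L2 h f - inner_L2 h g"
  by (metis inner_L2_cnj inner_L2_diff_left complex_cnj_diff)

lemma inner_L2_add_right: "f \<in> L2 \<Longrightarrow> g \<in> L2 \<Longrightarrow> h \<in> L2 \<Longrightarrow>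
    inner_L2 h (\<lambda>t. f t + g t) = inner_L2 h f + inner_L2 h g"
  by (metis inner_L2_cnj inner_L2_add_left complex_cnj_add)

lemma norm_L2_nonneg [simp]: "0 \<le> norm_L2 f"
  by (simp add: norm_L2_def)

lemma norm_L2_sq: "(norm_L2 f)\<^sup>2 = (LINT t|leb. (cmod (f t))\<^sup>2)"
  by (simp add: norm_L2_def)

lemma inner_L2_self: "inner_L2 f f = of_real ((norm_L2 f)\<^sup>2)"
  unfolding norm_L2_sq inner_L2_def complex_norm_square[symmetric]
  by (simp flip: of_real_power)

lemma norm_L2_cmult: "norm_L2 (\<lambda>t. c * f t) = cmod c * norm_L2 f"
  by (simp add: norm_L2_def norm_mult power_mult_distrib real_sqrt_mult)

lemma norm_L2_minus_commute: "norm_L2 (\<lambda>t. f t - g t) = norm_L2 (\<lambda>t. g t - f t)"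
  by (simp add: norm_L2_def norm_minus_commute)

lemma norm_L2_add_sq:
  assumes "f \<in> L2" "g \<in> L2"
  shows "(norm_L2 (\<lambda>t. f t + g t))\<^sup>2 = (norm_L2 f)\<^sup>2 + 2 * Re (inner_L2 f g) + (norm_L2 g)\<^sup>2"
proof -
  have "of_real ((norm_L2 (\<lambda>t. f t + g t))\<^sup>2) = inner_L2 f f + inner_L2 g g + (inner_L2 f g + cnj (inner_L2 f g))"
    unfolding inner_L2_self[symmetric] using assms
    by (simp add: inner_L2_add_left inner_L2_add_right L2_add inner_L2_cnj)
  then have "complex_of_real ((norm_L2 (\<lambda>t. f t + g t))\<^sup>2) =
      of_real ((norm_L2 f)\<^sup>2 + 2 * Re (inner_L2 f g) + (norm_L2 g)\<^sup>2)"
    by (simp add: inner_L2_self complex_add_cnj)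
  then show ?thesis using of_real_eq_iff by blast
qed

text \<open>The absolute values stay inside the integral because completeness needs more than a
  bound for \<open>inner_L2\<close>: with the constant 1 as one factor, this is the passage from
  square integrals to integrals. The source is a quadratic polynomial in \<open>s\<close> without
  negative values.\<close>

lemma L2_abs_Cauchy_Schwarz:
  assumes f: "f \<in> L2" and g: "g \<in> L2"
  shows "(LINT t|leb. cmod (f t) * cmod (g t)) \<le> norm_L2 f * norm_L2 g"
proof -
  have m: "f \<in> borel_measurable leb" "g \<in> borel_measurable leb"
    using assms by (auto simp: L2_def)
  have i: "integrable leb (\<lambda>t. (cmod (f t))\<^sup>2)" "integrable leb (\<lambda>t. (cmod (g t))\<^sup>2)"
    using assms by (auto simp: L2_def)
  let ?I = "LINT t|leb. cmod (f t) * cmod (g t)"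
  have *: "0 \<le> (norm_L2 f)\<^sup>2 * s\<^sup>2 - 2 * ?I * s + (norm_L2 g)\<^sup>2" for s
  proof -
    have "0 \<le> (LINT t|leb. (s * cmod (f t) - cmod (g t))\<^sup>2)" by simp
    also have "\<dots> = (LINT t|leb. s\<^sup>2 * (cmod (f t))\<^sup>2 - 2 * s * (cmod (f t) * cmod (g t)) + (cmod (g t))\<^sup>2)"
      by (intro Bochner_Integration.integral_cong) (auto simp: power2_eq_square algebra_simps)
    also have "\<dots> = (norm_L2 f)\<^sup>2 * s\<^sup>2 - 2 * ?I * s + (norm_L2 g)\<^sup>2"
      unfolding norm_L2_sq using i L2_mult_integrable[OF f g] by simp
    finally show ?thesis .
  qed
  have I0: "0 \<le> ?I" by simp
  have "?I\<^sup>2 \<le> (norm_L2 f)\<^sup>2 * (norm_L2 g)\<^sup>2"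
  proof (cases "norm_L2 f = 0")
    case True
    have "?I = 0"
    proof (rule ccontr)
      assume "?I \<noteq> 0"
      \<comment> \<open>With \<open>norm_L2 f = 0\<close> the polynomial is linear in
        \<open>s\<close>; a nonzero slope would make it negative at this \<open>s\<close>.\<close>
      then have "2 * ?I * (((norm_L2 g)\<^sup>2 + 1) / ?I) = 2 * (norm_L2 g)\<^sup>2 + 2" by simp
      then show False using *[of "((norm_L2 g)\<^sup>2 + 1) / ?I"] True
        by simp (smt (verit) zero_le_power2)
    qed
    then show ?thesis by simp
  next
    case False
    define n I where "n = (norm_L2 f)\<^sup>2" and "I = ?I"
    have n: "n > 0" using False by (simp add: n_def)
    \<comment> \<open>\<open>I / n\<close> is the minimum point of the polynomial.\<close>
    have "0 \<le> n * (I / n)\<^sup>2 - 2 * I * (I / n) + (norm_L2 g)\<^sup>2"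
      using *[of "I / n"] by (simp add: n_def I_def)
    also have "n * (I / n)\<^sup>2 - 2 * I * (I / n) = - (I\<^sup>2 / n)"
      using n by (simp add: power2_eq_square)
    finally have "I\<^sup>2 / n \<le> (norm_L2 g)\<^sup>2" by simp
    then show ?thesis using n by (simp add: n_def I_def pos_divide_le_eq mult.commute)
  qed
  then have "?I\<^sup>2 \<le> (norm_L2 f * norm_L2 g)\<^sup>2" by (simp add: power_mult_distrib)
  then show ?thesis by (rule power2_le_imp_le) simp
qed

lemma L2_Cauchy_Schwarz:
  assumes "f \<in> L2" "g \<in> L2" shows "cmod (inner_L2 f g) \<le> norm_L2 f * norm_L2 g"
proof -
  have "cmod (inner_L2 f g) \<le> (LINT t|leb. cmod (f t * cnj (g t)))"
    unfolding inner_L2_def by (rule integral_norm_bound)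
  then show ?thesis using L2_abs_Cauchy_Schwarz[OF assms] by (simp add: norm_mult)
qed

lemma norm_L2_triangle:
  assumes "f \<in> L2" "g \<in> L2"
  shows "norm_L2 (\<lambda>t. f t + g t) \<le> norm_L2 f + norm_L2 g"
proof (rule power2_le_imp_le)
  have "Re (inner_L2 f g) \<le> norm_L2 f * norm_L2 g"
    using L2_Cauchy_Schwarz[OF assms] complex_Re_le_cmod order_trans by blast
  then show "(norm_L2 (\<lambda>t. f t + g t))\<^sup>2 \<le> (norm_L2 f + norm_L2 g)\<^sup>2"
    by (simp add: norm_L2_add_sq assms power2_sum)
qed simp

lemma norm_L2_triangle_diff:
  assumes "f \<in> L2" "g \<in> L2" "h \<in> L2"
  shows "norm_L2 (\<lambda>t. f t - h t) \<le> norm_L2 (\<lambda>t. f t - g t) + norm_L2 (\<lambda>t. g t - h t)"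
  using norm_L2_triangle[of "\<lambda>t. f t - g t" "\<lambda>t. g t - h t"] assms by (simp add: L2_diff)

lemma inner_L2_eq_L2:
  assumes "f \<in> L2" "g \<in> L2" "h \<in> L2" "norm_L2 (\<lambda>t. f t - g t) = 0"
  shows "inner_L2 f h = inner_L2 g h"
  using L2_Cauchy_Schwarz[of "\<lambda>t. f t - g t" h] assms
  by (simp add: L2_diff inner_L2_diff_left)

lemma eq_L2_norm_diff:
  assumes "eq_L2 f g" shows "norm_L2 (\<lambda>t. f t - g t) = 0"
proof -
  have "(LINT t|leb. (cmod (f t - g t))\<^sup>2) = 0"
    using assms unfolding eq_L2_def by (intro integral_eq_zero_AE) auto
  then show ?thesis by (simp add: norm_L2_def)
qed

section \<open>Completeness of the space and the Riesz representation theorem\<close>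

lemma AE_summable_of_integrals:
  fixes D :: "nat \<Rightarrow> 'a \<Rightarrow> real"
  assumes i: "\<And>n. integrable M (D n)" and pos: "\<And>n t. 0 \<le> D n t"
    and le: "\<And>n. (LINT t|M. D n t) \<le> c n" and c: "summable c"
  shows "AE t in M. summable (\<lambda>n. D n t)"
proof -
  have c0: "0 \<le> c n" for n
    using le[of n] Bochner_Integration.integral_nonneg[of M "D n"] pos by fastforce
  have [measurable]: "D n \<in> borel_measurable M" for n using i by auto
  have "(\<integral>\<^sup>+t. (\<Sum>n. ennreal (D n t)) \<partial>M) = (\<Sum>n. \<integral>\<^sup>+t. ennreal (D n t) \<partial>M)"
    by (rule nn_integral_suminf) measurable
  also have "\<dots> = (\<Sum>n. ennreal (LINT t|M. D n t))"
    using i pos by (intro suminf_cong nn_integral_eq_integral) auto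
  also have "\<dots> \<le> (\<Sum>n. ennreal (c n))"
    using le by (intro suminf_le) (auto intro!: ennreal_leI)
  also have "\<dots> = ennreal (suminf c)"
    using c c0 by (intro suminf_ennreal2) auto
  finally have "(\<integral>\<^sup>+t. (\<Sum>n. ennreal (D n t)) \<partial>M) \<noteq> \<infinity>"
    by (auto simp: top_unique)
  then have "AE t in M. (\<Sum>n. ennreal (D n t)) \<noteq> \<infinity>"
    by (intro nn_integral_PInf_AE) auto
  then show ?thesis
    by (rule AE_mp) (auto intro!: AE_I2 summable_suminf_not_top pos)
qed

text \<open>Riesz-Fischer: a fast subsequence has increments that are summable almost everywhere,
  hence a pointwise limit, and Fatou's lemma carries the Cauchy estimate over to it.\<close>

theorem L2_complete:
  assumes X: "\<And>n. X n \<in> L2"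
    and Cauchy: "\<And>\<epsilon>. \<epsilon> > 0 \<Longrightarrow> \<exists>N. \<forall>m\<ge>N. \<forall>n\<ge>N. norm_L2 (\<lambda>t. X m t - X n t) < \<epsilon>"
  obtains k where "k \<in> L2" "(\<lambda>n. norm_L2 (\<lambda>t. X n t - k t)) \<longlonglongrightarrow> 0"
proof -
  have [measurable]: "X n \<in> borel_measurable leb" for n using X by (rule L2_meas)
  have one: "(\<lambda>t. 1) \<in> L2" by (simp add: L2_def)
  have "\<forall>j. \<exists>N. \<forall>m\<ge>N. \<forall>n\<ge>N. norm_L2 (\<lambda>t. X m t - X n t) < (1/2) ^ j"
    using Cauchy by simp
  then obtain N where N: "\<And>j m n. N j \<le> m \<Longrightarrow> N j \<le> n \<Longrightarrow> norm_L2 (\<lambda>t. X m t - X n t) < (1/2) ^ j"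
    by metis
  \<comment> \<open>The partial sums of \<open>N\<close> make \<open>r\<close> monotone, with
    \<open>r j\<close> still at least \<open>N j\<close> and at least \<open>j\<close>.\<close>
  define r where "r j = j + (\<Sum>i\<le>j. N i)" for j
  have rN: "N j \<le> r j" and r_Suc: "r j \<le> r (Suc j)" and rj: "j \<le> r j" for j
    using member_le_sum[of j "{..j}" N] by (auto simp: r_def)
  define Y where "Y j = X (r j)" for j
  have [measurable]: "Y n \<in> borel_measurable leb" for n by (simp add: Y_def)
  have Y: "Y n \<in> L2" for n by (simp add: Y_def X)
  have Yd: "norm_L2 (\<lambda>t. Y (Suc j) t - Y j t) < (1/2) ^ j" for j
    unfolding Y_def using rN[of j] r_Suc[of j] by (intro N) auto
  have "AE t in leb. summable (\<lambda>j. cmod (Y (Suc j) t - Y j t))"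
  proof (rule AE_summable_of_integrals)
    fix j
    have d: "(\<lambda>t. Y (Suc j) t - Y j t) \<in> L2" by (intro L2_diff Y)
    show "integrable leb (\<lambda>t. cmod (Y (Suc j) t - Y j t))"
      using L2_mult_integrable(2)[OF d one] by simp
    have "(LINT t|leb. cmod (Y (Suc j) t - Y j t)) \<le> norm_L2 (\<lambda>t. Y (Suc j) t - Y j t) * norm_L2 (\<lambda>t. 1)"
      using L2_abs_Cauchy_Schwarz[OF d one] by simp
    also have "\<dots> \<le> (1/2) ^ j * norm_L2 (\<lambda>t. 1)"
      using Yd[of j] by (intro mult_right_mono) auto
    finally show "(LINT t|leb. cmod (Y (Suc j) t - Y j t)) \<le> (1/2) ^ j * norm_L2 (\<lambda>t. 1)" .
  qed (auto intro!: summable_mult2 summable_geometric)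
  then have conv: "AE t in leb. (\<lambda>j. Y j t) \<longlonglongrightarrow> lim (\<lambda>j. Y j t)"
  proof (rule AE_mp, intro AE_I2 impI)
    fix t assume "summable (\<lambda>j. cmod (Y (Suc j) t - Y j t))"
    then have "summable (\<lambda>j. Y (Suc j) t - Y j t)" by (rule summable_norm_cancel)
    then have "convergent (\<lambda>j. (\<Sum>i<j. Y (Suc i) t - Y i t) + Y 0 t)"
      by (intro convergent_add) (auto simp: summable_iff_convergent convergent_const)
    then have "convergent (\<lambda>j. Y j t)" by (simp add: sum_lessThan_telescope[of "\<lambda>j. Y j t"])
    then show "(\<lambda>j. Y j t) \<longlonglongrightarrow> lim (\<lambda>j. Y j t)" by (simp add: convergent_LIMSEQ_iff)
  qed
  \<comment> \<open>Where the subsequence diverges, \<open>lim\<close> is an unspecified value; this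
    concerns only a null set.\<close>
  define k where "k t = lim (\<lambda>j. Y j t)" for t
  have [measurable]: "k \<in> borel_measurable leb"
    unfolding k_def by (rule borel_measurable_lim_metric) measurable
  have key: "(\<lambda>t. X n t - k t) \<in> L2 \<and> norm_L2 (\<lambda>t. X n t - k t) \<le> \<epsilon>"
    if e: "\<epsilon> > 0" and M: "\<forall>m\<ge>M. \<forall>n\<ge>M. norm_L2 (\<lambda>t. X m t - X n t) < \<epsilon>" and n: "n \<ge> M" for \<epsilon> M n
  proof -
    have "(\<integral>\<^sup>+t. ennreal ((cmod (X n t - k t))\<^sup>2) \<partial>leb)
        = (\<integral>\<^sup>+t. liminf (\<lambda>j. ennreal ((cmod (X n t - Y j t))\<^sup>2)) \<partial>leb)"
    proof (rule nn_integral_cong_AE, rule AE_mp[OF conv], intro AE_I2 impI)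
      fix t assume "(\<lambda>j. Y j t) \<longlonglongrightarrow> lim (\<lambda>j. Y j t)"
      then have "(\<lambda>j. ennreal ((cmod (X n t - Y j t))\<^sup>2)) \<longlonglongrightarrow> ennreal ((cmod (X n t - k t))\<^sup>2)"
        unfolding k_def by (intro tendsto_intros)
      then show "ennreal ((cmod (X n t - k t))\<^sup>2) = liminf (\<lambda>j. ennreal ((cmod (X n t - Y j t))\<^sup>2))"
        by (intro lim_imp_Liminf[symmetric]) auto
    qed
    also have "\<dots> \<le> liminf (\<lambda>j. \<integral>\<^sup>+t. ennreal ((cmod (X n t - Y j t))\<^sup>2) \<partial>leb)"
      by (rule nn_integral_liminf) measurable
    also have "\<dots> \<le> liminf (\<lambda>j. ennreal (\<epsilon>\<^sup>2))"
    proof (rule Liminf_mono, rule eventually_sequentiallyI)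
      fix j assume "M \<le> j"
      then have "norm_L2 (\<lambda>t. X n t - Y j t) < \<epsilon>"
        unfolding Y_def using M n rj[of j] by auto
      then have "(norm_L2 (\<lambda>t. X n t - Y j t))\<^sup>2 \<le> \<epsilon>\<^sup>2" by (intro power_mono) auto
      moreover have "(\<integral>\<^sup>+t. ennreal ((cmod (X n t - Y j t))\<^sup>2) \<partial>leb) = ennreal ((norm_L2 (\<lambda>t. X n t - Y j t))\<^sup>2)"
        using L2_diff[OF X Y, of n j] unfolding norm_L2_sq
        by (intro nn_integral_eq_integral) (auto simp: L2_def)
      ultimately show "(\<integral>\<^sup>+t. ennreal ((cmod (X n t - Y j t))\<^sup>2) \<partial>leb) \<le> ennreal (\<epsilon>\<^sup>2)"
        by (simp add: ennreal_leI)
    qed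
    also have "\<dots> = ennreal (\<epsilon>\<^sup>2)" by (simp add: Liminf_const)
    finally have *: "(\<integral>\<^sup>+t. ennreal ((cmod (X n t - k t))\<^sup>2) \<partial>leb) \<le> ennreal (\<epsilon>\<^sup>2)" .
    then have i: "integrable leb (\<lambda>t. (cmod (X n t - k t))\<^sup>2)"
      by (intro integrableI_nonneg) (auto simp: top_unique less_top intro: le_less_trans)
    then have L: "(\<lambda>t. X n t - k t) \<in> L2" by (simp add: L2_def)
    have "ennreal ((norm_L2 (\<lambda>t. X n t - k t))\<^sup>2) \<le> ennreal (\<epsilon>\<^sup>2)"
      using * nn_integral_eq_integral[OF i] by (simp add: norm_L2_sq)
    then have "(norm_L2 (\<lambda>t. X n t - k t))\<^sup>2 \<le> \<epsilon>\<^sup>2" by (subst (asm) ennreal_le_iff) auto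
    then show ?thesis using L e by (auto intro: power2_le_imp_le)
  qed
  have "k \<in> L2"
  proof -
    obtain M where M: "\<forall>m\<ge>M. \<forall>n\<ge>M. norm_L2 (\<lambda>t. X m t - X n t) < 1" using Cauchy[of 1] by auto
    have "(\<lambda>t. X M t - k t) \<in> L2" using key[OF _ M] by simp
    from L2_diff[OF X this, of M] show ?thesis by simp
  qed
  moreover have "(\<lambda>n. norm_L2 (\<lambda>t. X n t - k t)) \<longlonglongrightarrow> 0"
  proof (rule LIMSEQ_I)
    fix \<epsilon> :: real assume e: "\<epsilon> > 0"
    then obtain M where M: "\<forall>m\<ge>M. \<forall>n\<ge>M. norm_L2 (\<lambda>t. X m t - X n t) < \<epsilon>/2"
      using Cauchy[of "\<epsilon>/2"] by auto
    show "\<exists>M. \<forall>n\<ge>M. norm (norm_L2 (\<lambda>t. X n t - k t) - 0) < \<epsilon>"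
      using key[OF _ M] e by (intro exI[of _ M]) fastforce
  qed
  ultimately show ?thesis by (rule that)
qed

text \<open>\<open>M\<close> need not be closed; the representing vector then lies in its closure.
  With a linear span for \<open>M\<close> this is orthogonal projection, with \<open>M = L2\<close>
  it is the representation theorem.\<close>

theorem L2_Riesz:
  assumes M: "M \<subseteq> L2" "(\<lambda>t. 0) \<in> M"
    and M_add: "\<And>f g. f \<in> M \<Longrightarrow> g \<in> M \<Longrightarrow> (\<lambda>t. f t + g t) \<in> M"
    and M_cmult: "\<And>c f. f \<in> M \<Longrightarrow> (\<lambda>t. c * f t) \<in> M"
    and add: "\<And>f g. f \<in> M \<Longrightarrow> g \<in> M \<Longrightarrow> \<psi> (\<lambda>t. f t + g t) = \<psi> f + \<psi> g"
    and cmult: "\<And>c f. f \<in> M \<Longrightarrow> \<psi> (\<lambda>t. c * f t) = c * \<psi> f"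
    and bound: "\<And>f. f \<in> M \<Longrightarrow> cmod (\<psi> f) \<le> C * norm_L2 f"
  obtains k where "k \<in> L2" "\<And>\<epsilon>. \<epsilon> > 0 \<Longrightarrow> \<exists>m\<in>M. norm_L2 (\<lambda>t. k t - m t) < \<epsilon>"
    "\<And>m. m \<in> M \<Longrightarrow> inner_L2 m k = \<psi> m"
proof -
  have inL: "f \<in> L2" if "f \<in> M" for f using M that by auto
  \<comment> \<open>If \<open>k\<close> represents \<open>\<psi>\<close>, then \<open>J f\<close> is
    the squared distance from \<open>f\<close> to \<open>k\<close> up to a constant, so a minimising
    sequence should converge to \<open>k\<close>.\<close>
  define J where "J f = (norm_L2 f)\<^sup>2 - 2 * Re (\<psi> f)" for f
  have J_ge: "J f \<ge> - C\<^sup>2" if "f \<in> M" for f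
  proof -
    have "Re (\<psi> f) \<le> C * norm_L2 f" using bound[OF that] complex_Re_le_cmod order_trans by blast
    moreover have "0 \<le> (norm_L2 f - C)\<^sup>2" by simp
    ultimately show ?thesis unfolding J_def power2_diff by (simp add: mult.commute)
  qed
  then have bdd: "bdd_below (J ` M)" by (intro bdd_belowI2)
  define I where "I = Inf (J ` M)"
  have I_le: "I \<le> J f" if "f \<in> M" for f unfolding I_def using bdd that by (intro cINF_lower)
  define \<delta> where "\<delta> n = inverse (real (Suc n))" for n
  have \<delta>: "\<delta> n > 0" for n by (simp add: \<delta>_def)
  have "\<exists>x\<in>M. J x < I + \<delta> n" for n
    using cInf_lessD[of "J ` M" "I + \<delta> n"] M(2) \<delta>[of n] by (auto simp: I_def)
  then obtain x where x: "\<And>n. x n \<in> M" "\<And>n. J (x n) < I + \<delta> n" by metis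
  have J_add: "J (\<lambda>t. f t + m t) = J f + 2 * Re (inner_L2 m f - \<psi> m) + (norm_L2 m)\<^sup>2"
    if "f \<in> M" "m \<in> M" for f m
  proof -
    have "Re (inner_L2 f m) = Re (inner_L2 m f)" by (subst inner_L2_cnj[symmetric]) simp
    then show ?thesis using that by (simp add: J_def norm_L2_add_sq inL add)
  qed
  have xd: "(norm_L2 (\<lambda>t. x p t - x n t))\<^sup>2 \<le> 2 * (\<delta> n + \<delta> p)" for n p
  proof -
    define m where "m = (\<lambda>t. x p t - x n t)"
    have "(\<lambda>t. x p t + (- 1) * x n t) \<in> M" by (intro M_add M_cmult x)
    then have m: "m \<in> M" by (simp add: m_def)
    \<comment> \<open>\<open>x n + m'\<close> is the midpoint of \<open>x n\<close> and
      \<open>x p\<close>; testing minimality there is the parallelogram argument and bounds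
      \<open>norm_L2 m\<close> by the gaps \<open>\<delta>\<close>.\<close>
    define m' where "m' = (\<lambda>t. (1/2) * m t)"
    have m': "m' \<in> M" unfolding m'_def by (intro M_cmult m)
    have 1: "J (x p) = J (x n) + 2 * Re (inner_L2 m (x n) - \<psi> m) + (norm_L2 m)\<^sup>2"
      using J_add[OF x(1) m, of n] by (simp add: m_def)
    have "I \<le> J (\<lambda>t. x n t + m' t)" by (intro I_le M_add x m')
    also have "\<dots> = J (x n) + 2 * Re (inner_L2 m' (x n) - \<psi> m') + (norm_L2 m')\<^sup>2"
      by (rule J_add[OF x(1) m'])
    also have "inner_L2 m' (x n) - \<psi> m' = (1/2) * (inner_L2 m (x n) - \<psi> m)"
      using m by (simp only: m'_def inner_L2_cmult_left cmult) (simp add: algebra_simps)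
    also have "(norm_L2 m')\<^sup>2 = (norm_L2 m)\<^sup>2 / 4"
      by (simp only: m'_def norm_L2_cmult) (simp add: power_divide)
    finally have "I \<le> J (x n) + Re (inner_L2 m (x n) - \<psi> m) + (norm_L2 m)\<^sup>2 / 4"
      by (simp add: field_simps)
    then have "(norm_L2 m)\<^sup>2 \<le> 2 * (\<delta> n + \<delta> p)"
      using 1 x(2)[of n] x(2)[of p] by simp
    then show ?thesis by (simp add: m_def)
  qed
  have \<delta>_lim: "\<delta> \<longlonglongrightarrow> 0" unfolding \<delta>_def by (rule LIMSEQ_inverse_real_of_nat)
  obtain k where k: "k \<in> L2" "(\<lambda>n. norm_L2 (\<lambda>t. x n t - k t)) \<longlonglongrightarrow> 0"
  proof (rule L2_complete[of x])
    show "x n \<in> L2" for n using x by (intro inL)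
    fix \<epsilon> :: real assume e: "\<epsilon> > 0"
    then have "eventually (\<lambda>n. \<delta> n < \<epsilon>\<^sup>2 / 4) sequentially"
      by (intro order_tendstoD(2)[OF \<delta>_lim]) simp
    then obtain N where N: "\<And>n. n \<ge> N \<Longrightarrow> \<delta> n < \<epsilon>\<^sup>2 / 4" by (auto simp: eventually_sequentially)
    have "norm_L2 (\<lambda>t. x m t - x n t) < \<epsilon>" if "m \<ge> N" "n \<ge> N" for m n
    proof (rule power2_less_imp_less)
      show "(norm_L2 (\<lambda>t. x m t - x n t))\<^sup>2 < \<epsilon>\<^sup>2"
        using xd[of m n] N[OF that(1)] N[OF that(2)] by simp
    qed (use e in simp)
    then show "\<exists>N. \<forall>m\<ge>N. \<forall>n\<ge>N. norm_L2 (\<lambda>t. x m t - x n t) < \<epsilon>" by blast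
  qed auto
  have "inner_L2 m k = \<psi> m" if m: "m \<in> M" for m
  proof (rule ccontr)
    define e where "e = inner_L2 m k - \<psi> m"
    assume "inner_L2 m k \<noteq> \<psi> m"
    then have e0: "(cmod e)\<^sup>2 > 0" by (simp add: e_def)
    have "(\<lambda>n. inner_L2 m (x n) - inner_L2 m k) \<longlonglongrightarrow> 0"
    proof (rule Lim_null_comparison)
      show "(\<lambda>n. norm_L2 m * norm_L2 (\<lambda>t. x n t - k t)) \<longlonglongrightarrow> 0"
        using tendsto_mult_right_zero[OF k(2)] by simp
      show "\<forall>\<^sub>F n in sequentially. norm (inner_L2 m (x n) - inner_L2 m k) \<le> norm_L2 m * norm_L2 (\<lambda>t. x n t - k t)"
        using L2_Cauchy_Schwarz[OF inL[OF m] L2_diff[OF inL[OF x(1)] k(1)]]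
        by (simp add: inner_L2_diff_right inL m x k)
    qed
    then have e_lim: "(\<lambda>n. inner_L2 m (x n) - \<psi> m) \<longlonglongrightarrow> e"
      unfolding e_def by (intro tendsto_diff tendsto_const) (simp add: LIM_zero_iff)
    \<comment> \<open>From \<open>x n\<close> a step is taken along \<open>m\<close>, against the
      defect \<open>e\<close>. Its size \<open>s\<close> is so small that the quadratic term cannot
      outweigh the linear gain.\<close>
    define s where "s = 1 / ((norm_L2 m)\<^sup>2 + 1)"
    have s: "s > 0" "s * (norm_L2 m)\<^sup>2 < 1"
      by (simp_all add: s_def add_nonneg_pos divide_less_eq)
    define c where "c = - of_real s * cnj e"
    have "- \<delta> n \<le> 2 * Re (c * (inner_L2 m (x n) - \<psi> m)) + (cmod c)\<^sup>2 * (norm_L2 m)\<^sup>2" for n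
    proof -
      have "I \<le> J (\<lambda>t. x n t + c * m t)" by (intro I_le M_add M_cmult x m)
      also have "\<dots> = J (x n) + 2 * Re (inner_L2 (\<lambda>t. c * m t) (x n) - \<psi> (\<lambda>t. c * m t)) + (norm_L2 (\<lambda>t. c * m t))\<^sup>2"
        by (intro J_add x M_cmult m)
      also have "\<dots> = J (x n) + 2 * Re (c * (inner_L2 m (x n) - \<psi> m)) + (cmod c)\<^sup>2 * (norm_L2 m)\<^sup>2"
        by (simp add: inner_L2_cmult_left cmult m norm_L2_cmult power_mult_distrib algebra_simps)
      finally show ?thesis using x(2)[of n] by simp
    qed
    moreover have "(\<lambda>n. - \<delta> n) \<longlonglongrightarrow> 0" using tendsto_minus[OF \<delta>_lim] by simp
    moreover have "(\<lambda>n. 2 * Re (c * (inner_L2 m (x n) - \<psi> m)) + (cmod c)\<^sup>2 * (norm_L2 m)\<^sup>2)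
       \<longlonglongrightarrow> 2 * Re (c * e) + (cmod c)\<^sup>2 * (norm_L2 m)\<^sup>2"
      by (intro tendsto_intros e_lim)
    ultimately have "0 \<le> 2 * Re (c * e) + (cmod c)\<^sup>2 * (norm_L2 m)\<^sup>2"
      by (intro LIMSEQ_le) auto
    also have "c * e = - of_real (s * (cmod e)\<^sup>2)"
      unfolding c_def using complex_norm_square[of e] by (simp add: mult.commute mult.left_commute)
    also have "cmod c = s * cmod e" using s by (simp add: c_def norm_mult)
    finally have "0 \<le> s * (cmod e)\<^sup>2 * (s * (norm_L2 m)\<^sup>2 - 2)"
      by (simp add: power2_eq_square algebra_simps)
    moreover have "s * (cmod e)\<^sup>2 * (s * (norm_L2 m)\<^sup>2 - 2) < 0"
      using s e0 by (intro mult_pos_neg) auto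
    ultimately show False by simp
  qed
  moreover have "\<exists>m\<in>M. norm_L2 (\<lambda>t. k t - m t) < \<epsilon>" if "\<epsilon> > 0" for \<epsilon>
  proof -
    have "\<exists>n. norm_L2 (\<lambda>t. x n t - k t) < \<epsilon>"
      using order_tendstoD(2)[OF k(2) that] by (auto simp: eventually_sequentially)
    then show ?thesis using x(1) by (metis norm_L2_minus_commute)
  qed
  ultimately show ?thesis using that[OF k(1)] by blast
qed

section \<open>Linear spans and complete systems\<close>

lemma lin_span_L2: "V \<subseteq> L2 \<Longrightarrow> lin_span V \<subseteq> L2"
  unfolding lin_span_def by (auto intro!: L2_sum L2_cmult)

lemma lin_span_mem: "v \<in> V \<Longrightarrow> v \<in> lin_span V"
  unfolding lin_span_def by (intro CollectI exI[of _ "{v}"] exI[of _ "\<lambda>_. 1"]) auto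

lemma lin_span_zero: "(\<lambda>t. 0) \<in> lin_span V"
  unfolding lin_span_def by (intro CollectI exI[of _ "{}"]) auto

lemma lin_span_cmult: assumes "f \<in> lin_span V" shows "(\<lambda>t. c * f t) \<in> lin_span V"
proof -
  obtain T a where T: "finite T" "T \<subseteq> V" "f = (\<lambda>t. \<Sum>v\<in>T. a v * v t)"
    using assms by (auto simp: lin_span_def)
  show ?thesis unfolding lin_span_def
    using T by (intro CollectI exI[of _ T] exI[of _ "\<lambda>v. c * a v"]) (auto simp: sum_distrib_left mult.assoc)
qed

lemma lin_span_add: assumes "f \<in> lin_span V" "g \<in> lin_span V" shows "(\<lambda>t. f t + g t) \<in> lin_span V"
proof -
  obtain T a where T: "finite T" "T \<subseteq> V" "f = (\<lambda>t. \<Sum>v\<in>T. a v * v t)"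
    using assms by (auto simp: lin_span_def)
  obtain T' a' where T': "finite T'" "T' \<subseteq> V" "g = (\<lambda>t. \<Sum>v\<in>T'. a' v * v t)"
    using assms by (auto simp: lin_span_def)
  define b where "b v = (if v \<in> T then a v else 0) + (if v \<in> T' then a' v else 0)" for v
  have "(\<Sum>v\<in>T. a v * v t) = (\<Sum>v\<in>T\<union>T'. (if v \<in> T then a v else 0) * v t)" for t
    using T T' by (intro sum.mono_neutral_cong_left) auto
  moreover have "(\<Sum>v\<in>T'. a' v * v t) = (\<Sum>v\<in>T\<union>T'. (if v \<in> T' then a' v else 0) * v t)" for t
    using T T' by (intro sum.mono_neutral_cong_left) auto
  ultimately have "(\<lambda>t. f t + g t) = (\<lambda>t. \<Sum>v\<in>T\<union>T'. b v * v t)"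
    by (simp add: T T' b_def distrib_right sum.distrib)
  then show ?thesis unfolding lin_span_def using T T' by blast
qed

lemma complete_L2_orthogonal:
  assumes V: "complete_L2 V" and f: "f \<in> L2" and orth: "\<And>v. v \<in> V \<Longrightarrow> inner_L2 f v = 0"
  shows "norm_L2 f = 0"
proof (rule ccontr)
  assume n: "norm_L2 f \<noteq> 0"
  have VL: "V \<subseteq> L2" and fc: "f \<in> closed_span V" using V f by (auto simp: complete_L2_def)
  have "norm_L2 f > 0" using n norm_L2_nonneg[of f] by linarith
  then obtain g where g: "g \<in> lin_span V" "norm_L2 (\<lambda>t. f t - g t) < norm_L2 f"
    using fc unfolding closed_span_def by blast
  obtain T a where T: "finite T" "T \<subseteq> V" "g = (\<lambda>t. \<Sum>v\<in>T. a v * v t)"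
    using g by (auto simp: lin_span_def)
  have gL: "g \<in> L2" using g lin_span_L2[OF VL] by auto
  have "inner_L2 g f = (\<Sum>v\<in>T. a v * inner_L2 v f)"
    using T VL f by (simp add: inner_L2_sum_left L2_cmult subset_iff inner_L2_cmult_left)
  also have "\<dots> = 0"
  proof (rule sum.neutral, safe)
    fix v assume "v \<in> T"
    then have "inner_L2 f v = 0" using T orth by auto
    then have "inner_L2 v f = 0" by (metis inner_L2_cnj complex_cnj_zero)
    then show "a v * inner_L2 v f = 0" by simp
  qed
  finally have "inner_L2 f f = inner_L2 (\<lambda>t. f t - g t) f"
    using f gL by (simp add: inner_L2_diff_left)
  then have "(norm_L2 f)\<^sup>2 = cmod (inner_L2 (\<lambda>t. f t - g t) f)"
    by (metis inner_L2_self norm_of_real abs_power2)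
  also have "\<dots> \<le> norm_L2 (\<lambda>t. f t - g t) * norm_L2 f"
    by (intro L2_Cauchy_Schwarz L2_diff f gL)
  also have "\<dots> < norm_L2 f * norm_L2 f"
    using g n by (intro mult_strict_right_mono) (auto simp: less_le)
  finally show False by (simp add: power2_eq_square)
qed

text \<open>The remainder of \<open>f\<close> after projection to the closed span of
  \<open>V\<close> is orthogonal to \<open>V\<close>, so the hypothesis annihilates it.\<close>

lemma complete_L2_I:
  assumes V: "V \<subseteq> L2" and orth: "\<And>h. h \<in> L2 \<Longrightarrow> (\<And>v. v \<in> V \<Longrightarrow> inner_L2 v h = 0) \<Longrightarrow> norm_L2 h = 0"
  shows "complete_L2 V"
proof -
  have "f \<in> closed_span V" if f: "f \<in> L2" for f
  proof -
    note sp = lin_span_L2[OF V]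
    obtain k where k: "k \<in> L2" "\<And>\<epsilon>. \<epsilon> > 0 \<Longrightarrow> \<exists>m\<in>lin_span V. norm_L2 (\<lambda>t. k t - m t) < \<epsilon>"
      "\<And>m. m \<in> lin_span V \<Longrightarrow> inner_L2 m k = inner_L2 m f"
    proof (rule L2_Riesz[of "lin_span V" "\<lambda>m. inner_L2 m f" "norm_L2 f"])
      show "cmod (inner_L2 m f) \<le> norm_L2 f * norm_L2 m" if "m \<in> lin_span V" for m
        using L2_Cauchy_Schwarz[of m f] that sp f by (auto simp: mult.commute)
    qed (use sp f in \<open>auto simp: lin_span_zero lin_span_add lin_span_cmult inner_L2_add_left subset_iff inner_L2_cmult_left\<close>)
    have 0: "norm_L2 (\<lambda>t. f t - k t) = 0"
    proof (rule orth)
      show "(\<lambda>t. f t - k t) \<in> L2" using f k by (intro L2_diff)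
      show "inner_L2 v (\<lambda>t. f t - k t) = 0" if "v \<in> V" for v
        using k(3)[OF lin_span_mem[OF that]] V that f k(1) by (simp add: inner_L2_diff_right subset_iff)
    qed
    have "\<exists>m\<in>lin_span V. norm_L2 (\<lambda>t. f t - m t) < \<epsilon>" if e: "\<epsilon> > 0" for \<epsilon>
    proof -
      obtain m where m: "m \<in> lin_span V" "norm_L2 (\<lambda>t. k t - m t) < \<epsilon>" using k(2)[OF e] by auto
      then have "norm_L2 (\<lambda>t. f t - m t) < \<epsilon>"
        using norm_L2_triangle_diff[of f k m] 0 f k(1) sp by auto
      then show ?thesis using m by auto
    qed
    then show ?thesis using f by (auto simp: closed_span_def)
  qed
  then show ?thesis using V by (auto simp: complete_L2_def closed_span_def)
qed

section \<open>The Fourier transform on \<open>L\<^sup>2(-\<pi>, \<pi>)\<close>\<close>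

lemma one_L2: "(\<lambda>t. 1) \<in> L2" by (simp add: L2_def)

lemma continuous_measurable_leb [measurable]:
  "continuous_on UNIV f \<Longrightarrow> f \<in> borel_measurable leb" for f :: "real \<Rightarrow> complex"
  by (simp add: continuous_imp_measurable_on_sets_lebesgue continuous_on_subset)

lemma ident_measurable_leb [measurable]: "(\<lambda>t. t) \<in> borel_measurable leb"
  by (simp add: continuous_imp_measurable_on_sets_lebesgue)

lemma L2_bounded:
  assumes "f \<in> borel_measurable leb" "\<And>t. t \<in> {-pi<..<pi} \<Longrightarrow> cmod (f t) \<le> C"
  shows "f \<in> L2"
  by (rule L2_I[OF assms(1) one_L2, of C]) (use assms in auto)

lemma L2_mult_bounded:
  assumes "f \<in> L2" "g \<in> borel_measurable leb" "\<And>t. t \<in> {-pi<..<pi} \<Longrightarrow> cmod (g t) \<le> C"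
  shows "(\<lambda>t. g t * f t) \<in> L2"
  by (rule L2_I[OF _ assms(1), of _ C])
    (use assms L2_meas[OF assms(1)] in \<open>auto simp: norm_mult intro!: mult_right_mono\<close>)

definition ft :: "(real \<Rightarrow> complex) \<Rightarrow> complex \<Rightarrow> complex" where
  "ft f z = (LINT t|leb. f t * exp (- (\<i> * z * of_real t)))"

lemma cmod_exp_bound:
  assumes "t \<in> {-pi<..<pi}" shows "cmod (exp (- (\<i> * z * of_real t))) \<le> exp (cmod z * pi)"
proof -
  have "cmod (exp (- (\<i> * z * of_real t))) \<le> exp (cmod (- (\<i> * z * of_real t)))" by (rule norm_exp)
  also have "\<dots> \<le> exp (cmod z * pi)" using assms by (auto simp: norm_mult intro!: mult_left_mono)
  finally show ?thesis .
qed

lemma exp_measurable [measurable]: "(\<lambda>t. exp (- (\<i> * z * of_real t))) \<in> borel_measurable leb"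
  by (intro continuous_measurable_leb continuous_intros)

lemma expo_L2: "expo \<mu> \<in> L2"
proof (rule L2_bounded)
  have e: "expo \<mu> = (\<lambda>t. exp (- (\<i> * (- \<mu>) * of_real t)))" by (simp add: expo_def fun_eq_iff)
  show "expo \<mu> \<in> borel_measurable leb" unfolding e by (rule exp_measurable)
  show "cmod (expo \<mu> t) \<le> exp (cmod (- \<mu>) * pi)" if "t \<in> {-pi<..<pi}" for t
    unfolding e by (rule cmod_exp_bound[OF that])
qed

text \<open>Evaluation at a complex point is an inner product too; linearity and the bound
  \<open>ft_bound\<close> are inherited from there.\<close>

lemma ft_eq_inner: "ft f z = inner_L2 f (expo (cnj z))"
  unfolding ft_def inner_L2_def expo_def by (simp add: exp_cnj)

lemma ft_real: "\<mu> \<in> \<real> \<Longrightarrow> ft f \<mu> = inner_L2 f (expo \<mu>)"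
  by (simp add: ft_eq_inner Reals_cnj_iff)

lemma ft_add: "f \<in> L2 \<Longrightarrow> g \<in> L2 \<Longrightarrow> ft (\<lambda>t. f t + g t) z = ft f z + ft g z"
  by (simp add: ft_eq_inner inner_L2_add_left expo_L2)

lemma ft_diff: "f \<in> L2 \<Longrightarrow> g \<in> L2 \<Longrightarrow> ft (\<lambda>t. f t - g t) z = ft f z - ft g z"
  by (simp add: ft_eq_inner inner_L2_diff_left expo_L2)

lemma ft_cmult: "ft (\<lambda>t. c * f t) z = c * ft f z"
  by (simp add: ft_eq_inner inner_L2_cmult_left)

lemma ft_sum: "(\<And>i. i \<in> A \<Longrightarrow> f i \<in> L2) \<Longrightarrow> ft (\<lambda>t. \<Sum>i\<in>A. f i t) z = (\<Sum>i\<in>A. ft (f i) z)"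
  by (simp add: ft_eq_inner inner_L2_sum_left expo_L2)

lemma ft_bound: "f \<in> L2 \<Longrightarrow> cmod (ft f z) \<le> norm_L2 (expo (cnj z)) * norm_L2 f"
  using L2_Cauchy_Schwarz[OF _ expo_L2, of f] by (simp add: ft_eq_inner mult.commute)

lemma ft_norm_0: "f \<in> L2 \<Longrightarrow> norm_L2 f = 0 \<Longrightarrow> ft f z = 0"
  using ft_bound[of f z] by simp

lemma ident_mult_L2: "f \<in> L2 \<Longrightarrow> (\<lambda>t. - \<i> * of_real t * f t) \<in> L2"
  by (rule L2_mult_bounded[of _ _ pi])
    (auto simp: norm_mult intro!: continuous_measurable_leb continuous_intros)

lemma L2_integrable: "f \<in> L2 \<Longrightarrow> integrable leb f" "f \<in> L2 \<Longrightarrow> integrable leb (\<lambda>t. cmod (f t))"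
  using L2_mult_integrable[OF _ one_L2, of f] by simp_all

lemma ft_integrable: "f \<in> L2 \<Longrightarrow> integrable leb (\<lambda>t. f t * exp (- (\<i> * z * of_real t)))"
  using L2_mult_integrable(1)[OF _ expo_L2, of f "cnj z"] by (simp add: expo_def exp_cnj)

text \<open>The form of the derivative matters: it is again the transform of a vector of the space,
  hence can be expanded along a Riesz basis of exponentials.\<close>

lemma has_field_derivative_ft:
  assumes f: "f \<in> L2"
  shows "(ft f has_field_derivative ft (\<lambda>t. - \<i> * of_real t * f t) z) (at z)"
proof -
  define p where "p = (\<lambda>t. - \<i> * of_real t * f t)"
  have p: "p \<in> L2" unfolding p_def by (rule ident_mult_L2[OF f])
  define K where "K = (LINT t|leb. cmod (f t)) * (exp (cmod z * pi) * (exp pi * pi\<^sup>2))"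
  have key: "cmod (ft f (z + h) - ft f z - h * ft p z) \<le> K * (cmod h)\<^sup>2" if h: "cmod h \<le> 1" for h
  proof -
    have "ft f (z + h) - ft f z - h * ft p z =
        (LINT t|leb. f t * exp (- (\<i> * (z + h) * of_real t)) - f t * exp (- (\<i> * z * of_real t))
           - h * (p t * exp (- (\<i> * z * of_real t))))"
      unfolding ft_def using ft_integrable[OF f, of z] ft_integrable[OF p, of z] ft_integrable[OF f, of "z+h"]
      by simp
    also have "cmod \<dots> \<le> (LINT t|leb. cmod (f t) * (exp (cmod z * pi) * (exp pi * pi\<^sup>2) * (cmod h)\<^sup>2))"
    proof (rule Bochner_Integration.integral_norm_bound_integral)
      show "integrable leb (\<lambda>t. cmod (f t) * (exp (cmod z * pi) * (exp pi * pi\<^sup>2) * (cmod h)\<^sup>2))"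
        by (intro integrable_mult_left L2_integrable f)
      fix t assume "t \<in> space leb"
      then have t: "t \<in> {-pi<..<pi}" by simp
      define w where "w = - (\<i> * h * of_real t)"
      have cw: "cmod w = cmod h * \<bar>t\<bar>" by (simp add: w_def norm_mult)
      have wpi: "cmod w \<le> cmod h * pi" unfolding cw using t by (intro mult_left_mono) auto
      also have "\<dots> \<le> pi" using h by (simp add: mult_left_le_one_le)
      finally have wpi': "cmod w \<le> pi" .
      \<comment> \<open>\<open>exp w - 1 - w\<close> is of second order in \<open>h\<close>,
        uniformly in \<open>t\<close>, because \<open>cmod w \<le> pi\<close>; the constant
        \<open>K\<close> stems from this remainder.\<close>
      have "cmod (exp w - (\<Sum>k\<le>1. w ^ k / fact k)) \<le> exp \<bar>Re w\<bar> * cmod w ^ Suc 1 / fact 1"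
        by (rule Taylor_exp)
      also have "\<dots> \<le> exp pi * (cmod w)\<^sup>2"
        using abs_Re_le_cmod[of w] wpi' by (simp add: power2_eq_square mult_right_mono)
      also have "\<dots> \<le> exp pi * (cmod h * pi)\<^sup>2"
        using wpi by (intro mult_left_mono power_mono) auto
      finally have *: "cmod (exp w - 1 - w) \<le> exp pi * pi\<^sup>2 * (cmod h)\<^sup>2"
        by (simp add: power_mult_distrib diff_diff_eq mult_ac)
      have "f t * exp (- (\<i> * (z + h) * of_real t)) - f t * exp (- (\<i> * z * of_real t))
           - h * (p t * exp (- (\<i> * z * of_real t))) = f t * (exp (- (\<i> * z * of_real t)) * (exp w - 1 - w))"
        by (simp add: w_def p_def ring_distribs exp_add[symmetric] exp_diff algebra_simps flip: exp_add)
      also have "cmod \<dots> \<le> cmod (f t) * (exp (cmod z * pi) * (exp pi * pi\<^sup>2 * (cmod h)\<^sup>2))"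
        unfolding norm_mult using * cmod_exp_bound[OF t, of z] by (intro mult_mono) auto
      finally show "cmod (f t * exp (- (\<i> * (z + h) * of_real t)) - f t * exp (- (\<i> * z * of_real t))
           - h * (p t * exp (- (\<i> * z * of_real t)))) \<le> cmod (f t) * (exp (cmod z * pi) * (exp pi * pi\<^sup>2) * (cmod h)\<^sup>2)"
        by (simp add: mult.assoc)
    qed (use ft_integrable[OF f] ft_integrable[OF p] in auto)
    also have "\<dots> = K * (cmod h)\<^sup>2" by (simp add: K_def)
    finally show ?thesis .
  qed
  have "((\<lambda>h. (ft f (z + h) - ft f z) / h - ft p z) \<longlongrightarrow> 0) (at 0)"
  proof (rule Lim_null_comparison)
    show "((\<lambda>h. K * cmod h) \<longlongrightarrow> 0) (at (0::complex))"
      by (auto intro!: tendsto_eq_intros)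
    have "eventually (\<lambda>h. h \<noteq> 0 \<and> cmod h < 1) (at (0::complex))"
      unfolding eventually_at by (intro exI[of _ 1]) auto
    then show "\<forall>\<^sub>F h in at 0. cmod ((ft f (z + h) - ft f z) / h - ft p z) \<le> K * cmod h"
    proof eventually_elim
      case (elim h)
      then have "(ft f (z + h) - ft f z) / h - ft p z = (ft f (z + h) - ft f z - h * ft p z) / h"
        by (simp add: field_simps)
      then show ?case using key[of h] elim
        by (simp add: norm_divide divide_le_eq power2_eq_square mult.assoc)
    qed
  qed
  then have "((\<lambda>h. (ft f (z + h) - ft f z) / h) \<longlongrightarrow> ft p z) (at 0)"
    by (simp add: LIM_zero_iff)
  then show ?thesis by (simp add: DERIV_def p_def)
qed

lemma integral_exp_tail:
  assumes s: "s \<in> {-pi..<pi}" and x: "x \<noteq> 0"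
  shows "(LINT t|leb. indicator {s<..} t * exp (- (\<i> * x * of_real t)))
      = (exp (- (\<i> * x * of_real s)) - exp (- (\<i> * x * of_real pi))) / (\<i> * x)"
proof -
  let ?e = "\<lambda>t::real. exp (- (\<i> * x * of_real t))"
  have "((\<lambda>t. ?e t) has_integral (- ?e pi / (\<i> * x)) - (- ?e s / (\<i> * x))) {s..pi}"
  proof (rule fundamental_theorem_of_calculus)
    show "((\<lambda>t. - ?e t / (\<i> * x)) has_vector_derivative ?e t) (at t within {s..pi})" for t
    proof -
      have "((\<lambda>z. - exp (- (\<i> * x * z)) / (\<i> * x)) has_field_derivative ?e t) (at (of_real t))"
        using x by (auto intro!: derivative_eq_intros)
      then show ?thesis
        using has_vector_derivative_at_within has_vector_derivative_real_field by blast
    qed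
  qed (use s in auto)
  then have "(?e has_integral (?e s - ?e pi) / (\<i> * x)) {s<..<pi}"
    by (simp add: has_integral_Icc_iff_Ioo diff_divide_distrib)
  then have "((\<lambda>t. if t \<in> {s<..<pi} then ?e t else 0) has_integral (?e s - ?e pi) / (\<i> * x)) {-pi<..<pi}"
    using s by (subst has_integral_restrict) auto
  then have h: "((\<lambda>t. indicator {s<..} t * ?e t) has_integral (?e s - ?e pi) / (\<i> * x)) {-pi<..<pi}"
    by (rule has_integral_eq[rotated]) (auto simp: indicator_def)
  have [measurable]: "(\<lambda>t. indicator {s<..} t :: complex) \<in> borel_measurable leb"
    by (rule measurable_compose[OF ident_measurable_leb]) simp
  have "(\<lambda>t. indicator {s<..} t * ?e t) \<in> L2"
    by (rule L2_bounded[of _ "exp (cmod x * pi)"])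
      (use cmod_exp_bound[of _ x] in \<open>auto simp: indicator_def\<close>)
  then have "integrable leb (\<lambda>t. indicator {s<..} t * ?e t)" by (rule L2_integrable)
  then show ?thesis
    using h by (subst lebesgue_integral_eq_integral) (auto dest: integral_unique)
qed

text \<open>Up to the factor \<open>\<i> exp (\<i> w t)\<close>, the quotient of the transform by \<open>z - w\<close> is the transform of the
  primitive of \<open>f t exp (- \<i> w t)\<close>, which vanishes at both end points.\<close>
lemma ft_divide_root:
  assumes f: "f \<in> L2" and w: "ft f w = 0"
  obtains q where "q \<in> L2" "\<And>z. ft f z = (z - w) * ft q z"
proof -
  interpret P: pair_sigma_finite leb leb
    by (simp add: pair_sigma_finite_def leb.sigma_finite_measure_axioms)
  define \<phi> where "\<phi> s = f s * exp (- (\<i> * w * of_real s))" for s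
  have f_meas [measurable]: "f \<in> borel_measurable leb" using f by (rule L2_meas)
  have [measurable]: "\<phi> \<in> borel_measurable leb" unfolding \<phi>_def by measurable
  have \<phi>i: "integrable leb \<phi>" unfolding \<phi>_def by (rule ft_integrable[OF f])
  define A where "A = {p \<in> space (leb \<Otimes>\<^sub>M leb). fst p < snd p}"
  have [measurable]: "A \<in> sets (leb \<Otimes>\<^sub>M leb)"
    unfolding A_def by measurable
  have G_meas: "(\<lambda>(s, t). indicator {s<..} t * \<phi> s * exp (- (\<i> * x * of_real t))) \<in> borel_measurable (leb \<Otimes>\<^sub>M leb)" for x
  proof -
    have "(\<lambda>p. indicator A p * \<phi> (fst p) * exp (- (\<i> * x * of_real (snd p)))) \<in> borel_measurable (leb \<Otimes>\<^sub>M leb)"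
      by measurable
    then show ?thesis
      by (rule measurable_cong[THEN iffD1, rotated]) (auto simp: A_def indicator_def space_pair_measure split: prod.splits)
  qed
  \<comment> \<open>The integral of \<open>\<phi>\<close> up to \<open>t\<close>. The indicator
    makes it a parameter integral over a fixed set, as measurability and Fubini require.\<close>
  define \<Phi> where "\<Phi> t = (LINT s|leb. indicator {s<..} t * \<phi> s)" for t
  have "(\<lambda>(t, s). indicator {s<..} t * \<phi> s) \<in> borel_measurable (leb \<Otimes>\<^sub>M leb)"
    using measurable_pair_swap[OF G_meas[of 0]] by (simp add: case_prod_beta)
  then have [measurable]: "\<Phi> \<in> borel_measurable leb"
    unfolding \<Phi>_def by (rule leb.borel_measurable_lebesgue_integral)
  have \<Phi>_bd: "cmod (\<Phi> t) \<le> (LINT s|leb. cmod (\<phi> s))" for t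
  proof -
    have "cmod (\<Phi> t) \<le> (LINT s|leb. cmod (indicator {s<..} t * \<phi> s))"
      unfolding \<Phi>_def by (rule integral_norm_bound)
    also have "\<dots> \<le> (LINT s|leb. cmod (\<phi> s))"
      using \<phi>i by (intro Bochner_Integration.integral_mono') (auto simp: indicator_def)
    finally show ?thesis .
  qed
  define q where "q t = exp (- (\<i> * (- w) * of_real t)) * (\<i> * \<Phi> t)" for t
  have q: "q \<in> L2" unfolding q_def
  proof (rule L2_mult_bounded[OF L2_cmult[OF L2_bounded]])
    show "cmod (\<Phi> t) \<le> (LINT s|leb. cmod (\<phi> s))" for t by (rule \<Phi>_bd)
    show "cmod (exp (- (\<i> * (- w) * of_real t))) \<le> exp (cmod (- w) * pi)" if "t \<in> {-pi<..<pi}" for t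
      by (rule cmod_exp_bound[OF that])
  qed auto
  have "ft f z = (z - w) * ft q z" for z
  proof (cases "z = w")
    case False
    define x where "x = z - w"
    have x: "x \<noteq> 0" using False by (simp add: x_def)
    let ?g = "\<lambda>s t. indicator {s<..} t * \<phi> s * exp (- (\<i> * x * of_real t))"
    let ?C = "exp (cmod x * pi)"
    have gi: "integrable (leb \<Otimes>\<^sub>M leb) (\<lambda>(s, t). ?g s t)"
    proof (rule Bochner_Integration.integrable_bound)
      show "integrable (leb \<Otimes>\<^sub>M leb) (\<lambda>p. \<phi> (fst p) * ?C)"
      proof (rule P.Fubini_integrable)
        show "integrable leb (\<lambda>s. LINT t|leb. norm (\<phi> (fst (s, t)) * ?C))"
          using \<phi>i by (simp add: norm_mult)
      qed (auto intro!: AE_I2)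
      show "AE p in leb \<Otimes>\<^sub>M leb. norm (case p of (s, t) \<Rightarrow> ?g s t) \<le> norm (\<phi> (fst p) * ?C)"
        using cmod_exp_bound[of _ x]
        by (intro AE_I2) (auto simp: space_pair_measure norm_mult indicator_def intro!: mult_left_mono)
    qed (rule G_meas)
    have "ft q z = (LINT t|leb. \<i> * (LINT s|leb. ?g s t))"
      unfolding ft_def
    proof (rule Bochner_Integration.integral_cong)
      fix t
      have e: "exp (- (\<i> * (- w) * of_real t)) * exp (- (\<i> * z * of_real t)) = exp (- (\<i> * x * of_real t))"
        by (simp add: x_def algebra_simps flip: exp_add)
      have "q t * exp (- (\<i> * z * of_real t)) = \<i> * (\<Phi> t * (exp (- (\<i> * (- w) * of_real t)) * exp (- (\<i> * z * of_real t))))"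
        by (simp only: q_def mult_ac)
      moreover have "(LINT s|leb. ?g s t) = \<Phi> t * exp (- (\<i> * x * of_real t))" by (simp add: \<Phi>_def)
      ultimately show "q t * exp (- (\<i> * z * of_real t)) = \<i> * (LINT s|leb. ?g s t)"
        by (simp only: e)
    qed simp
    also have "\<dots> = \<i> * (LINT t|leb. (LINT s|leb. ?g s t))" by simp
    also have "(LINT t|leb. (LINT s|leb. ?g s t)) = (LINT s|leb. (LINT t|leb. ?g s t))"
      using gi by (rule P.Fubini_integral)
    also have "\<dots> = (LINT s|leb. \<phi> s * exp (- (\<i> * x * of_real s)) / (\<i> * x) - exp (- (\<i> * x * of_real pi)) / (\<i> * x) * \<phi> s)"
    proof (rule Bochner_Integration.integral_cong)
      fix s assume "s \<in> space leb"
      then have s: "s \<in> {-pi..<pi}" by simp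
      have "(LINT t|leb. ?g s t) = (LINT t|leb. \<phi> s * (indicator {s<..} t * exp (- (\<i> * x * of_real t))))"
        by (simp add: mult_ac)
      also have "\<dots> = \<phi> s * (LINT t|leb. indicator {s<..} t * exp (- (\<i> * x * of_real t)))" by simp
      finally show "(LINT t|leb. ?g s t) = \<phi> s * exp (- (\<i> * x * of_real s)) / (\<i> * x) - exp (- (\<i> * x * of_real pi)) / (\<i> * x) * \<phi> s"
        unfolding integral_exp_tail[OF s x] by (simp add: diff_divide_distrib right_diff_distrib)
    qed simp
    also have "(\<lambda>s. \<phi> s * exp (- (\<i> * x * of_real s))) = (\<lambda>s. f s * exp (- (\<i> * z * of_real s)))"
    proof
      fix s
      have "exp (- (\<i> * w * of_real s)) * exp (- (\<i> * x * of_real s)) = exp (- (\<i> * z * of_real s))"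
        by (simp add: x_def algebra_simps flip: exp_add)
      then show "\<phi> s * exp (- (\<i> * x * of_real s)) = f s * exp (- (\<i> * z * of_real s))"
        unfolding \<phi>_def by (metis mult.assoc)
    qed
    \<comment> \<open>The end point \<open>pi\<close> contributes a multiple of
      \<open>ft f w\<close>, and the root removes exactly this term.\<close>
    also have "(LINT s|leb. f s * exp (- (\<i> * z * of_real s)) / (\<i> * x) - exp (- (\<i> * x * of_real pi)) / (\<i> * x) * \<phi> s)
        = ft f z / (\<i> * x) - exp (- (\<i> * x * of_real pi)) / (\<i> * x) * ft f w"
    proof -
      have "ft f w = (LINT s|leb. \<phi> s)" by (simp add: ft_def \<phi>_def)
      moreover have "integrable leb (\<lambda>s. f s * exp (- (\<i> * z * of_real s)) / (\<i> * x))"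
        by (intro integrable_divide ft_integrable f)
      moreover have "integrable leb (\<lambda>s. exp (- (\<i> * x * of_real pi)) / (\<i> * x) * \<phi> s)"
        by (intro integrable_mult_right \<phi>i)
      ultimately show ?thesis
        by (subst Bochner_Integration.integral_diff) (simp_all add: ft_def)
    qed
    finally show ?thesis using x w by (simp add: x_def)
  qed (simp add: w)
  with q show ?thesis by (rule that)
qed

section \<open>Dual systems and Riesz bases of exponentials\<close>

text \<open>Closes the duality estimates below: there a finite sum of squares is tested against
  itself and so is bounded by a multiple of its own root.\<close>

lemma le_square_of_le_mult_sqrt:
  assumes "0 \<le> S" "0 \<le> M" "S \<le> M * sqrt S" shows "S \<le> M\<^sup>2"
proof (cases "S = 0")
  case False
  then have "sqrt S * sqrt S \<le> M * sqrt S" "sqrt S > 0" using assms by auto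
  then have "sqrt S \<le> M" by (simp only: mult_le_cancel_right_pos)
  then show ?thesis using assms by (simp add: sqrt_le_D)
qed (use assms in auto)

text \<open>The common ground of the two systems; the Riesz basis has norm bounds in addition.
  Frequencies are complex numbers on the real axis, so that they can be arguments of the entire
  functions \<open>ft f\<close>.\<close>

locale dual_exponentials =
  fixes I :: "complex set" and d :: "complex \<Rightarrow> real \<Rightarrow> complex"
  assumes freq_real: "I \<subseteq> \<real>"
    and complete: "\<And>f. f \<in> L2 \<Longrightarrow> (\<And>\<mu>. \<mu> \<in> I \<Longrightarrow> ft f \<mu> = 0) \<Longrightarrow> norm_L2 f = 0"
    and dual_L2: "\<And>\<mu>. \<mu> \<in> I \<Longrightarrow> d \<mu> \<in> L2"
    and ft_dual: "\<And>\<mu> \<nu>. \<mu> \<in> I \<Longrightarrow> \<nu> \<in> I \<Longrightarrow> ft (d \<mu>) \<nu> = (if \<mu> = \<nu> then 1 else 0)"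
begin

lemma ft_eq_0:
  assumes "f \<in> L2" "\<And>\<mu>. \<mu> \<in> I \<Longrightarrow> ft f \<mu> = 0" shows "ft f z = 0"
  using complete[OF assms] ft_norm_0[OF assms(1)] by blast

lemma norm_diff_eq_0:
  assumes "f \<in> L2" "g \<in> L2" "\<And>\<mu>. \<mu> \<in> I \<Longrightarrow> ft f \<mu> = ft g \<mu>"
  shows "norm_L2 (\<lambda>t. f t - g t) = 0"
  by (intro complete L2_diff) (use assms in \<open>auto simp: ft_diff\<close>)

lemma ft_eq:
  assumes "f \<in> L2" "g \<in> L2" "\<And>\<mu>. \<mu> \<in> I \<Longrightarrow> ft f \<mu> = ft g \<mu>"
  shows "ft f z = ft g z"
  using ft_norm_0[OF L2_diff norm_diff_eq_0[OF assms], of z] assms by (simp add: ft_diff)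

lemma ft_dual_divide:
  assumes a: "a \<in> I" and w: "ft (d a) w = 0"
  obtains p where "p \<in> L2" "\<And>z. (z - w) * ft p z = (z - a) * ft (d a) z"
    "\<And>\<mu>. \<mu> \<in> I \<Longrightarrow> \<mu> \<noteq> w \<Longrightarrow> ft p \<mu> = 0"
proof -
  obtain q where q: "q \<in> L2" "\<And>z. ft (d a) z = (z - w) * ft q z"
    using ft_divide_root[OF dual_L2[OF a] w] by blast
  \<comment> \<open>\<open>(z - a) / (z - w) = 1 + (w - a) / (z - w)\<close>: exchanging the root
    \<open>w\<close> for \<open>a\<close> needs no multiplication by \<open>z\<close>, which could
    lead out of the space.\<close>
  define p where "p t = d a t + (w - a) * q t" for t
  have p: "p \<in> L2" unfolding p_def using q a by (intro L2_add L2_cmult dual_L2)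
  have ftp: "ft p z = (z - a) * ft q z" for z
    unfolding p_def using q a by (simp add: ft_add L2_cmult dual_L2 ft_cmult) (simp add: algebra_simps)
  have "ft p \<mu> = 0" if "\<mu> \<in> I" "\<mu> \<noteq> w" for \<mu>
    using q(2)[of \<mu>] ft_dual[OF a that(1)] that by (auto simp: ftp split: if_splits)
  then show ?thesis using that[OF p] q(2) by (simp add: ftp)
qed

lemma ft_dual_punctured:
  assumes a: "a \<in> I" shows "\<exists>z. z \<noteq> a \<and> ft (d a) z \<noteq> 0"
proof (rule ccontr)
  assume "\<not> ?thesis"
  then have "eventually (\<lambda>z. ft (d a) z = 0) (at a)"
    by (auto simp: eventually_at_topological)
  then have "(ft (d a) \<longlongrightarrow> 0) (at a)" by (rule tendsto_eventually)
  moreover have "isCont (ft (d a)) a"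
    by (intro DERIV_isCont[OF has_field_derivative_ft] dual_L2 a)
  ultimately have "ft (d a) a = 0" using LIM_unique isCont_def by blast
  then show False using ft_dual[OF a a] by simp
qed

text \<open>An additional root could be exchanged for \<open>a\<close>; the result would vanish at
  all frequencies, and then everywhere by completeness.\<close>

lemma ft_dual_nonzero:
  assumes a: "a \<in> I" and w: "w \<notin> I" shows "ft (d a) w \<noteq> 0"
proof
  assume 0: "ft (d a) w = 0"
  obtain p where p: "p \<in> L2" "\<And>z. (z - w) * ft p z = (z - a) * ft (d a) z"
    "\<And>\<mu>. \<mu> \<in> I \<Longrightarrow> \<mu> \<noteq> w \<Longrightarrow> ft p \<mu> = 0"
    by (rule ft_dual_divide[OF a 0]) (rule that)
  have "ft p z = 0" for z by (rule ft_eq_0[OF p(1)]) (use p(3) w in metis)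
  then show False using p(2) ft_dual_punctured[OF a] by auto
qed

text \<open>Exchanging the root \<open>b\<close> of \<open>ft (d a)\<close> for \<open>a\<close>
  gives a transform that vanishes at all frequencies except \<open>b\<close>, thus a multiple of
  \<open>ft (d b)\<close>.\<close>

lemma ft_dual_ratio:
  assumes a: "a \<in> I" and b: "b \<in> I"
  obtains \<gamma> where "\<gamma> \<noteq> 0" "\<And>z. (z - a) * ft (d a) z = \<gamma> * ((z - b) * ft (d b) z)"
proof (cases "a = b")
  case False
  then have 0: "ft (d a) b = 0" using ft_dual[OF a b] by simp
  obtain p where p: "p \<in> L2" "\<And>z. (z - b) * ft p z = (z - a) * ft (d a) z"
    "\<And>\<mu>. \<mu> \<in> I \<Longrightarrow> \<mu> \<noteq> b \<Longrightarrow> ft p \<mu> = 0"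
    by (rule ft_dual_divide[OF a 0]) (rule that)
  have pb: "ft p z = ft p b * ft (d b) z" for z
  proof -
    have "ft p z = ft (\<lambda>t. ft p b * d b t) z"
      by (rule ft_eq) (use p(1,3) b in \<open>auto simp: L2_cmult dual_L2 ft_cmult ft_dual\<close>)
    then show ?thesis by (simp only: ft_cmult)
  qed
  have eq: "(z - a) * ft (d a) z = ft p b * ((z - b) * ft (d b) z)" for z
    using p(2)[of z] by (subst (asm) pb) (simp only: mult_ac)
  show ?thesis
  proof (rule that[OF _ eq])
    obtain z where "z \<noteq> a" "ft (d a) z \<noteq> 0" using ft_dual_punctured[OF a] by blast
    then have "(z - a) * ft (d a) z \<noteq> 0" by simp
    then show "ft p b \<noteq> 0" unfolding eq[of z] by simp
  qed
qed (use that[of 1] in simp)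

end

text \<open>Both inequalities of a Riesz basis, in terms of the transform. Square summability of the
  data \<open>c\<close> is a uniform bound \<open>B\<close> on finite sums, which passes directly
  into the norm estimate.\<close>

locale riesz_exponentials = dual_exponentials I d
  for I :: "complex set" and d :: "complex \<Rightarrow> real \<Rightarrow> complex" +
  fixes K :: real
  assumes K_nonneg: "0 \<le> K"
    and bessel: "\<And>f A. f \<in> L2 \<Longrightarrow> finite A \<Longrightarrow> A \<subseteq> I \<Longrightarrow> (\<Sum>\<mu>\<in>A. (cmod (ft f \<mu>))\<^sup>2) \<le> K * (norm_L2 f)\<^sup>2"
    and interpolation: "\<And>c B. (\<And>A. finite A \<Longrightarrow> A \<subseteq> I \<Longrightarrow> (\<Sum>\<mu>\<in>A. (cmod (c \<mu>))\<^sup>2) \<le> B) \<Longrightarrow>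
      \<exists>k\<in>L2. (\<forall>\<mu>\<in>I. ft k \<mu> = c \<mu>) \<and> (norm_L2 k)\<^sup>2 \<le> K * B"
begin

text \<open>By uniqueness, the interpolant of the data of \<open>f\<close> is \<open>f\<close> up to
  a null function; this gives the lower Riesz bound.\<close>

lemma norm_L2_le:
  assumes "f \<in> L2" "\<And>A. finite A \<Longrightarrow> A \<subseteq> I \<Longrightarrow> (\<Sum>\<mu>\<in>A. (cmod (ft f \<mu>))\<^sup>2) \<le> B"
  shows "(norm_L2 f)\<^sup>2 \<le> K * B"
proof -
  obtain k where k: "k \<in> L2" "\<And>\<mu>. \<mu> \<in> I \<Longrightarrow> ft k \<mu> = ft f \<mu>" "(norm_L2 k)\<^sup>2 \<le> K * B"
    using interpolation[of "ft f"] assms(2) by blast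
  have "norm_L2 (\<lambda>t. f t - k t) = 0" using assms k by (intro norm_diff_eq_0) auto
  moreover have "norm_L2 (\<lambda>t. (f t - k t) + k t) \<le> norm_L2 (\<lambda>t. f t - k t) + norm_L2 k"
    by (intro norm_L2_triangle L2_diff assms k)
  ultimately have "norm_L2 f \<le> norm_L2 k" by simp
  then have "(norm_L2 f)\<^sup>2 \<le> (norm_L2 k)\<^sup>2" by (intro power_mono) auto
  then show ?thesis using k by linarith
qed

lemma ft_sq_summable:
  assumes "f \<in> L2" shows "(\<lambda>\<mu>. (cmod (ft f \<mu>))\<^sup>2) summable_on I"
  by (rule nonneg_bdd_above_summable_on)
    (use bessel[OF assms] in \<open>auto intro!: bdd_aboveI[of _ "K * (norm_L2 f)\<^sup>2"]\<close>)

lemma ft_finite_sum_dual: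
  assumes "finite A" "A \<subseteq> I" "\<mu> \<in> I"
  shows "ft (\<lambda>t. \<Sum>\<zeta>\<in>A. c \<zeta> * d \<zeta> t) \<mu> = (if \<mu> \<in> A then c \<mu> else 0)"
proof -
  have "ft (\<lambda>t. \<Sum>\<zeta>\<in>A. c \<zeta> * d \<zeta> t) \<mu> = (\<Sum>\<zeta>\<in>A. c \<zeta> * ft (d \<zeta>) \<mu>)"
    using assms by (simp add: ft_sum L2_cmult dual_L2 subset_iff ft_cmult)
  also have "\<dots> = (\<Sum>\<zeta>\<in>A. if \<zeta> = \<mu> then c \<mu> else 0)"
    using assms by (intro sum.cong) (auto simp: ft_dual)
  finally show ?thesis using assms by simp
qed

text \<open>The error of a partial sum has the coefficients of \<open>f\<close> outside the finite
  set, so \<open>norm_L2_le\<close> bounds it by a tail. Convergence is stated after pairing with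
  \<open>h\<close>: an exponential for \<open>h\<close> gives Lagrange interpolation at a point, the
  orthogonal vector gives the relations of the last section.\<close>

lemma expansion:
  assumes f: "f \<in> L2" and h: "h \<in> L2"
  shows "((\<lambda>\<mu>. ft f \<mu> * inner_L2 (d \<mu>) h) has_sum inner_L2 f h) I"
proof -
  define S where "S = infsum (\<lambda>\<mu>. (cmod (ft f \<mu>))\<^sup>2) I"
  let ?s = "\<lambda>A. \<Sum>\<mu>\<in>A. (cmod (ft f \<mu>))\<^sup>2"
  have S: "((\<lambda>\<mu>. (cmod (ft f \<mu>))\<^sup>2) has_sum S) I"
    unfolding S_def using ft_sq_summable[OF f] by (rule has_sum_infsum)
  let ?P = "\<lambda>A t. \<Sum>\<zeta>\<in>A. ft f \<zeta> * d \<zeta> t"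
  have est: "cmod ((\<Sum>\<mu>\<in>A. ft f \<mu> * inner_L2 (d \<mu>) h) - inner_L2 f h) \<le> norm_L2 h * sqrt (K * (S - ?s A))"
    if A: "finite A" "A \<subseteq> I" for A
  proof -
    have P: "?P A \<in> L2" using A by (intro L2_sum L2_cmult dual_L2) auto
    have "(norm_L2 (\<lambda>t. f t - ?P A t))\<^sup>2 \<le> K * (S - ?s A)"
    proof (rule norm_L2_le)
      fix A' assume A': "finite A'" "A' \<subseteq> I"
      have "(\<Sum>\<mu>\<in>A'. (cmod (ft (\<lambda>t. f t - ?P A t) \<mu>))\<^sup>2) = (\<Sum>\<mu>\<in>A'. if \<mu> \<in> A then 0 else (cmod (ft f \<mu>))\<^sup>2)"
        using A A' by (intro sum.cong) (auto simp: ft_diff f P ft_finite_sum_dual)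
      also have "\<dots> = ?s (A' - A)"
        using A' by (intro sum.mono_neutral_cong_right) auto
      also have "\<dots> = ?s (A \<union> (A' - A)) - ?s A" using A A' by (subst sum.union_disjoint) auto
      also have "\<dots> \<le> S - ?s A"
        using finite_sum_le_has_sum[OF S, of "A \<union> (A' - A)"] A A' by auto
      finally show "(\<Sum>\<mu>\<in>A'. (cmod (ft (\<lambda>t. f t - ?P A t) \<mu>))\<^sup>2) \<le> S - ?s A" .
    qed (intro L2_diff f P)
    then have le: "norm_L2 (\<lambda>t. f t - ?P A t) \<le> sqrt (K * (S - ?s A))" by (rule real_le_rsqrt)
    have eq: "inner_L2 (\<lambda>t. f t - ?P A t) h = inner_L2 f h - (\<Sum>\<mu>\<in>A. ft f \<mu> * inner_L2 (d \<mu>) h)"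
      using A f h P by (simp add: inner_L2_diff_left inner_L2_sum_left L2_cmult dual_L2 subset_iff inner_L2_cmult_left)
    have "cmod (inner_L2 f h - (\<Sum>\<mu>\<in>A. ft f \<mu> * inner_L2 (d \<mu>) h)) \<le> norm_L2 (\<lambda>t. f t - ?P A t) * norm_L2 h"
      using L2_Cauchy_Schwarz[OF L2_diff[OF f P] h] by (simp only: eq)
    also have "\<dots> \<le> sqrt (K * (S - ?s A)) * norm_L2 h" by (intro mult_right_mono le) simp
    finally show ?thesis by (simp only: norm_minus_commute mult.commute)
  qed
  have "(?s \<longlongrightarrow> S) (finite_subsets_at_top I)" using S by (simp add: has_sum_def)
  then have "((\<lambda>A. norm_L2 h * sqrt (K * (S - ?s A))) \<longlongrightarrow> norm_L2 h * sqrt (K * (S - S))) (finite_subsets_at_top I)"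
    by (intro tendsto_intros)
  then have "((\<lambda>A. norm_L2 h * sqrt (K * (S - ?s A))) \<longlongrightarrow> 0) (finite_subsets_at_top I)" by simp
  then have "((\<lambda>A. (\<Sum>\<mu>\<in>A. ft f \<mu> * inner_L2 (d \<mu>) h) - inner_L2 f h) \<longlongrightarrow> 0) (finite_subsets_at_top I)"
    by (rule Lim_null_comparison[rotated])
      (use est in \<open>auto intro!: eventually_finite_subsets_at_top_weakI\<close>)
  then show ?thesis by (simp add: has_sum_def LIM_zero_iff)
qed

lemma ft_expansion:
  assumes f: "f \<in> L2" shows "((\<lambda>\<mu>. ft f \<mu> * ft (d \<mu>) z) has_sum ft f z) I"
  using expansion[OF f expo_L2, of "cnj z"] by (simp add: ft_eq_inner)

lemma dual_bessel:
  assumes h: "h \<in> L2" and A: "finite A" "A \<subseteq> I"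
  shows "(\<Sum>\<mu>\<in>A. (cmod (inner_L2 (d \<mu>) h))\<^sup>2) \<le> K * (norm_L2 h)\<^sup>2"
proof -
  let ?b = "\<lambda>\<mu>. inner_L2 (d \<mu>) h"
  define S where "S = (\<Sum>\<mu>\<in>A. (cmod (?b \<mu>))\<^sup>2)"
  have S0: "0 \<le> S" unfolding S_def by (intro sum_nonneg) auto
  \<comment> \<open>Conjugate coefficients, so that the pairing of \<open>?x\<close> with
    \<open>h\<close> is the sum of squares itself.\<close>
  let ?x = "\<lambda>t. \<Sum>\<mu>\<in>A. cnj (?b \<mu>) * d \<mu> t"
  have x: "?x \<in> L2" using A by (intro L2_sum L2_cmult dual_L2) auto
  have "inner_L2 ?x h = (\<Sum>\<mu>\<in>A. cnj (?b \<mu>) * ?b \<mu>)"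
    using A h by (simp add: inner_L2_sum_left L2_cmult dual_L2 subset_iff inner_L2_cmult_left)
  also have "\<dots> = of_real S"
    by (simp add: S_def complex_norm_square mult.commute del: of_real_power)
  finally have "S = cmod (inner_L2 ?x h)" using S0 by simp
  also have "\<dots> \<le> norm_L2 ?x * norm_L2 h" by (rule L2_Cauchy_Schwarz[OF x h])
  also have "(norm_L2 ?x)\<^sup>2 \<le> K * S"
  proof (rule norm_L2_le[OF x])
    fix A' assume A': "finite A'" "A' \<subseteq> I"
    have "(\<Sum>\<mu>\<in>A'. (cmod (ft ?x \<mu>))\<^sup>2) = (\<Sum>\<mu>\<in>A'. if \<mu> \<in> A then (cmod (?b \<mu>))\<^sup>2 else 0)"
      using A A' by (intro sum.cong) (auto simp: ft_finite_sum_dual)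
    also have "\<dots> = (\<Sum>\<mu>\<in>A' \<inter> A. (cmod (?b \<mu>))\<^sup>2)"
      using A' by (simp add: sum.inter_restrict)
    also have "\<dots> \<le> S" unfolding S_def using A by (intro sum_mono2) auto
    finally show "(\<Sum>\<mu>\<in>A'. (cmod (ft ?x \<mu>))\<^sup>2) \<le> S" .
  qed
  then have "norm_L2 ?x \<le> sqrt (K * S)" by (rule real_le_rsqrt)
  then have "norm_L2 ?x * norm_L2 h \<le> (sqrt K * norm_L2 h) * sqrt S"
    using mult_right_mono[of "norm_L2 ?x" "sqrt K * sqrt S" "norm_L2 h"]
    by (simp only: real_sqrt_mult mult_ac norm_L2_nonneg)
  finally have "S \<le> (sqrt K * norm_L2 h)\<^sup>2"
    using S0 K_nonneg by (intro le_square_of_le_mult_sqrt) auto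
  then show ?thesis using K_nonneg by (simp add: power_mult_distrib S_def)
qed

end

section \<open>From the operator form of a Riesz basis to bounds on the transform\<close>

lemma complete_L2_expo:
  assumes "complete_L2 (expo ` I)" "I \<subseteq> \<real>" "f \<in> L2" "\<And>\<mu>. \<mu> \<in> I \<Longrightarrow> ft f \<mu> = 0"
  shows "norm_L2 f = 0"
proof (rule complete_L2_orthogonal[OF assms(1,3)])
  fix v assume "v \<in> expo ` I"
  then obtain \<mu> where "\<mu> \<in> I" "v = expo \<mu>" by blast
  then show "inner_L2 f v = 0" using assms(2) assms(4)[of \<mu>] ft_real[of \<mu> f] by auto
qed

lemma bounded_operator_L2: "bounded_operator T \<Longrightarrow> f \<in> L2 \<Longrightarrow> T f \<in> L2"
  by (simp add: bounded_operator_def)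

lemma bounded_operator_bound:
  assumes "bounded_operator T"
  obtains C where "0 \<le> C" "\<And>f. f \<in> L2 \<Longrightarrow> norm_L2 (T f) \<le> C * norm_L2 f"
proof -
  obtain C where C: "\<And>f. f \<in> L2 \<Longrightarrow> norm_L2 (T f) \<le> C * norm_L2 f"
    using assms unfolding bounded_operator_def by blast
  have "C * norm_L2 f \<le> \<bar>C\<bar> * norm_L2 f" for f by (intro mult_right_mono) auto
  then show ?thesis using that[of "\<bar>C\<bar>"] C order_trans by (metis abs_ge_zero)
qed

lemma eq_L2_inner: "eq_L2 f g \<Longrightarrow> f \<in> L2 \<Longrightarrow> g \<in> L2 \<Longrightarrow> h \<in> L2 \<Longrightarrow> inner_L2 f h = inner_L2 g h"
  by (intro inner_L2_eq_L2 eq_L2_norm_diff)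

text \<open>Operators act on functions but are linear only almost everywhere; pairing with a fixed
  \<open>h\<close> turns such statements into equations between numbers.\<close>

lemma bounded_operator_inner_linear:
  assumes T: "bounded_operator T" and "f \<in> L2" "g \<in> L2" "h \<in> L2"
  shows "inner_L2 (T (\<lambda>t. a * f t + b * g t)) h = a * inner_L2 (T f) h + b * inner_L2 (T g) h"
proof -
  have "eq_L2 (T (\<lambda>t. a * f t + b * g t)) (\<lambda>t. a * T f t + b * T g t)"
    using T assms by (auto simp: bounded_operator_def)
  then have "inner_L2 (T (\<lambda>t. a * f t + b * g t)) h = inner_L2 (\<lambda>t. a * T f t + b * T g t) h"
    using assms by (intro eq_L2_inner) (auto intro!: L2_intros bounded_operator_L2[OF T])
  then show ?thesis
    using assms by (simp add: inner_L2_add_left L2_cmult bounded_operator_L2[OF T] inner_L2_cmult_left)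
qed

lemma bounded_operator_inner_sum:
  assumes T: "bounded_operator T" and h: "h \<in> L2" and "finite A" "\<And>i. i \<in> A \<Longrightarrow> u i \<in> L2"
  shows "inner_L2 (T (\<lambda>t. \<Sum>i\<in>A. c i * u i t)) h = (\<Sum>i\<in>A. c i * inner_L2 (T (u i)) h)"
  using assms(3,4)
proof (induction A rule: finite_induct)
  case empty
  show ?case using bounded_operator_inner_linear[OF T h h h, of 0 0] by simp
next
  case (insert i A)
  then have "(\<lambda>t. \<Sum>i\<in>A. c i * u i t) \<in> L2" by (intro L2_sum L2_cmult) auto
  from bounded_operator_inner_linear[OF T _ this h, of "u i" "c i" 1] show ?case
    using insert by simp
qed

text \<open>A map on functions could separate two representatives of one vector; linearity and the
  bound, applied to \<open>f - g\<close>, exclude this up to a null function.\<close>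

lemma bounded_operator_inner_cong:
  assumes T: "bounded_operator T" and L: "f \<in> L2" "g \<in> L2" "h \<in> L2" and "eq_L2 f g"
  shows "inner_L2 (T f) h = inner_L2 (T g) h"
proof -
  obtain C where C: "\<And>f. f \<in> L2 \<Longrightarrow> norm_L2 (T f) \<le> C * norm_L2 f"
    using bounded_operator_bound[OF T] by blast
  have D: "(\<lambda>t. 1 * f t + (- 1) * g t) \<in> L2" by (intro L2_intros L)
  have "norm_L2 (\<lambda>t. 1 * f t + (- 1) * g t) = 0"
    using eq_L2_norm_diff[OF assms(5)] by simp
  then have "norm_L2 (T (\<lambda>t. 1 * f t + (- 1) * g t)) = 0" using C[OF D] by (simp add: antisym)
  then have "inner_L2 (T (\<lambda>t. 1 * f t + (- 1) * g t)) h = 0"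
    using L2_Cauchy_Schwarz[OF bounded_operator_L2[OF T D] L(3)] by simp
  then show ?thesis using bounded_operator_inner_linear[OF T L, of 1 "-1"] by simp
qed

context
  fixes I :: "'i set" and u
  assumes u: "orthonormal_basis I u"
begin

lemma orthonormal_L2: "i \<in> I \<Longrightarrow> u i \<in> L2"
  using u by (auto simp: orthonormal_basis_def complete_L2_def)

lemma orthonormal_inner: "i \<in> I \<Longrightarrow> j \<in> I \<Longrightarrow> inner_L2 (u i) (u j) = (if i = j then 1 else 0)"
  using u by (auto simp: orthonormal_basis_def)

lemma orthonormal_norm:
  assumes A: "finite A" "A \<subseteq> I"
  shows "norm_L2 (\<lambda>t. \<Sum>i\<in>A. c i * u i t) = sqrt (\<Sum>i\<in>A. (cmod (c i))\<^sup>2)"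
proof -
  let ?x = "\<lambda>t. \<Sum>i\<in>A. c i * u i t"
  have x: "?x \<in> L2" using A by (intro L2_sum L2_cmult orthonormal_L2) auto
  have xu: "inner_L2 ?x (u i) = c i" if "i \<in> A" for i
  proof -
    have "inner_L2 ?x (u i) = (\<Sum>j\<in>A. c j * inner_L2 (u j) (u i))"
      using A that by (simp add: inner_L2_sum_left L2_cmult orthonormal_L2 subset_iff inner_L2_cmult_left)
    also have "\<dots> = (\<Sum>j\<in>A. if j = i then c i else 0)"
      using A that by (intro sum.cong) (auto simp: orthonormal_inner subset_iff)
    finally show ?thesis using A that by simp
  qed
  have "inner_L2 ?x ?x = (\<Sum>i\<in>A. c i * inner_L2 (u i) ?x)"
    using A x by (subst inner_L2_sum_left) (auto simp: L2_cmult orthonormal_L2 subset_iff inner_L2_cmult_left)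
  also have "\<dots> = (\<Sum>i\<in>A. c i * cnj (c i))"
    by (intro sum.cong refl) (metis xu inner_L2_cnj)
  also have "\<dots> = of_real (\<Sum>i\<in>A. (cmod (c i))\<^sup>2)" by (simp add: complex_norm_square del: of_real_power)
  finally have "(norm_L2 ?x)\<^sup>2 = (\<Sum>i\<in>A. (cmod (c i))\<^sup>2)"
    unfolding inner_L2_self of_real_eq_iff .
  then show ?thesis by (intro real_sqrt_unique[symmetric]) auto
qed

lemma orthonormal_bessel:
  assumes A: "finite A" "A \<subseteq> I" and g: "g \<in> L2"
  shows "(\<Sum>i\<in>A. (cmod (inner_L2 g (u i)))\<^sup>2) \<le> (norm_L2 g)\<^sup>2"
proof -
  define S where "S = (\<Sum>i\<in>A. (cmod (inner_L2 g (u i)))\<^sup>2)"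
  have S0: "0 \<le> S" unfolding S_def by (intro sum_nonneg) auto
  let ?x = "\<lambda>t. \<Sum>i\<in>A. inner_L2 g (u i) * u i t"
  have x: "?x \<in> L2" using A by (intro L2_sum L2_cmult orthonormal_L2) auto
  have "inner_L2 ?x g = (\<Sum>i\<in>A. inner_L2 g (u i) * inner_L2 (u i) g)"
    using A g by (simp add: inner_L2_sum_left L2_cmult orthonormal_L2 subset_iff inner_L2_cmult_left)
  also have "\<dots> = (\<Sum>i\<in>A. inner_L2 g (u i) * cnj (inner_L2 g (u i)))" by (simp add: inner_L2_cnj)
  also have "\<dots> = of_real S" by (simp add: S_def complex_norm_square del: of_real_power)
  finally have "S = cmod (inner_L2 ?x g)" using S0 by simp
  also have "\<dots> \<le> norm_L2 ?x * norm_L2 g" by (rule L2_Cauchy_Schwarz[OF x g])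
  also have "\<dots> = norm_L2 g * sqrt S" by (simp add: orthonormal_norm[OF A] S_def)
  finally show ?thesis using S0 unfolding S_def[symmetric] by (intro le_square_of_le_mult_sqrt) auto
qed

end

text \<open>The interpolating function represents the functional
  that sends \<open>f\<close> to the pairing of \<open>c\<close> with the coefficients of \<open>S f\<close>.\<close>
lemma riesz_basis_interpolation:
  fixes I :: "'i set"
  assumes u: "orthonormal_basis I u" and S: "bounded_operator S"
    and bound: "0 \<le> C" "\<And>f. f \<in> L2 \<Longrightarrow> norm_L2 (S f) \<le> C * norm_L2 f"
    and c: "\<And>A. finite A \<Longrightarrow> A \<subseteq> I \<Longrightarrow> (\<Sum>i\<in>A. (cmod (c i))\<^sup>2) \<le> B"
  shows "\<exists>k\<in>L2. (norm_L2 k)\<^sup>2 \<le> C\<^sup>2 * B \<and>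
    (\<forall>f\<in>L2. \<forall>i\<in>I. (\<forall>h\<in>L2. inner_L2 (S f) h = inner_L2 (u i) h) \<longrightarrow> inner_L2 k f = c i)"
proof -
  note uL = orthonormal_L2[OF u] and SL = bounded_operator_L2[OF S]
  have B: "0 \<le> B" using c[of "{}"] by simp
  \<comment> \<open>The conjugate is there because the functional yields
    \<open>inner_L2 f k\<close>, the conjugate of the prescribed
    \<open>inner_L2 k f\<close>.\<close>
  define a where "a f i = inner_L2 (S f) (u i) * cnj (c i)" for f i
  have fin: "(\<Sum>i\<in>A. cmod (a f i)) \<le> C * sqrt B * norm_L2 f" if f: "f \<in> L2" and A: "finite A" "A \<subseteq> I" for f A
  proof -
    have "(\<Sum>i\<in>A. cmod (a f i)) \<le> L2_set (\<lambda>i. cmod (inner_L2 (S f) (u i))) A * L2_set (\<lambda>i. cmod (c i)) A"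
      unfolding a_def norm_mult by (rule order_trans[OF _ L2_set_mult_ineq]) simp
    also have "\<dots> \<le> norm_L2 (S f) * sqrt B"
    proof (rule mult_mono)
      show "L2_set (\<lambda>i. cmod (inner_L2 (S f) (u i))) A \<le> norm_L2 (S f)"
        unfolding L2_set_def using orthonormal_bessel[OF u A SL[OF f]] by (intro real_le_lsqrt) (auto intro: sum_nonneg)
      show "L2_set (\<lambda>i. cmod (c i)) A \<le> sqrt B"
        unfolding L2_set_def using c[OF A] by simp
    qed (auto simp: L2_set_nonneg)
    also have "\<dots> \<le> C * norm_L2 f * sqrt B" using bound f B by (intro mult_right_mono) auto
    finally show ?thesis by (simp add: mult_ac)
  qed
  have sn: "(\<lambda>i. cmod (a f i)) summable_on I" if "f \<in> L2" for f
    by (rule nonneg_bdd_above_summable_on)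
      (use fin[OF that] in \<open>auto intro!: bdd_aboveI[of _ "C * sqrt B * norm_L2 f"]\<close>)
  then have s: "a f summable_on I" if "f \<in> L2" for f using that abs_summable_summable by blast
  obtain k where k: "k \<in> L2" "\<And>f. f \<in> L2 \<Longrightarrow> inner_L2 f k = infsum (a f) I"
  proof (rule L2_Riesz[of L2 "\<lambda>f. infsum (a f) I" "C * sqrt B"])
    show "infsum (a (\<lambda>t. f t + g t)) I = infsum (a f) I + infsum (a g) I" if "f \<in> L2" "g \<in> L2" for f g
    proof -
      have "infsum (a (\<lambda>t. f t + g t)) I = infsum (\<lambda>i. a f i + a g i) I"
      proof (rule infsum_cong)
        fix i assume "i \<in> I"
        then show "a (\<lambda>t. f t + g t) i = a f i + a g i"
          using bounded_operator_inner_linear[OF S that uL, of i 1 1] by (simp add: a_def distrib_right)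
      qed
      then show ?thesis using infsum_add s that by auto
    qed
    show "infsum (a (\<lambda>t. e * f t)) I = e * infsum (a f) I" if "f \<in> L2" for e f
    proof -
      have "infsum (a (\<lambda>t. e * f t)) I = infsum (\<lambda>i. e * a f i) I"
      proof (rule infsum_cong)
        fix i assume "i \<in> I"
        then show "a (\<lambda>t. e * f t) i = e * a f i"
          using bounded_operator_inner_linear[OF S that that uL, of i e 0] by (simp add: a_def mult_ac)
      qed
      then show ?thesis by (simp add: infsum_cmult_right')
    qed
    show "cmod (infsum (a f) I) \<le> C * sqrt B * norm_L2 f" if f: "f \<in> L2" for f
    proof -
      have "cmod (infsum (a f) I) \<le> infsum (\<lambda>i. cmod (a f i)) I" using sn[OF f] by (rule norm_infsum_bound)
      also have "\<dots> \<le> C * sqrt B * norm_L2 f" using sn[OF f] fin[OF f] by (intro infsum_le_finite_sums)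
      finally show ?thesis .
    qed
  qed (auto intro: L2_intros)
  have "(norm_L2 k)\<^sup>2 = cmod (infsum (a k) I)"
    using k(2)[OF k(1)] by (metis inner_L2_self norm_of_real abs_power2)
  also have "\<dots> \<le> infsum (\<lambda>i. cmod (a k i)) I" using sn[OF k(1)] by (rule norm_infsum_bound)
  also have "\<dots> \<le> C * sqrt B * norm_L2 k" using sn[OF k(1)] fin[OF k(1)] by (intro infsum_le_finite_sums)
  finally have "(norm_L2 k)\<^sup>2 \<le> C * sqrt B * sqrt ((norm_L2 k)\<^sup>2)" by simp
  then have "(norm_L2 k)\<^sup>2 \<le> (C * sqrt B)\<^sup>2" using bound B by (intro le_square_of_le_mult_sqrt) auto
  then have "(norm_L2 k)\<^sup>2 \<le> C\<^sup>2 * B" using B by (simp add: power_mult_distrib)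
  moreover have "inner_L2 k f = c i"
    if f: "f \<in> L2" and i: "i \<in> I" and eq: "\<forall>h\<in>L2. inner_L2 (S f) h = inner_L2 (u i) h" for f i
  proof -
    have "infsum (a f) I = infsum (\<lambda>j. if j = i then cnj (c i) else 0) I"
      using i by (intro infsum_cong) (auto simp: a_def eq uL orthonormal_inner[OF u])
    also have "\<dots> = infsum (\<lambda>j. cnj (c i)) {i}"
      using i by (intro infsum_cong_neutral) auto
    finally have "inner_L2 f k = cnj (c i)" using k(2)[OF f] by simp
    then show ?thesis by (metis inner_L2_cnj complex_cnj_cnj)
  qed
  ultimately show ?thesis using k(1) by blast
qed

lemma riesz_basis_exponentials:
  assumes Z: "Z \<subseteq> \<real>" and R: "riesz_basis Z expo"
  obtains d K where "riesz_exponentials Z d K"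
proof -
  obtain u T S where u: "orthonormal_basis Z u" and T: "bounded_operator T" and S: "bounded_operator S"
    and ST: "\<And>f. f \<in> L2 \<Longrightarrow> eq_L2 (S (T f)) f" and TS: "\<And>f. f \<in> L2 \<Longrightarrow> eq_L2 (T (S f)) f"
    and Tu: "\<And>\<mu>. \<mu> \<in> Z \<Longrightarrow> eq_L2 (T (u \<mu>)) (expo \<mu>)"
    using R unfolding riesz_basis_def by blast
  note uL = orthonormal_L2[OF u] and SL = bounded_operator_L2[OF S] and TL = bounded_operator_L2[OF T]
  obtain C where C: "0 \<le> C" "\<And>f. f \<in> L2 \<Longrightarrow> norm_L2 (T f) \<le> C * norm_L2 f"
    by (rule bounded_operator_bound[OF T]) (rule that)
  obtain C' where C': "0 \<le> C'" "\<And>f. f \<in> L2 \<Longrightarrow> norm_L2 (S f) \<le> C' * norm_L2 f"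
    by (rule bounded_operator_bound[OF S]) (rule that)
  \<comment> \<open>\<open>C\<close> belongs to \<open>T\<close> and serves the Bessel bound,
    \<open>C'\<close> belongs to \<open>S\<close> and serves interpolation; the sum is one constant
    for both.\<close>
  define K where "K = C\<^sup>2 + C'\<^sup>2"
  have bessel: "(\<Sum>\<mu>\<in>A. (cmod (ft f \<mu>))\<^sup>2) \<le> K * (norm_L2 f)\<^sup>2"
    if f: "f \<in> L2" and A: "finite A" "A \<subseteq> Z" for f A
  proof -
    define s where "s = (\<Sum>\<mu>\<in>A. (cmod (ft f \<mu>))\<^sup>2)"
    have s0: "0 \<le> s" unfolding s_def by (intro sum_nonneg) auto
    let ?x = "\<lambda>t. \<Sum>\<mu>\<in>A. ft f \<mu> * u \<mu> t"
    have x: "?x \<in> L2" using A by (intro L2_sum L2_cmult uL) auto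
    have "inner_L2 (T ?x) f = (\<Sum>\<mu>\<in>A. ft f \<mu> * inner_L2 (T (u \<mu>)) f)"
      using A uL by (intro bounded_operator_inner_sum T f) auto
    also have "\<dots> = (\<Sum>\<mu>\<in>A. ft f \<mu> * cnj (ft f \<mu>))"
    proof (rule sum.cong)
      fix \<mu> assume "\<mu> \<in> A"
      then have \<mu>: "\<mu> \<in> Z" using A by auto
      then have "inner_L2 (T (u \<mu>)) f = inner_L2 (expo \<mu>) f"
        by (intro eq_L2_inner Tu TL uL f expo_L2)
      then show "ft f \<mu> * inner_L2 (T (u \<mu>)) f = ft f \<mu> * cnj (ft f \<mu>)"
        using \<mu> Z by (simp add: ft_real inner_L2_cnj subset_iff)
    qed simp
    also have "\<dots> = of_real s" by (simp add: s_def complex_norm_square del: of_real_power)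
    finally have "s = cmod (inner_L2 (T ?x) f)" using s0 by simp
    also have "\<dots> \<le> norm_L2 (T ?x) * norm_L2 f" by (rule L2_Cauchy_Schwarz[OF TL[OF x] f])
    also have "\<dots> \<le> (C * norm_L2 ?x) * norm_L2 f" using C(2)[OF x] by (intro mult_right_mono) auto
    also have "\<dots> = (C * norm_L2 f) * sqrt s" by (simp add: orthonormal_norm[OF u A] s_def)
    finally have "s \<le> (C * norm_L2 f)\<^sup>2" using s0 C by (intro le_square_of_le_mult_sqrt) auto
    also have "\<dots> \<le> K * (norm_L2 f)\<^sup>2" by (simp add: K_def power_mult_distrib mult_right_mono)
    finally show ?thesis by (simp add: s_def)
  qed
  have interp: "\<exists>k\<in>L2. (\<forall>\<mu>\<in>Z. ft k \<mu> = c \<mu>) \<and> (norm_L2 k)\<^sup>2 \<le> K * B"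
    if c: "\<And>A. finite A \<Longrightarrow> A \<subseteq> Z \<Longrightarrow> (\<Sum>\<mu>\<in>A. (cmod (c \<mu>))\<^sup>2) \<le> B" for c B
  proof -
    have B: "0 \<le> B" using c[of "{}"] by simp
    obtain k where k: "k \<in> L2" "(norm_L2 k)\<^sup>2 \<le> C'\<^sup>2 * B"
      "\<forall>f\<in>L2. \<forall>\<mu>\<in>Z. (\<forall>h\<in>L2. inner_L2 (S f) h = inner_L2 (u \<mu>) h) \<longrightarrow> inner_L2 k f = c \<mu>"
      using riesz_basis_interpolation[OF u S C' c] by blast
    have "ft k \<mu> = c \<mu>" if \<mu>: "\<mu> \<in> Z" for \<mu>
    proof -
      have "inner_L2 (S (expo \<mu>)) h = inner_L2 (u \<mu>) h" if h: "h \<in> L2" for h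
      proof -
        have "inner_L2 (S (expo \<mu>)) h = inner_L2 (S (T (u \<mu>))) h"
          by (rule sym, intro bounded_operator_inner_cong S TL uL \<mu> h expo_L2 Tu)
        also have "\<dots> = inner_L2 (u \<mu>) h"
          by (intro eq_L2_inner ST SL TL uL \<mu> h)
        finally show ?thesis .
      qed
      then have "inner_L2 k (expo \<mu>) = c \<mu>" using k(3) \<mu> expo_L2 by blast
      then show ?thesis using \<mu> Z by (simp add: ft_real subset_iff)
    qed
    moreover have "(norm_L2 k)\<^sup>2 \<le> K * B" using k(2) B
      by (smt (verit) K_def mult_right_mono zero_le_power2)
    ultimately show ?thesis using k(1) by blast
  qed
  have complete: "norm_L2 f = 0" if f: "f \<in> L2" and 0: "\<And>\<mu>. \<mu> \<in> Z \<Longrightarrow> ft f \<mu> = 0" for f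
  proof -
    have eT: "inner_L2 (expo \<mu>) f = 0" if "\<mu> \<in> Z" for \<mu>
      using 0[OF that] that Z by (metis ft_real inner_L2_cnj complex_cnj_zero subsetD)
    \<comment> \<open>\<open>k\<close> is the adjoint of \<open>T\<close> applied to
      \<open>f\<close>. It is orthogonal to the orthonormal basis, hence null, and testing it with
      \<open>S f\<close> returns the norm of \<open>f\<close>.\<close>
    obtain k where k: "k \<in> L2" "\<And>g. g \<in> L2 \<Longrightarrow> inner_L2 g k = inner_L2 (T g) f"
    proof (rule L2_Riesz[of L2 "\<lambda>g. inner_L2 (T g) f" "C * norm_L2 f"])
      show "inner_L2 (T (\<lambda>t. g t + h t)) f = inner_L2 (T g) f + inner_L2 (T h) f" if "g \<in> L2" "h \<in> L2" for g h
        using bounded_operator_inner_linear[OF T that f, of 1 1] by simp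
      show "inner_L2 (T (\<lambda>t. c * g t)) f = c * inner_L2 (T g) f" if "g \<in> L2" for c g
        using bounded_operator_inner_linear[OF T that that f, of c 0] by simp
      show "cmod (inner_L2 (T g) f) \<le> C * norm_L2 f * norm_L2 g" if g: "g \<in> L2" for g
        using L2_Cauchy_Schwarz[OF TL[OF g] f] mult_right_mono[OF C(2)[OF g] norm_L2_nonneg[of f]]
        by (simp add: mult_ac)
    qed (auto intro: L2_intros)
    have "norm_L2 k = 0"
    proof (rule complete_L2_orthogonal[of "u ` Z"])
      show "complete_L2 (u ` Z)" using u by (simp add: orthonormal_basis_def)
      fix v assume "v \<in> u ` Z"
      then obtain \<mu> where \<mu>: "\<mu> \<in> Z" "v = u \<mu>" by auto
      have "inner_L2 (u \<mu>) k = inner_L2 (T (u \<mu>)) f" by (intro k uL \<mu>)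
      also have "\<dots> = inner_L2 (expo \<mu>) f" by (intro eq_L2_inner Tu TL uL f expo_L2 \<mu>)
      finally show "inner_L2 k v = 0" using eT \<mu> by (metis inner_L2_cnj complex_cnj_zero)
    qed (rule k)
    then have "inner_L2 (S f) k = 0"
      using L2_Cauchy_Schwarz[OF SL[OF f] k(1)] by simp
    then have "inner_L2 (T (S f)) f = 0" using k(2)[OF SL[OF f]] by simp
    then have "inner_L2 f f = 0" using eq_L2_inner[OF TS TL[OF SL] _ f, OF f f f] by simp
    then show ?thesis by (simp add: inner_L2_self)
  qed
  \<comment> \<open>Kronecker data have square sum at most 1, so interpolation produces the
    biorthogonal system.\<close>
  have "\<exists>k\<in>L2. \<forall>\<nu>\<in>Z. ft k \<nu> = (if \<mu> = \<nu> then 1 else 0)" for \<mu>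
  proof -
    have "(\<Sum>\<nu>\<in>A. (cmod (if \<mu> = \<nu> then 1 else 0))\<^sup>2) \<le> 1" if "finite A" for A
      using that by (subst sum.cong[OF refl, of _ _ "\<lambda>\<nu>. if \<mu> = \<nu> then 1 else 0"]) auto
    then show ?thesis using interp[of "\<lambda>\<nu>. if \<mu> = \<nu> then 1 else 0" 1] by blast
  qed
  then obtain d where "\<And>\<mu>. d \<mu> \<in> L2" "\<And>\<mu> \<nu>. \<nu> \<in> Z \<Longrightarrow> ft (d \<mu>) \<nu> = (if \<mu> = \<nu> then 1 else 0)"
    by metis
  then have "riesz_exponentials Z d K"
    by unfold_locales (use Z complete bessel interp in \<open>auto simp: K_def\<close>)
  then show ?thesis by (rule that)
qed

section \<open>Distribution of the frequencies\<close>

lemma ft_one: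
  assumes "x \<noteq> 0"
  shows "ft (\<lambda>t. 1) x = (exp (\<i> * x * of_real pi) - exp (- (\<i> * x * of_real pi))) / (\<i> * x)"
proof -
  have "ft (\<lambda>t. 1) x = (LINT t|leb. indicator {-pi<..} t * exp (- (\<i> * x * of_real t)))"
    unfolding ft_def by (intro Bochner_Integration.integral_cong) auto
  also have "\<dots> = (exp (- (\<i> * x * of_real (- pi))) - exp (- (\<i> * x * of_real pi))) / (\<i> * x)"
    by (rule integral_exp_tail) (use assms in auto)
  finally show ?thesis by simp
qed

lemma ft_expo: "ft (expo \<mu>) z = ft (\<lambda>t. 1) (z - \<mu>)"
  unfolding ft_def expo_def
  by (intro Bochner_Integration.integral_cong) (auto simp: algebra_simps simp flip: exp_add)

lemma norm_expo_real: "\<mu> \<in> \<real> \<Longrightarrow> (norm_L2 (expo \<mu>))\<^sup>2 = 2 * pi"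
  unfolding norm_L2_sq expo_def
  by (auto simp: Reals_def measure_restrict_space)

lemma ft_one_real_bound:
  assumes "x \<in> \<real>" "x \<noteq> 0" shows "(cmod (ft (\<lambda>t. 1) x))\<^sup>2 \<le> 4 / (cmod x)\<^sup>2"
proof -
  have "cmod (exp (\<i> * x * of_real pi) - exp (- (\<i> * x * of_real pi))) \<le>
      cmod (exp (\<i> * x * of_real pi)) + cmod (exp (- (\<i> * x * of_real pi)))"
    by (rule norm_triangle_ineq4)
  also have "\<dots> = 2" using assms by (auto simp: Reals_def)
  finally have "cmod (ft (\<lambda>t. 1) x) \<le> 2 / cmod x"
    using assms by (simp add: ft_one norm_divide norm_mult divide_right_mono)
  then have "(cmod (ft (\<lambda>t. 1) x))\<^sup>2 \<le> (2 / cmod x)\<^sup>2" by (intro power_mono) auto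
  then show ?thesis by (simp add: power_divide)
qed

text \<open>The kernel \<open>ft (\<lambda>t. 1)\<close> is \<open>2 * sin (pi * x) / x\<close>,
  without zeros off the real axis; at \<open>x + \<i>\<close> the exponentials in its numerator have
  the distinct moduli \<open>exp pi\<close> and \<open>exp (- pi)\<close>. With the Bessel bound
  this makes the weights summable over the frequencies.\<close>

lemma ft_real_exp_lower_bound:
  assumes "x \<in> \<real>" shows "1 / (1 + (cmod x)\<^sup>2) \<le> (cmod (ft (expo (- \<i>)) x))\<^sup>2"
proof -
  obtain y where y: "x = of_real y" using assms by (auto simp: Reals_def)
  have ne: "x + \<i> \<noteq> 0" by (auto simp: y complex_eq_iff)
  have cn: "(cmod (x + \<i>))\<^sup>2 = 1 + (cmod x)\<^sup>2" by (simp add: y cmod_power2)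
  have "exp pi - exp (- pi) \<le> cmod (exp (\<i> * (x + \<i>) * of_real pi) - exp (- (\<i> * (x + \<i>) * of_real pi)))"
  proof -
    have "cmod (exp (- (\<i> * (x + \<i>) * of_real pi))) = exp pi"
         "cmod (exp (\<i> * (x + \<i>) * of_real pi)) = exp (- pi)" by (simp_all add: y)
    then show ?thesis
      using norm_triangle_ineq3[of "exp (\<i> * (x + \<i>) * of_real pi)" "exp (- (\<i> * (x + \<i>) * of_real pi))"]
      by linarith
  qed
  moreover have "exp pi - exp (- pi) \<ge> 1"
  proof -
    have "1 + pi \<le> exp pi" by (rule exp_ge_add_one_self)
    moreover have "exp (- pi) \<le> 1" by simp
    ultimately show ?thesis using pi_gt3 by linarith
  qed
  ultimately have "1 / cmod (x + \<i>) \<le> cmod (ft (expo (- \<i>)) x)"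
    using ne by (simp add: ft_expo ft_one norm_divide norm_mult divide_right_mono)
  then have "(1 / cmod (x + \<i>))\<^sup>2 \<le> (cmod (ft (expo (- \<i>)) x))\<^sup>2" by (intro power_mono) auto
  then show ?thesis by (simp add: power_divide cn)
qed

lemma summable_on_tail:
  fixes b :: "'a \<Rightarrow> real"
  assumes s: "b summable_on I" and pos: "\<And>i. i \<in> I \<Longrightarrow> 0 \<le> b i" and e: "0 < \<epsilon>"
  obtains X where "finite X" "X \<subseteq> I" "\<And>A. finite A \<Longrightarrow> A \<subseteq> I - X \<Longrightarrow> sum b A \<le> \<epsilon>"
proof -
  have S: "(b has_sum infsum b I) I" using s by (rule has_sum_infsum)
  obtain X where X: "finite X" "X \<subseteq> I" "dist (sum b X) (infsum b I) \<le> \<epsilon>"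
    using has_sum_finite_approximation[OF S e] by blast
  have "sum b A \<le> \<epsilon>" if A: "finite A" "A \<subseteq> I - X" for A
  proof -
    have "sum b X + sum b A = sum b (X \<union> A)" using X A by (subst sum.union_disjoint) auto
    also have "\<dots> \<le> infsum b I" using X A pos by (intro finite_sum_le_has_sum[OF S]) auto
    finally show ?thesis using X(3) by (simp add: dist_real_def)
  qed
  with X show ?thesis using that by blast
qed

context riesz_exponentials
begin

lemma weight_summable: "(\<lambda>\<mu>. 1 / (1 + (cmod \<mu>)\<^sup>2)) summable_on I"
proof (rule summable_on_comparison_test)
  show "(\<lambda>\<mu>. (cmod (ft (expo (- \<i>)) \<mu>))\<^sup>2) summable_on I" by (rule ft_sq_summable[OF expo_L2])
qed (use freq_real ft_real_exp_lower_bound in auto)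

lemma finite_freq: "finite {\<mu> \<in> I. cmod \<mu> < R}"
proof -
  \<comment> \<open>Frequencies in the disc have at least twice this weight, so none of them can
    belong to the tail.\<close>
  have "0 < 1 / (2 * (1 + R\<^sup>2))" by (simp add: add_pos_nonneg)
  from summable_on_tail[OF weight_summable _ this]
  obtain X where X: "finite X" "X \<subseteq> I"
    "\<And>A. finite A \<Longrightarrow> A \<subseteq> I - X \<Longrightarrow> (\<Sum>\<mu>\<in>A. 1 / (1 + (cmod \<mu>)\<^sup>2)) \<le> 1 / (2 * (1 + R\<^sup>2))"
    by (smt (verit) divide_nonneg_nonneg zero_le_power2)
  have "{\<mu> \<in> I. cmod \<mu> < R} \<subseteq> X"
  proof safe
    fix \<mu> assume \<mu>: "\<mu> \<in> I" "cmod \<mu> < R"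
    show "\<mu> \<in> X"
    proof (rule ccontr)
      assume "\<mu> \<notin> X"
      then have "1 / (1 + (cmod \<mu>)\<^sup>2) \<le> 1 / (2 * (1 + R\<^sup>2))" using X(3)[of "{\<mu>}"] \<mu> by simp
      then have "2 * (1 + R\<^sup>2) \<le> 1 + (cmod \<mu>)\<^sup>2"
        by (simp add: field_simps add_pos_nonneg)
      moreover have "(cmod \<mu>)\<^sup>2 \<le> R\<^sup>2" using \<mu> by (intro power_mono) auto
      moreover have "0 \<le> R\<^sup>2" by simp
      ultimately show False unfolding distrib_left by arith
    qed
  qed
  then show ?thesis using X(1) finite_subset by blast
qed

text \<open>If the frequencies were bounded on one side, translating them far to the other side would make all
  coefficients of a fixed exponential small.\<close>
lemma freq_unbounded:
  assumes \<sigma>: "\<sigma> = 1 \<or> \<sigma> = -1"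
  shows "\<exists>\<mu>\<in>I. \<sigma> * Re \<mu> < - B"
proof (rule ccontr)
  assume "\<not> ?thesis"
  then have lo: "\<sigma> * Re \<mu> \<ge> - B" if "\<mu> \<in> I" for \<mu> using that by (auto simp: not_less)
  define A where "A = max B 0"
  have A: "0 \<le> A" and loA: "\<sigma> * Re \<mu> \<ge> - A" if "\<mu> \<in> I" for \<mu>
    using lo[OF that] by (auto simp: A_def)
  have A0: "0 \<le> A" by (simp add: A_def)
  have cm: "(cmod \<mu>)\<^sup>2 = (\<sigma> * Re \<mu>)\<^sup>2" if "\<mu> \<in> I" for \<mu>
    using that freq_real \<sigma> by (auto simp: power_mult_distrib cmod_power2 complex_is_Real_iff subset_iff)
  \<comment> \<open>Up to the factor 4 this weight dominates the squared coefficients of the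
    translated exponential for all \<open>N \<ge> A + 1\<close> at once, so its tail can be fixed
    before \<open>N\<close> is chosen.\<close>
  define b where "b \<mu> = 1 / (\<sigma> * Re \<mu> + A + 1)\<^sup>2" for \<mu>
  have "b summable_on I"
  proof (rule summable_on_comparison_test)
    show "(\<lambda>\<mu>. (3 + 2 * (A + 1)\<^sup>2) * (1 / (1 + (cmod \<mu>)\<^sup>2))) summable_on I"
      by (intro summable_on_cmult_right weight_summable)
    fix \<mu> assume \<mu>: "\<mu> \<in> I"
    define x where "x = \<sigma> * Re \<mu>"
    define y where "y = x + A + 1"
    have y: "1 \<le> y" using loA[OF \<mu>] by (simp add: y_def x_def)
    have y1: "1 \<le> y\<^sup>2" using y by simp
    have "x\<^sup>2 = (y - (A + 1))\<^sup>2" by (simp add: y_def)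
    also have "\<dots> \<le> 2 * y\<^sup>2 + 2 * (A + 1)\<^sup>2"
      using zero_le_power2[of "y + (A + 1)"] by (simp add: power2_sum power2_diff)
    also have "2 * (A + 1)\<^sup>2 \<le> 2 * (A + 1)\<^sup>2 * y\<^sup>2"
      using y1 by (simp add: mult_le_cancel_left1)
    finally have "1 + x\<^sup>2 \<le> (3 + 2 * (A + 1)\<^sup>2) * y\<^sup>2" using y1 by (simp add: algebra_simps)
    then show "b \<mu> \<le> (3 + 2 * (A + 1)\<^sup>2) * (1 / (1 + (cmod \<mu>)\<^sup>2))"
      using y1 cm[OF \<mu>] y by (simp add: b_def x_def y_def field_simps add_pos_nonneg)
  qed (simp add: b_def)
  \<comment> \<open>The set \<open>X\<close> and the tail will contribute \<open>4 * e\<close> each.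
    The value makes \<open>K * (8 * e)\<close> smaller than \<open>2 * pi\<close>, the squared norm
    of an exponential with real frequency.\<close>
  define e where "e = pi / (K + 1) / 8"
  have e: "0 < e" using K_nonneg by (simp add: e_def)
  obtain X where X: "finite X" "X \<subseteq> I" "\<And>A. finite A \<Longrightarrow> A \<subseteq> I - X \<Longrightarrow> sum b A \<le> e"
    using summable_on_tail[OF \<open>b summable_on I\<close> _ e] by (auto simp: b_def)
  define m where "m = real (card X) / e + 1"
  have m: "1 \<le> m" "card X / m\<^sup>2 \<le> e"
  proof -
    show m1: "1 \<le> m" using e by (simp add: m_def)
    have "card X \<le> e * m" using e by (simp add: m_def field_simps)
    also have "\<dots> \<le> e * m\<^sup>2" using e m1 by (simp add: power2_eq_square)
    finally show "card X / m\<^sup>2 \<le> e" using m1 by (simp add: divide_le_eq)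
  qed
  define N where "N = A + m"
  define f where "f = expo (of_real (- \<sigma> * N))"
  have "(norm_L2 f)\<^sup>2 \<le> K * (8 * e)"
  proof (rule norm_L2_le)
    show "f \<in> L2" by (simp add: f_def expo_L2)
    fix C assume C: "finite C" "C \<subseteq> I"
    have bd: "(cmod (ft f \<mu>))\<^sup>2 \<le> 4 / (\<sigma> * Re \<mu> + N)\<^sup>2" and ge: "\<sigma> * Re \<mu> + N \<ge> m" if "\<mu> \<in> C" for \<mu>
    proof -
      have \<mu>: "\<mu> \<in> I" using that C by auto
      show ge: "\<sigma> * Re \<mu> + N \<ge> m" using loA[OF \<mu>] by (simp add: N_def)
      have \<mu>r: "\<mu> = of_real (Re \<mu>)" using \<mu> freq_real by (metis of_real_Re subsetD)
      have "\<mu> - of_real (- \<sigma> * N) = of_real (Re \<mu> + \<sigma> * N)" by (subst \<mu>r) simp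
      moreover have "(Re \<mu> + \<sigma> * N)\<^sup>2 = (\<sigma> * Re \<mu> + N)\<^sup>2" using \<sigma> by (auto simp: power2_eq_square algebra_simps)
      moreover have "Re \<mu> + \<sigma> * N \<noteq> 0" using \<sigma> ge m by auto
      ultimately show "(cmod (ft f \<mu>))\<^sup>2 \<le> 4 / (\<sigma> * Re \<mu> + N)\<^sup>2"
        using ft_one_real_bound[of "of_real (Re \<mu> + \<sigma> * N)"] ge m
        by (auto simp: f_def ft_expo norm_of_real simp del: of_real_add of_real_mult)
    qed
    have "(\<Sum>\<mu>\<in>C. (cmod (ft f \<mu>))\<^sup>2) \<le> (\<Sum>\<mu>\<in>C. (if \<mu> \<in> X then 4 / m\<^sup>2 else 0) + (if \<mu> \<in> X then 0 else 4 * b \<mu>))"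
    proof (rule sum_mono)
      fix \<mu> assume \<mu>: "\<mu> \<in> C"
      have "4 / (\<sigma> * Re \<mu> + N)\<^sup>2 \<le> 4 / m\<^sup>2"
        using ge[OF \<mu>] m by (intro divide_left_mono power_mono) auto
      moreover have "4 / (\<sigma> * Re \<mu> + N)\<^sup>2 \<le> 4 * b \<mu>"
      proof -
        have "0 < \<sigma> * Re \<mu> + A + 1" using loA[of \<mu>] \<mu> C by auto
        then have "(\<sigma> * Re \<mu> + A + 1)\<^sup>2 \<le> (\<sigma> * Re \<mu> + N)\<^sup>2" using m by (intro power_mono) (auto simp: N_def)
        then show ?thesis unfolding b_def using \<open>0 < \<sigma> * Re \<mu> + A + 1\<close> by (simp add: frac_le)
      qed
      ultimately show "(cmod (ft f \<mu>))\<^sup>2 \<le> (if \<mu> \<in> X then 4 / m\<^sup>2 else 0) + (if \<mu> \<in> X then 0 else 4 * b \<mu>)"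
        using bd[OF \<mu>] by auto
    qed
    also have "\<dots> = (\<Sum>\<mu>\<in>C. if \<mu> \<in> X then 4 / m\<^sup>2 else 0) + (\<Sum>\<mu>\<in>C. if \<mu> \<in> X then 0 else 4 * b \<mu>)"
      by (rule sum.distrib)
    also have "(\<Sum>\<mu>\<in>C. if \<mu> \<in> X then 4 / m\<^sup>2 else 0) = (\<Sum>\<mu>\<in>C \<inter> X. 4 / m\<^sup>2)"
      using C by (intro sum.inter_restrict[symmetric])
    also have "\<dots> \<le> (\<Sum>\<mu>\<in>X. 4 / m\<^sup>2)" using X by (intro sum_mono2) auto
    also have "\<dots> = 4 * (card X / m\<^sup>2)" by simp
    also have "\<dots> \<le> 4 * e" using m(2) by (rule mult_left_mono) simp
    also have "(\<Sum>\<mu>\<in>C. if \<mu> \<in> X then 0 else 4 * b \<mu>) = (\<Sum>\<mu>\<in>C - X. 4 * b \<mu>)"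
      using C by (intro sum.mono_neutral_cong_right) auto
    also have "\<dots> = 4 * sum b (C - X)" by (simp add: sum_distrib_left)
    also have "sum b (C - X) \<le> e" using C by (intro X) auto
    finally show "(\<Sum>\<mu>\<in>C. (cmod (ft f \<mu>))\<^sup>2) \<le> 8 * e" by simp
  qed
  also have "\<dots> < 2 * pi" 
  proof -
    have "K * (8 * e) = pi * (K / (K + 1))"
    proof -
      have "K + 1 \<noteq> 0" "K * 8 + 8 \<noteq> 0" using K_nonneg by linarith+
      then show ?thesis by (simp add: e_def field_simps)
    qed
    also have "\<dots> \<le> pi * 1" using K_nonneg by (intro mult_left_mono) auto
    finally show ?thesis using pi_gt_zero by linarith
  qed
  also have "\<dots> = (norm_L2 f)\<^sup>2" unfolding f_def by (subst norm_expo_real) auto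
  finally show False by simp
qed

end

section \<open>The generating function\<close>

lemma (in dual_exponentials) has_derivative_ft_dual_product:
  assumes b: "b \<in> I"
  shows "((\<lambda>z. (z - b) * ft (d b) z) has_field_derivative 1) (at b)"
  by (auto intro!: derivative_eq_intros has_field_derivative_ft dual_L2 b simp: ft_dual b)

text \<open>A partial Weierstrass product of genus one centred at \<open>a\<close>, with all
  convergence factors gathered in one exponential; \<open>\<kappa>\<close> is its logarithmic
  derivative at \<open>a\<close> when \<open>a\<close> is not in \<open>A\<close>.\<close>

definition partial_prod :: "complex \<Rightarrow> complex \<Rightarrow> complex set \<Rightarrow> complex \<Rightarrow> complex" where
  "partial_prod a \<kappa> A z = (\<Prod>\<mu>\<in>A. 1 - (z - a) / (\<mu> - a)) * exp ((\<kappa> + (\<Sum>\<mu>\<in>A. 1 / (\<mu> - a))) * (z - a))"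

text \<open>The convergence factors complete \<open>1 / (z - \<mu>)\<close> by
  \<open>1 / (\<mu> - a)\<close>; the sum is of order \<open>1 / \<mu>\<^sup>2\<close>, and the same
  terms occur in the series for \<open>ft (d a)\<close>.\<close>

lemma has_field_derivative_partial_prod:
  assumes "finite A" "z \<notin> A" "a \<notin> A"
  shows "(partial_prod a \<kappa> A has_field_derivative
     partial_prod a \<kappa> A z * (\<kappa> + (\<Sum>\<mu>\<in>A. (z - a) / ((z - \<mu>) * (\<mu> - a))))) (at z)"
proof -
  have *: "((\<lambda>z. \<Prod>\<mu>\<in>A. 1 - (z - a) / (\<mu> - a)) has_field_derivative
     (\<Prod>\<mu>\<in>A. 1 - (z - a) / (\<mu> - a)) * (\<Sum>\<mu>\<in>A. 1 / (z - \<mu>))) (at z)"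
    using assms
  proof (induction A rule: finite_induct)
    case (insert \<mu> A)
    have ne: "\<mu> - a \<noteq> 0" "z - \<mu> \<noteq> 0" using insert by auto
    have "((\<lambda>z. 1 - (z - a) / (\<mu> - a)) has_field_derivative - 1 / (\<mu> - a)) (at z)"
      using ne by (auto intro!: derivative_eq_intros)
    also have "- 1 / (\<mu> - a) = - ((z - \<mu>) / (\<mu> - a)) * (1 / (z - \<mu>))"
      using ne by simp
    also have "- ((z - \<mu>) / (\<mu> - a)) = 1 - (z - a) / (\<mu> - a)"
      using ne by (simp add: field_simps)
    finally have 1: "((\<lambda>z. 1 - (z - a) / (\<mu> - a)) has_field_derivative (1 - (z - a) / (\<mu> - a)) * (1 / (z - \<mu>))) (at z)" .
    have 2: "((\<lambda>z. \<Prod>\<mu>\<in>A. 1 - (z - a) / (\<mu> - a)) has_field_derivative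
        (\<Prod>\<mu>\<in>A. 1 - (z - a) / (\<mu> - a)) * (\<Sum>\<mu>\<in>A. 1 / (z - \<mu>))) (at z)"
      using insert by auto
    have "((\<lambda>z. (1 - (z - a) / (\<mu> - a)) * (\<Prod>\<mu>\<in>A. 1 - (z - a) / (\<mu> - a))) has_field_derivative
      ((1 - (z - a) / (\<mu> - a)) * (1 / (z - \<mu>))) * (\<Prod>\<mu>\<in>A. 1 - (z - a) / (\<mu> - a)) +
      ((\<Prod>\<mu>\<in>A. 1 - (z - a) / (\<mu> - a)) * (\<Sum>\<mu>\<in>A. 1 / (z - \<mu>))) * (1 - (z - a) / (\<mu> - a))) (at z)"
      by (rule DERIV_mult[OF 1 2])
    moreover have "q * u * p + p * s * q = q * p * (u + s)" for q u p s :: complex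
      by (simp add: algebra_simps)
    ultimately show ?case
      by (simp only: prod.insert[OF insert(1,2)] sum.insert[OF insert(1,2)])
  qed simp
  have eq: "(z - a) / ((z - \<mu>) * (\<mu> - a)) = 1 / (z - \<mu>) + 1 / (\<mu> - a)" if "\<mu> \<in> A" for \<mu>
  proof -
    have "z - \<mu> \<noteq> 0" "\<mu> - a \<noteq> 0" using that assms by auto
    then show ?thesis by (simp add: add_frac_eq)
  qed
  let ?s = "\<kappa> + (\<Sum>\<mu>\<in>A. 1 / (\<mu> - a))"
  have e: "((\<lambda>z. exp (?s * (z - a))) has_field_derivative exp (?s * (z - a)) * ?s) (at z)"
    by (auto intro!: derivative_eq_intros)
  have "(\<Sum>\<mu>\<in>A. (z - a) / ((z - \<mu>) * (\<mu> - a))) = (\<Sum>\<mu>\<in>A. 1 / (z - \<mu>)) + (\<Sum>\<mu>\<in>A. 1 / (\<mu> - a))"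
    by (simp add: eq sum.distrib cong: sum.cong)
  then show ?thesis
    unfolding partial_prod_def
    by (intro DERIV_cong[OF DERIV_mult[OF * e]]) (simp add: algebra_simps)
qed

section \<open>The product formula for the dual functions\<close>

context riesz_exponentials
begin

lemma nonreal_notin: "Im z \<noteq> 0 \<Longrightarrow> z \<notin> I"
  using freq_real by (auto simp: complex_is_Real_iff subset_iff)

text \<open>Logarithmic differentiation of the product formula; it comes out of the
  interpolation formula for the derivative of \<open>ft (d a)\<close>.\<close>
lemma log_derivative_dual:
  assumes a: "a \<in> I" and z: "z \<notin> I"
  defines "p \<equiv> (\<lambda>t. - \<i> * of_real t * d a t)"
  shows "((\<lambda>\<mu>. (z - a) / ((z - \<mu>) * (\<mu> - a))) has_sum (ft p z / ft (d a) z - ft p a)) (I - {a})"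
proof -
  have p: "p \<in> L2" unfolding p_def by (intro ident_mult_L2 dual_L2 a)
  have dp: "(ft (d a) has_field_derivative ft p x) (at x)" for x
    unfolding p_def by (intro has_field_derivative_ft dual_L2 a)
  have g0: "ft (d a) z \<noteq> 0" by (rule ft_dual_nonzero[OF a z])
  have "((\<lambda>\<mu>. ft p \<mu> * ft (d \<mu>) z) has_sum ft p z) I" by (rule ft_expansion[OF p])
  moreover have "((\<lambda>\<mu>. ft p \<mu> * ft (d \<mu>) z) has_sum (ft p a * ft (d a) z)) {a}"
    by (rule has_sum_finiteI) auto
  ultimately have "((\<lambda>\<mu>. ft p \<mu> * ft (d \<mu>) z) has_sum (ft p z - ft p a * ft (d a) z)) (I - {a})"
    using a by (intro has_sum_Diff) auto
  then have "((\<lambda>\<mu>. ft p \<mu> * ft (d \<mu>) z / ft (d a) z) has_sum (ft p z - ft p a * ft (d a) z) / ft (d a) z) (I - {a})"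
    by (rule has_sum_divide_const)
  also have "(ft p z - ft p a * ft (d a) z) / ft (d a) z = ft p z / ft (d a) z - ft p a"
    using g0 by (simp add: diff_divide_distrib)
  also have "((\<lambda>\<mu>. ft p \<mu> * ft (d \<mu>) z / ft (d a) z) has_sum ft p z / ft (d a) z - ft p a) (I - {a}) \<longleftrightarrow>
     ((\<lambda>\<mu>. (z - a) / ((z - \<mu>) * (\<mu> - a))) has_sum (ft p z / ft (d a) z - ft p a)) (I - {a})"
  proof (rule has_sum_cong)
    fix \<mu> assume "\<mu> \<in> I - {a}"
    then have \<mu>: "\<mu> \<in> I" "\<mu> \<noteq> a" by auto
    obtain \<gamma> where \<gamma>: "\<gamma> \<noteq> 0" "\<And>x. (x - a) * ft (d a) x = \<gamma> * ((x - \<mu>) * ft (d \<mu>) x)"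
      by (rule ft_dual_ratio[OF a \<mu>(1)]) (rule that)
    \<comment> \<open>Differentiating both sides of the ratio identity at \<open>\<mu>\<close>
      expresses the coefficient \<open>ft p \<mu>\<close> by \<open>\<gamma>\<close>.\<close>
    have "((\<lambda>x. (x - a) * ft (d a) x) has_field_derivative (\<mu> - a) * ft p \<mu>) (at \<mu>)"
      using \<mu> by (auto intro!: derivative_eq_intros dp simp: ft_dual a)
    moreover have "((\<lambda>x. \<gamma> * ((x - \<mu>) * ft (d \<mu>) x)) has_field_derivative \<gamma> * 1) (at \<mu>)"
      by (intro DERIV_cmult has_derivative_ft_dual_product \<mu>)
    ultimately have \<gamma>p: "(\<mu> - a) * ft p \<mu> = \<gamma>"
      unfolding \<gamma>(2) using DERIV_unique by fastforce
    have "z - \<mu> \<noteq> 0" "\<mu> - a \<noteq> 0" using \<mu> z by auto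
    then have ne: "(z - \<mu>) * (\<mu> - a) \<noteq> 0" by simp
    have "(z - a) * ft (d a) z = (\<mu> - a) * ft p \<mu> * ((z - \<mu>) * ft (d \<mu>) z)"
      using \<gamma>(2)[of z] \<gamma>p by simp
    then show "ft p \<mu> * ft (d \<mu>) z / ft (d a) z = (z - a) / ((z - \<mu>) * (\<mu> - a))"
      unfolding frac_eq_eq[OF g0 ne] by (simp only: mult_ac)
  qed
  finally show ?thesis .
qed

text \<open>Dividing out the roots one by one keeps the quotient a transform, hence differentiable
  also at the zeros of the product.\<close>

lemma dual_divide_product:
  assumes a: "a \<in> I" and A: "finite A" "A \<subseteq> I - {a}"
  shows "\<exists>f\<in>L2. \<forall>z. ft (d a) z = (\<Prod>\<mu>\<in>A. 1 - (z - a) / (\<mu> - a)) * ft f z"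
  using A
proof (induction A rule: finite_induct)
  case empty
  then show ?case using dual_L2[OF a] by auto
next
  case (insert \<mu> A)
  then obtain f where f: "f \<in> L2" "\<And>z. ft (d a) z = (\<Prod>\<mu>\<in>A. 1 - (z - a) / (\<mu> - a)) * ft f z" by auto
  have ne: "\<mu> - a \<noteq> 0" "\<mu> \<in> I" using insert by auto
  have "(\<Prod>\<nu>\<in>A. 1 - (\<mu> - a) / (\<nu> - a)) \<noteq> 0"
    using insert by (auto simp: prod_zero_iff divide_eq_1_iff)
  moreover have "ft (d a) \<mu> = 0" using ne by (simp add: ft_dual a)
  ultimately have "ft f \<mu> = 0" using f(2)[of \<mu>] by simp
  then obtain q where q: "q \<in> L2" "\<And>z. ft f z = (z - \<mu>) * ft q z" using ft_divide_root[OF f(1)] by blast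
  have "ft (d a) z = (\<Prod>\<mu>\<in>insert \<mu> A. 1 - (z - a) / (\<mu> - a)) * ft (\<lambda>t. (a - \<mu>) * q t) z" for z
  proof -
    have "(z - \<mu>) = (1 - (z - a) / (\<mu> - a)) * (a - \<mu>)" using ne by (simp add: field_simps)
    then have "ft f z = (1 - (z - a) / (\<mu> - a)) * ((a - \<mu>) * ft q z)" using q(2)[of z] by (simp only: mult.assoc)
    then show ?thesis
      unfolding f(2)[of z] prod.insert[OF insert(1,2)] ft_cmult by (simp only: mult_ac)
  qed
  then show ?case using q(1) by (intro bexI[of _ "\<lambda>t. (a - \<mu>) * q t"]) (auto intro: L2_cmult)
qed

text \<open>The quotient \<open>r\<close> of \<open>ft (d a)\<close> by a partial product is entire, and off the real line its logarithmic
  derivative is a tail of the series in \<open>log_derivative_dual\<close>.\<close>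
lemma partial_prod_quotient:
  assumes a: "a \<in> I" and A: "finite A" "A \<subseteq> I - {a}"
    and tail: "\<And>B. finite B \<Longrightarrow> B \<subseteq> I - {a} - A \<Longrightarrow> (\<Sum>\<mu>\<in>B. 1 / (1 + (cmod \<mu>)\<^sup>2)) \<le> \<epsilon>"
    and big: "\<And>\<mu>. \<mu> \<in> I - {a} - A \<Longrightarrow> 2 * \<rho> \<le> cmod \<mu> \<and> 1 \<le> cmod \<mu>"
    and \<rho>: "cmod a < \<rho>" "cmod z < \<rho>" and small: "64 * \<rho>\<^sup>2 * \<epsilon> \<le> 1"
  defines "\<kappa> \<equiv> ft (\<lambda>t. - \<i> * of_real t * d a t) a"
  shows "\<exists>r. ft (d a) z = partial_prod a \<kappa> A z * r \<and> cmod (r - 1) \<le> 64 * \<rho>\<^sup>2 * \<epsilon>"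
proof -
  define p where "p = (\<lambda>t. - \<i> * of_real t * d a t)"
  have \<rho>0: "0 < \<rho>" using \<rho>(1) norm_ge_zero[of a] by linarith
  have \<epsilon>0: "0 \<le> \<epsilon>" using tail[of "{}"] by simp
  obtain f where f: "f \<in> L2" "\<And>z. ft (d a) z = (\<Prod>\<mu>\<in>A. 1 - (z - a) / (\<mu> - a)) * ft f z"
    using dual_divide_product[OF a A] by blast
  define s where "s = \<kappa> + (\<Sum>\<mu>\<in>A. 1 / (\<mu> - a))"
  define r where "r z = ft f z * exp (- s * (z - a))" for z
  define fp where "fp = (\<lambda>t. - \<i> * of_real t * f t)"
  define r' where "r' z = (ft fp z - s * ft f z) * exp (- s * (z - a))" for z
  have fp: "fp \<in> L2" unfolding fp_def by (rule ident_mult_L2[OF f(1)])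
  have der_r: "(r has_field_derivative r' x) (at x)" for x
  proof -
    have "(ft f has_field_derivative ft fp x) (at x)" unfolding fp_def by (rule has_field_derivative_ft[OF f(1)])
    then show ?thesis unfolding r_def r'_def
      by (auto intro!: derivative_eq_intros simp: algebra_simps)
  qed
  have gr: "ft (d a) x = partial_prod a \<kappa> A x * r x" for x
  proof -
    have "q * E * (u * E') = q * u * (E * E')" for q E u E' :: complex by (simp only: mult_ac)
    moreover have "exp (s * (x - a)) * exp (- s * (x - a)) = 1" by (simp flip: exp_add)
    ultimately show ?thesis
      unfolding partial_prod_def r_def s_def[symmetric] using f(2)[of x] by simp
  qed
  have "partial_prod a \<kappa> A a = 1" by (simp add: partial_prod_def)
  then have ra: "r a = 1" using gr[of a] a by (simp add: ft_dual)
  let ?L = "\<lambda>x \<mu>. (x - a) / ((x - \<mu>) * (\<mu> - a))"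
  have dr: "cmod (r' x) \<le> 16 * \<rho> * \<epsilon> * cmod (r x)" if x: "cmod x < \<rho>" "Im x \<noteq> 0" for x
  proof -
    have xI: "x \<notin> I" by (rule nonreal_notin[OF x(2)])
    have g0: "ft (d a) x \<noteq> 0" by (rule ft_dual_nonzero[OF a xI])
    have hs: "(?L x has_sum (ft p x / ft (d a) x - \<kappa> - (\<Sum>\<mu>\<in>A. ?L x \<mu>))) (I - {a} - A)"
      unfolding p_def \<kappa>_def
      by (rule has_sum_Diff[OF log_derivative_dual[OF a xI] has_sum_finite[OF A(1)] A(2)])
    have "(ft (d a) has_field_derivative ft p x) (at x)"
      unfolding p_def by (intro has_field_derivative_ft dual_L2 a)
    moreover have "((\<lambda>x. partial_prod a \<kappa> A x * r x) has_field_derivative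
        partial_prod a \<kappa> A x * (\<kappa> + (\<Sum>\<mu>\<in>A. ?L x \<mu>)) * r x + r' x * partial_prod a \<kappa> A x) (at x)"
      using A xI by (intro DERIV_mult has_field_derivative_partial_prod der_r) auto
    ultimately have "ft p x = partial_prod a \<kappa> A x * (\<kappa> + (\<Sum>\<mu>\<in>A. ?L x \<mu>)) * r x + r' x * partial_prod a \<kappa> A x"
      unfolding gr[symmetric] by (rule DERIV_unique)
    then have r'L: "r' x = (ft p x / ft (d a) x - \<kappa> - (\<Sum>\<mu>\<in>A. ?L x \<mu>)) * r x"
      using g0 gr[of x] by (simp add: field_simps)
    \<comment> \<open>The numerator is at most \<open>2 * \<rho>\<close>, both factors of the
      denominator are at least \<open>c / 2\<close>, and \<open>1 \<le> c\<close> trades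
      \<open>c\<^sup>2\<close> for the weight.\<close>
    have le: "cmod (?L x \<mu>) \<le> 16 * \<rho> * (1 / (1 + (cmod \<mu>)\<^sup>2))" if \<mu>: "\<mu> \<in> I - {a} - A" for \<mu>
    proof -
      define c where "c = cmod \<mu>"
      have c: "2 * \<rho> \<le> c" "1 \<le> c" using big[OF \<mu>] by (auto simp: c_def)
      have "cmod (x - a) \<le> 2 * \<rho>" using norm_triangle_ineq4[of x a] \<rho>(1) x(1) by linarith
      moreover have "c / 2 \<le> cmod (x - \<mu>)"
        using norm_triangle_ineq2[of \<mu> x] x(1) c by (simp add: c_def norm_minus_commute)
      moreover have "c / 2 \<le> cmod (\<mu> - a)"
        using norm_triangle_ineq2[of \<mu> a] \<rho>(1) c by (simp add: c_def)
      ultimately have "cmod (?L x \<mu>) \<le> 2 * \<rho> / ((c / 2) * (c / 2))"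
        unfolding norm_divide norm_mult using c \<rho>0 by (intro frac_le mult_mono mult_pos_pos) auto
      also have "\<dots> = 16 * \<rho> * (1 / (c\<^sup>2 + c\<^sup>2))" by (simp add: power2_eq_square)
      also have "\<dots> \<le> 16 * \<rho> * (1 / (1 + c\<^sup>2))"
        using c \<rho>0 one_le_power[of c 2] by (intro mult_left_mono divide_left_mono) (auto intro!: mult_pos_pos add_pos_pos)
      finally show ?thesis by (simp add: c_def)
    qed
    have "cmod (ft p x / ft (d a) x - \<kappa> - (\<Sum>\<mu>\<in>A. ?L x \<mu>)) \<le> 16 * \<rho> * \<epsilon>"
    proof (rule Lim_norm_ubound)
      show "(sum (?L x) \<longlongrightarrow> ft p x / ft (d a) x - \<kappa> - (\<Sum>\<mu>\<in>A. ?L x \<mu>)) (finite_subsets_at_top (I - {a} - A))"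
        using hs by (simp add: has_sum_def)
      show "\<forall>\<^sub>F B in finite_subsets_at_top (I - {a} - A). cmod (sum (?L x) B) \<le> 16 * \<rho> * \<epsilon>"
      proof (rule eventually_finite_subsets_at_top_weakI)
        fix B assume B: "finite B" "B \<subseteq> I - {a} - A"
        have "cmod (sum (?L x) B) \<le> (\<Sum>\<mu>\<in>B. 16 * \<rho> * (1 / (1 + (cmod \<mu>)\<^sup>2)))"
          by (rule sum_norm_le) (use B le in auto)
        also have "\<dots> = 16 * \<rho> * (\<Sum>\<mu>\<in>B. 1 / (1 + (cmod \<mu>)\<^sup>2))" by (simp add: sum_distrib_left)
        also have "\<dots> \<le> 16 * \<rho> * \<epsilon>" using tail[OF B] \<rho>0 by (intro mult_left_mono) auto
        finally show "cmod (sum (?L x) B) \<le> 16 * \<rho> * \<epsilon>" .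
      qed
    qed simp
    then show ?thesis unfolding r'L norm_mult by (intro mult_right_mono) auto
  qed
  define M where "M = (SUP x\<in>ball 0 \<rho>. cmod (r x))"
  have cont_r: "continuous_on X r" for X
    by (rule DERIV_continuous_on) (rule has_field_derivative_at_within[OF der_r])
  have "compact ((\<lambda>x. cmod (r x)) ` cball 0 \<rho>)"
    by (intro compact_continuous_image continuous_intros cont_r compact_cball)
  then have "bdd_above ((\<lambda>x. cmod (r x)) ` cball 0 \<rho>)"
    by (intro bounded_imp_bdd_above compact_imp_bounded)
  then have bdd: "bdd_above ((\<lambda>x. cmod (r x)) ` ball 0 \<rho>)"
    by (rule bdd_above_mono) (auto intro!: image_mono)
  have rM: "cmod (r x) \<le> M" if "x \<in> ball 0 \<rho>" for x
    unfolding M_def by (rule cSUP_upper[OF that bdd])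
  have r'M: "cmod (r' x) \<le> 16 * \<rho> * \<epsilon> * M" if x: "x \<in> ball 0 \<rho>" for x
  proof (cases "Im x = 0")
    case False
    have "cmod (r' x) \<le> 16 * \<rho> * \<epsilon> * cmod (r x)" using x False by (intro dr) auto
    also have "\<dots> \<le> 16 * \<rho> * \<epsilon> * M" using \<rho>0 \<epsilon>0 rM[OF x] by (intro mult_left_mono) auto
    finally show ?thesis .
  next
    case True
    \<comment> \<open>Real points, where \<open>ft (d a)\<close> may vanish, are approached from the
      upper half plane; \<open>r'\<close> is continuous.\<close>
    define X where "X n = x + \<i> * of_real (inverse (real (Suc n)))" for n
    have "X \<longlonglongrightarrow> x + \<i> * of_real 0"
      unfolding X_def by (intro tendsto_intros LIMSEQ_inverse_real_of_nat)
    then have X: "X \<longlonglongrightarrow> x" by simp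
    have "isCont r' x"
      unfolding r'_def by (intro continuous_intros DERIV_isCont[OF has_field_derivative_ft] f(1) fp)
    then have "(\<lambda>n. cmod (r' (X n))) \<longlonglongrightarrow> cmod (r' x)"
      by (intro tendsto_norm isCont_tendsto_compose[OF _ X])
    moreover have "\<forall>\<^sub>F n in sequentially. X n \<in> ball 0 \<rho>"
      by (rule topological_tendstoD[OF X open_ball x])
    then have "\<forall>\<^sub>F n in sequentially. cmod (r' (X n)) \<le> 16 * \<rho> * \<epsilon> * M"
    proof eventually_elim
      case (elim n)
      have "cmod (r' (X n)) \<le> 16 * \<rho> * \<epsilon> * cmod (r (X n))"
        using elim True by (intro dr) (auto simp: X_def)
      also have "\<dots> \<le> 16 * \<rho> * \<epsilon> * M" using \<rho>0 \<epsilon>0 rM[OF elim] by (intro mult_left_mono) auto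
      finally show ?case .
    qed
    ultimately show ?thesis by (intro tendsto_upperbound[of _ _ sequentially]) auto
  qed
  have aB: "a \<in> ball 0 \<rho>" using \<rho> by simp
  have M0: "0 \<le> M" using order_trans[OF norm_ge_zero rM[OF aB]] .
  have r1: "cmod (r x - 1) \<le> 32 * \<rho>\<^sup>2 * \<epsilon> * M" if x: "x \<in> ball 0 \<rho>" for x
  proof -
    have "cmod (r x - r a) \<le> 16 * \<rho> * \<epsilon> * M * cmod (x - a)"
      by (rule field_differentiable_bound[of "ball 0 \<rho>" r r'])
        (use x aB r'M in \<open>auto intro: has_field_derivative_at_within[OF der_r]\<close>)
    also have "\<dots> \<le> 16 * \<rho> * \<epsilon> * M * (2 * \<rho>)"
    proof (rule mult_left_mono)
      show "cmod (x - a) \<le> 2 * \<rho>" using norm_triangle_ineq4[of x a] \<rho>(1) x by simp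
    qed (use \<rho>0 \<epsilon>0 M0 in simp)
    finally show ?thesis by (simp add: ra power2_eq_square mult_ac)
  qed
  \<comment> \<open>The bound on \<open>r'\<close> involves the supremum \<open>M\<close> of
    \<open>r\<close> itself; the smallness of \<open>\<epsilon>\<close> absorbs it,
    \<open>M \<le> 1 + M / 2\<close>. The 64 is 16 from the derivative, 2 from the diameter
    \<open>2 * \<rho>\<close>, and 2 from \<open>M \<le> 2\<close>.\<close>
  have half: "32 * \<rho>\<^sup>2 * \<epsilon> * M \<le> M / 2"
    using mult_right_mono[OF small M0] by simp
  have "M \<le> 1 + M / 2"
    unfolding M_def
  proof (rule cSUP_least, unfold M_def[symmetric])
    fix x :: complex assume x: "x \<in> ball 0 \<rho>"
    have "cmod (r x) \<le> 1 + cmod (r x - 1)" using norm_triangle_ineq[of 1 "r x - 1"] by simp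
    then show "cmod (r x) \<le> 1 + M / 2" using r1[OF x] half by linarith
  qed (use \<rho>0 in auto)
  then have "M \<le> 2" by simp
  have "cmod (r z - 1) \<le> 32 * \<rho>\<^sup>2 * \<epsilon> * M" using \<rho> by (intro r1) simp
  also have "\<dots> \<le> 32 * \<rho>\<^sup>2 * \<epsilon> * 2" using \<epsilon>0 \<open>M \<le> 2\<close> by (intro mult_left_mono) auto
  finally have "cmod (r z - 1) \<le> 64 * \<rho>\<^sup>2 * \<epsilon>" by simp
  then show ?thesis using gr[of z] by blast
qed

text \<open>The Hadamard product of \<open>ft (d a)\<close>. It is truncated by discs about 0, like
  the generating function, so that the two can be compared for each \<open>R\<close>.\<close>

lemma partial_prod_tendsto:
  assumes a: "a \<in> I"
  defines "\<kappa> \<equiv> ft (\<lambda>t. - \<i> * of_real t * d a t) a"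
  shows "((\<lambda>R. partial_prod a \<kappa> ({\<mu> \<in> I. cmod \<mu> < R} - {a}) z) \<longlongrightarrow> ft (d a) z) (at_top :: real filter)"
proof -
  let ?A = "\<lambda>R. {\<mu> \<in> I. cmod \<mu> < R} - {a}"
  define \<rho> where "\<rho> = cmod a + cmod z + 1"
  have \<rho>: "cmod a < \<rho>" "cmod z < \<rho>" "1 \<le> \<rho>"
    unfolding \<rho>_def using norm_ge_zero[of a] norm_ge_zero[of z] by linarith+
  let ?g = "ft (d a) z" and ?h = "\<lambda>R. partial_prod a \<kappa> (?A R) z"
  show ?thesis
  proof (rule tendstoI)
    fix e :: real assume e: "0 < e"
    \<comment> \<open>\<open>1 / 2\<close> keeps \<open>r\<close> away from 0, which bounds the
      truncated product by \<open>2 * cmod ?g\<close>; the other entry then pushes the error below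
      \<open>e\<close>.\<close>
    define \<eta> where "\<eta> = min (1 / 2) (e / (4 * (cmod ?g + 1)))"
    have g1: "0 < cmod ?g + 1" using norm_ge_zero[of ?g] by linarith
    have \<eta>: "\<eta> \<le> 1 / 2" "\<eta> \<le> e / (4 * (cmod ?g + 1))"
      unfolding \<eta>_def by (rule min.cobounded1, rule min.cobounded2)
    have \<eta>0: "0 < \<eta>" using e g1 by (simp add: \<eta>_def)
    define \<epsilon> where "\<epsilon> = \<eta> / (64 * \<rho>\<^sup>2)"
    have \<epsilon>: "0 < \<epsilon>" "64 * \<rho>\<^sup>2 * \<epsilon> = \<eta>" using \<eta>0 \<rho> by (auto simp: \<epsilon>_def)
    obtain X where X: "finite X" "X \<subseteq> I"
      "\<And>A. finite A \<Longrightarrow> A \<subseteq> I - X \<Longrightarrow> (\<Sum>\<mu>\<in>A. 1 / (1 + (cmod \<mu>)\<^sup>2)) \<le> \<epsilon>"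
      using summable_on_tail[OF weight_summable _ \<epsilon>(1)] by (metis divide_nonneg_nonneg add_nonneg_nonneg zero_le_one zero_le_power2)
    have "eventually (\<lambda>R. \<forall>\<mu>\<in>X. cmod \<mu> < R) at_top"
      using X(1) by (intro eventually_ball_finite) (auto intro: eventually_gt_at_top)
    moreover have "eventually (\<lambda>R. 2 * \<rho> \<le> R) at_top" by (rule eventually_ge_at_top)
    ultimately show "eventually (\<lambda>R. dist (?h R) ?g < e) at_top"
    proof eventually_elim
      case (elim R)
      have "\<exists>r. ?g = ?h R * r \<and> cmod (r - 1) \<le> 64 * \<rho>\<^sup>2 * \<epsilon>"
        unfolding \<kappa>_def
      proof (rule partial_prod_quotient[OF a])
        show "finite (?A R)" using finite_freq by simp
        show "(\<Sum>\<mu>\<in>B. 1 / (1 + (cmod \<mu>)\<^sup>2)) \<le> \<epsilon>" if "finite B" "B \<subseteq> I - {a} - ?A R" for B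
          using that elim(1) by (intro X(3)) force+
        show "2 * \<rho> \<le> cmod \<mu> \<and> 1 \<le> cmod \<mu>" if "\<mu> \<in> I - {a} - ?A R" for \<mu>
          using that elim(2) \<rho> by auto
      qed (use \<rho> \<epsilon> \<eta>(1) in auto)
      then obtain r where r: "?g = ?h R * r" "cmod (r - 1) \<le> \<eta>" unfolding \<epsilon>(2) by blast
      have "1 \<le> cmod r + cmod (r - 1)" using norm_triangle_ineq4[of r "r - 1"] by simp
      then have r2: "1 / 2 \<le> cmod r" using r(2) \<eta>(1) by linarith
      have "cmod ?g = cmod (?h R) * cmod r" by (subst r(1)) (rule norm_mult)
      then have "cmod (?h R) * (1 / 2) \<le> cmod ?g"
        using mult_left_mono[OF r2 norm_ge_zero[of "?h R"]] by simp
      then have h: "cmod (?h R) \<le> 2 * cmod ?g" by simp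
      have "dist (?h R) ?g = cmod (?h R * (r - 1))"
        by (subst r(1)) (simp add: dist_norm norm_minus_commute algebra_simps)
      also have "\<dots> \<le> 2 * cmod ?g * \<eta>" unfolding norm_mult using h r(2) by (intro mult_mono) auto
      also have "\<dots> \<le> 2 * cmod ?g * (e / (4 * (cmod ?g + 1)))" using \<eta>(2) by (intro mult_left_mono) auto
      also have "\<dots> = e / 2 * (cmod ?g / (cmod ?g + 1))" using g1 by (simp add: field_simps)
      also have "\<dots> \<le> e / 2 * 1" using e g1 by (intro mult_left_mono) auto
      also have "\<dots> < e" using e by simp
      finally show ?case .
    qed
  qed
qed

end

section \<open>Comparison with the generating function\<close>

context riesz_exponentials
begin

text \<open>Base point \<open>a = 0\<close> is forced when \<open>0\<close> is a frequency, so that the factor \<open>z\<close> of the generating function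
  is the factor \<open>z - a\<close>.\<close>
lemma generating_function_eq:
  assumes gen: "generating_function I F" and a: "a \<in> I" "0 \<in> I \<Longrightarrow> a = 0"
  obtains c k where "c \<noteq> 0" "\<And>z. F z = c * exp (k * (z - a)) * ((z - a) * ft (d a) z)"
proof -
  define T where "T R = {\<mu> \<in> I. cmod \<mu> < R}" for R :: real
  define \<kappa> where "\<kappa> = ft (\<lambda>t. - \<i> * of_real t * d a t) a"
  define s where "s R = (\<Sum>\<mu>\<in>T R - {a}. 1 / (\<mu> - a))" for R
  define H where "H R z = partial_prod a \<kappa> (T R - {a}) z" for R z
  define P where "P R z = (\<Prod>\<mu>\<in>T R. if \<mu> = 0 then z else 1 - z / \<mu>)" for R z
  \<comment> \<open>The constant ratio between a factor of the generating function and the factor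
    centred at \<open>a\<close>, which is \<open>z - a\<close> when
    \<open>\<mu> = a\<close>.\<close>
  define \<gamma> where "\<gamma> \<mu> = (if \<mu> = 0 then 1 else if \<mu> = a then - 1 / a else 1 - a / \<mu>)" for \<mu>
  define c where "c R = (\<Prod>\<mu>\<in>T R. \<gamma> \<mu>)" for R
  \<comment> \<open>The ratio of the truncated products apart from
    \<open>exp (- \<kappa> * (z - a))\<close>. Neither \<open>c R\<close> nor \<open>s R\<close> is
    known to converge at first; the limit of \<open>s R\<close> has to be recovered from limits of
    \<open>V R z\<close>.\<close>
  define V where "V R z = c R * exp (- s R * (z - a))" for R z
  have finT: "finite (T R)" for R unfolding T_def by (rule finite_freq)
  have TI: "\<mu> \<in> T R \<Longrightarrow> \<mu> \<in> I" for \<mu> R by (simp add: T_def)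
  have P_lim: "((\<lambda>R. P R z) \<longlongrightarrow> F z) at_top" for z
    using gen unfolding generating_function_def P_def T_def by simp
  have H_lim: "((\<lambda>R. H R z) \<longlongrightarrow> ft (d a) z) at_top" for z
    unfolding H_def T_def \<kappa>_def by (rule partial_prod_tendsto[OF a(1)])
  have aT: "eventually (\<lambda>R. a \<in> T R) at_top"
    using eventually_gt_at_top[of "cmod a"] a by (auto simp: T_def elim: eventually_mono)
  have P_eq: "P R z = V R z * exp (- \<kappa> * (z - a)) * ((z - a) * H R z)" if aR: "a \<in> T R" for R z
  proof -
    have "P R z = (\<Prod>\<mu>\<in>T R. \<gamma> \<mu> * (if \<mu> = a then z - a else 1 - (z - a) / (\<mu> - a)))"
      unfolding P_def
    proof (rule prod.cong)
      fix \<mu> assume "\<mu> \<in> T R"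
      then have \<mu>: "\<mu> \<in> I" by (rule TI)
      show "(if \<mu> = 0 then z else 1 - z / \<mu>) = \<gamma> \<mu> * (if \<mu> = a then z - a else 1 - (z - a) / (\<mu> - a))"
      proof (cases "\<mu> = 0 \<or> \<mu> = a")
        case True
        then show ?thesis using a \<mu> by (auto simp: \<gamma>_def field_simps)
      next
        case False
        then have ne: "\<mu> \<noteq> 0" "\<mu> - a \<noteq> 0" by auto
        have e: "\<gamma> \<mu> = (\<mu> - a) / \<mu>" "1 - (z - a) / (\<mu> - a) = (\<mu> - z) / (\<mu> - a)" "1 - z / \<mu> = (\<mu> - z) / \<mu>"
          using False ne by (simp_all add: \<gamma>_def field_simps)
        have "(\<mu> - a) / \<mu> * ((\<mu> - z) / (\<mu> - a)) = (\<mu> - z) / \<mu>" using ne by simp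
        then show ?thesis using False by (simp only: e if_False de_Morgan_disj simp_thms)
      qed
    qed simp
    also have "\<dots> = c R * (\<Prod>\<mu>\<in>T R. if \<mu> = a then z - a else 1 - (z - a) / (\<mu> - a))"
      by (simp add: prod.distrib c_def)
    also have "(\<Prod>\<mu>\<in>T R. if \<mu> = a then z - a else 1 - (z - a) / (\<mu> - a)) =
        (z - a) * (\<Prod>\<mu>\<in>T R - {a}. 1 - (z - a) / (\<mu> - a))"
      using aR by (subst prod.remove[OF finT aR]) (auto intro!: prod.cong)
    finally have 1: "P R z = c R * ((z - a) * (\<Prod>\<mu>\<in>T R - {a}. 1 - (z - a) / (\<mu> - a)))" .
    have "exp (- s R * (z - a)) * exp (- \<kappa> * (z - a)) * exp ((\<kappa> + s R) * (z - a)) = 1"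
      by (simp add: algebra_simps flip: exp_add)
    moreover have "C * E * E' * (x * (q * E'')) = C * (x * q) * (E * E' * E'')" for C E E' x q E'' :: complex
      by (simp only: mult_ac)
    ultimately show ?thesis unfolding 1 V_def H_def partial_prod_def s_def[symmetric]
      by (simp only: mult_1_right)
  qed
  have V_lim: "((\<lambda>R. V R z) \<longlongrightarrow> F z / (exp (- \<kappa> * (z - a)) * ((z - a) * ft (d a) z))) at_top"
    if "ft (d a) z \<noteq> 0" "z \<noteq> a" for z
  proof -
    have "((\<lambda>R. P R z / (exp (- \<kappa> * (z - a)) * ((z - a) * H R z))) \<longlongrightarrow>
        F z / (exp (- \<kappa> * (z - a)) * ((z - a) * ft (d a) z))) at_top"
      using that by (intro tendsto_intros P_lim H_lim) auto
    moreover have "eventually (\<lambda>R. H R z \<noteq> 0) at_top"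
      using tendsto_imp_eventually_ne[OF H_lim that(1)] .
    then have "eventually (\<lambda>R. P R z / (exp (- \<kappa> * (z - a)) * ((z - a) * H R z)) = V R z) at_top"
      using aT by eventually_elim (use that in \<open>simp add: P_eq\<close>)
    ultimately show ?thesis by (rule Lim_transform_eventually)
  qed
  \<comment> \<open>The origin normalises \<open>V\<close>: if it is a frequency, it is the base
    point and \<open>V R 0 = 1\<close>; otherwise \<open>P R 0 = 1\<close>.\<close>
  obtain v0 where v0: "v0 \<noteq> 0" "((\<lambda>R. V R 0) \<longlongrightarrow> v0) at_top"
  proof (cases "0 \<in> I")
    case True
    then have a0: "a = 0" by (rule a(2))
    have "V R 0 = 1" for R
      unfolding V_def c_def \<gamma>_def using a0 by (auto intro!: prod.neutral)
    then show ?thesis using that[of 1] by simp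
  next
    case False
    then have ne: "ft (d a) 0 \<noteq> 0" "0 \<noteq> a" using ft_dual_nonzero[OF a(1)] a by auto
    have "P R 0 = 1" for R unfolding P_def using False TI by (intro prod.neutral) auto
    then have "F 0 = 1" using P_lim[of 0] by (simp add: tendsto_const_iff)
    then show ?thesis using that[OF _ V_lim[OF ne]] ne by simp
  qed
  have E_lim: "\<exists>l. ((\<lambda>R. exp (- s R * z)) \<longlongrightarrow> l) at_top" if "Im z \<noteq> 0" for z
  proof -
    have zI: "z \<notin> I" using that by (rule nonreal_notin)
    then have ne: "ft (d a) z \<noteq> 0" "z \<noteq> a" using ft_dual_nonzero[OF a(1)] a by auto
    have "((\<lambda>R. V R z / V R 0) \<longlongrightarrow> F z / (exp (- \<kappa> * (z - a)) * ((z - a) * ft (d a) z)) / v0) at_top"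
      by (intro tendsto_divide V_lim v0 ne)
    moreover have "eventually (\<lambda>R. V R 0 \<noteq> 0) at_top"
      using tendsto_imp_eventually_ne[OF v0(2,1)] .
    then have "eventually (\<lambda>R. V R z / V R 0 = exp (- s R * z)) at_top"
    proof eventually_elim
      case (elim R)
      have "V R z = V R 0 * exp (- s R * z)"
        by (simp add: V_def algebra_simps flip: exp_add)
      then show ?case using elim by simp
    qed
    ultimately show ?thesis by (intro exI) (rule Lim_transform_eventually)
  qed
  \<comment> \<open>As \<open>s R\<close> is real, the modulus at \<open>1 + \<i>\<close> is
    \<open>exp (- s R)\<close>. The value at the opposite point is the reciprocal, so the limit is
    not 0 and a logarithm can be taken. The points are nonreal because \<open>1\<close> or
    \<open>-1\<close> might be a frequency.\<close>
  obtain l where l: "((\<lambda>R. exp (- s R * (1 + \<i>))) \<longlongrightarrow> l) at_top" using E_lim[of "1 + \<i>"] by auto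
  obtain l' where l': "((\<lambda>R. exp (- s R * - (1 + \<i>))) \<longlongrightarrow> l') at_top" using E_lim[of "- (1 + \<i>)"] by auto
  have "((\<lambda>R. exp (- s R * (1 + \<i>)) * exp (- s R * - (1 + \<i>))) \<longlongrightarrow> l * l') at_top"
    by (intro tendsto_mult l l')
  moreover have "exp (- x * y) * exp (- x * - y) = 1" for x y :: complex by (simp flip: exp_add)
  ultimately have "((\<lambda>R::real. 1::complex) \<longlongrightarrow> l * l') at_top" by (simp only:)
  then have "l * l' = 1" by (simp add: tendsto_const_iff)
  then have l0: "l \<noteq> 0" by auto
  have s_real: "s R \<in> \<real>" for R unfolding s_def
    using a freq_real TI by (intro sum_in_Reals Reals_divide Reals_diff) auto
  have "cmod (exp (- s R * (1 + \<i>))) = exp (- Re (s R))" for R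
    using s_real[of R] by (simp add: complex_is_Real_iff)
  then have "((\<lambda>R. exp (- Re (s R))) \<longlongrightarrow> cmod l) at_top" using tendsto_norm[OF l] by simp
  then have "((\<lambda>R. ln (exp (- Re (s R)))) \<longlongrightarrow> ln (cmod l)) at_top" using l0 by (intro tendsto_ln) auto
  then have "((\<lambda>R. - Re (s R)) \<longlongrightarrow> ln (cmod l)) at_top" by simp
  then have "((\<lambda>R. - of_real (- Re (s R))) \<longlongrightarrow> - complex_of_real (ln (cmod l))) at_top"
    by (intro tendsto_intros)
  then have s_lim: "(s \<longlongrightarrow> - complex_of_real (ln (cmod l))) at_top"
    using s_real by (simp add: of_real_Re)
  define S where "S = - complex_of_real (ln (cmod l))"
  note s_lim = s_lim[folded S_def]
  have F_eq: "F z = v0 * exp (- S * z) * exp (- \<kappa> * (z - a)) * ((z - a) * ft (d a) z)" for z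
  proof -
    have "V R z = V R 0 * exp (- s R * z)" for R
      by (simp add: V_def algebra_simps flip: exp_add)
    then have V: "((\<lambda>R. V R z) \<longlongrightarrow> v0 * exp (- S * z)) at_top"
      by (simp only:) (intro tendsto_intros v0 s_lim)
    have "((\<lambda>R. V R z * exp (- \<kappa> * (z - a)) * ((z - a) * H R z)) \<longlongrightarrow>
        v0 * exp (- S * z) * exp (- \<kappa> * (z - a)) * ((z - a) * ft (d a) z)) at_top"
      by (intro tendsto_intros V H_lim)
    moreover have "eventually (\<lambda>R. V R z * exp (- \<kappa> * (z - a)) * ((z - a) * H R z) = P R z) at_top"
      using aT by eventually_elim (simp add: P_eq)
    ultimately have "((\<lambda>R. P R z) \<longlongrightarrow> v0 * exp (- S * z) * exp (- \<kappa> * (z - a)) * ((z - a) * ft (d a) z)) at_top"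
      by (rule Lim_transform_eventually)
    then show ?thesis using P_lim tendsto_unique[OF trivial_limit_at_top_linorder] by blast
  qed
  show ?thesis
  proof (rule that)
    show "v0 * exp (- S * a) \<noteq> 0" using v0 by simp
    show "F z = v0 * exp (- S * a) * exp (- (S + \<kappa>) * (z - a)) * ((z - a) * ft (d a) z)" for z
    proof -
      have "exp (- S * a) * exp (- (S + \<kappa>) * (z - a)) = exp (- S * z) * exp (- \<kappa> * (z - a))"
        by (simp add: algebra_simps flip: exp_add)
      then show ?thesis unfolding F_eq by (simp only: mult.assoc)
    qed
  qed
qed

text \<open>The lower bound \<open>c / (1 + \<bar>\<zeta>\<bar>)\<close> for the derivatives at the frequencies, which are unbounded on both sides,
  leaves no room for a real exponential factor.\<close>
lemma ratio_bounded:
  assumes gen: "generating_function I F"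
    and bdd: "bdd_above ((\<lambda>\<zeta>. cmod (deriv F \<zeta>)) ` I)"
  obtains a \<phi> M where "a \<in> I" "\<And>b. b \<in> I \<Longrightarrow> \<phi> b \<noteq> 0" "\<And>b. b \<in> I \<Longrightarrow> cmod (\<phi> b) \<le> M"
    "\<And>b z. b \<in> I \<Longrightarrow> (z - a) * ft (d a) z = \<phi> b * ((z - b) * ft (d b) z)"
proof -
  obtain a where a: "a \<in> I" "0 \<in> I \<Longrightarrow> a = 0"
    using freq_unbounded[of 1 0] by auto
  have "\<exists>\<gamma>. \<gamma> \<noteq> 0 \<and> (\<forall>z. (z - a) * ft (d a) z = \<gamma> * ((z - b) * ft (d b) z))" if "b \<in> I" for b
    by (rule ft_dual_ratio[OF a(1) that]) blast
  then obtain \<phi> where \<phi>: "\<And>b. b \<in> I \<Longrightarrow> \<phi> b \<noteq> 0"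
    "\<And>b z. b \<in> I \<Longrightarrow> (z - a) * ft (d a) z = \<phi> b * ((z - b) * ft (d b) z)" by metis
  obtain c k where c: "c \<noteq> 0" and F: "\<And>z. F z = c * exp (k * (z - a)) * ((z - a) * ft (d a) z)"
    by (rule generating_function_eq[OF gen a]) (assumption | rule that)+
  obtain B where B: "\<And>b. b \<in> I \<Longrightarrow> cmod (deriv F b) \<le> B" using bdd by (auto simp: bdd_above_def)
  have dF: "deriv F b = c * exp (k * (b - a)) * \<phi> b" if b: "b \<in> I" for b
  proof (rule DERIV_imp_deriv)
    have Fb: "F = (\<lambda>z. c * exp (k * (z - a)) * (\<phi> b * ((z - b) * ft (d b) z)))"
      unfolding \<phi>(2)[OF b, symmetric] using F by blast
    have 1: "((\<lambda>z. \<phi> b * ((z - b) * ft (d b) z)) has_field_derivative \<phi> b * 1) (at b)"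
      by (intro DERIV_cmult has_derivative_ft_dual_product b)
    have 2: "((\<lambda>z. c * exp (k * (z - a))) has_field_derivative c * exp (k * (b - a)) * k) (at b)"
      by (auto intro!: derivative_eq_intros)
    show "(F has_field_derivative c * exp (k * (b - a)) * \<phi> b) (at b)"
      unfolding Fb by (rule DERIV_cong[OF DERIV_mult[OF 2 1]]) simp
  qed
  have \<phi>_le: "cmod (\<phi> b) * exp (Re k * Re (b - a)) \<le> B / cmod c" if b: "b \<in> I" for b
  proof -
    have "Im (b - a) = 0" using b a freq_real by (auto simp: complex_is_Real_iff subset_iff)
    then have "cmod (deriv F b) = cmod c * (cmod (\<phi> b) * exp (Re k * Re (b - a)))"
      unfolding dF[OF b] by (simp add: norm_mult mult_ac)
    then show ?thesis using B[OF b] c by (simp add: pos_le_divide_eq mult.commute)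
  qed
  have dn: "norm_L2 (d b) \<le> sqrt K" if b: "b \<in> I" for b
  proof -
    have "(norm_L2 (d b))\<^sup>2 \<le> K * 1"
    proof (rule norm_L2_le[OF dual_L2[OF b]])
      fix A assume A: "finite A" "A \<subseteq> I"
      then have "(\<Sum>\<mu>\<in>A. (cmod (ft (d b) \<mu>))\<^sup>2) = (\<Sum>\<mu>\<in>A. if b = \<mu> then 1 else 0)"
        using b by (intro sum.cong) (auto simp: ft_dual subset_iff)
      then show "(\<Sum>\<mu>\<in>A. (cmod (ft (d b) \<mu>))\<^sup>2) \<le> 1" using A by simp
    qed
    then show ?thesis by (intro real_le_rsqrt) simp
  qed
  define L where "L = norm_L2 (expo (cnj \<i>)) * sqrt K"
  define g where "g = cmod ((\<i> - a) * ft (d a) \<i>)"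
  have "\<i> \<notin> I" by (rule nonreal_notin) simp
  then have g0: "0 < g" using a ft_dual_nonzero[OF a(1), of \<i>] by (auto simp: g_def)
  \<comment> \<open>At \<open>\<i>\<close>, which is no frequency, the function
    \<open>(z - a) * ft (d a) z\<close> has the fixed modulus \<open>g > 0\<close>, while the dual
    vectors are bounded uniformly; so \<open>\<phi> b\<close> cannot decay faster than
    \<open>1 / (1 + cmod b)\<close>.\<close>
  have g_le: "g \<le> cmod (\<phi> b) * ((1 + cmod b) * L)" if b: "b \<in> I" for b
  proof -
    have "cmod (ft (d b) \<i>) \<le> norm_L2 (expo (cnj \<i>)) * norm_L2 (d b)" by (rule ft_bound[OF dual_L2[OF b]])
    also have "\<dots> \<le> L" unfolding L_def using dn[OF b] by (intro mult_left_mono) auto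
    finally have "cmod (ft (d b) \<i>) \<le> L" .
    moreover have "cmod (\<i> - b) \<le> 1 + cmod b" using norm_triangle_ineq4[of \<i> b] by simp
    ultimately show ?thesis
      unfolding g_def \<phi>(2)[OF b] norm_mult by (intro mult_mono mult_left_mono) auto
  qed
  have Rek: "Re k = 0"
  proof (rule ccontr)
    assume k: "Re k \<noteq> 0"
    define m where "m = \<bar>Re k\<bar>"
    \<comment> \<open>The sign selects the direction in which the exponential factor grows; there a
      bounded derivative of \<open>F\<close> forces \<open>\<phi>\<close> to decay exponentially,
      against \<open>g_le\<close>.\<close>
    define \<sigma> where "\<sigma> = - sgn (Re k)"
    have m: "0 < m" using k by (simp add: m_def)
    have \<sigma>: "\<sigma> = 1 \<or> \<sigma> = -1" using k by (auto simp: \<sigma>_def sgn_if)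
    have \<sigma>m: "Re k = - \<sigma> * m" by (simp add: \<sigma>_def m_def sgn_mult_abs)
    have B0: "0 \<le> B" using order_trans[OF norm_ge_zero B[OF a(1)]] .
    have L0: "0 \<le> L" using K_nonneg by (simp add: L_def)
    define D where "D = B / cmod c * L / g * exp (- m * \<sigma> * Re a)"
    have D0: "0 \<le> D" using B0 L0 g0 by (simp add: D_def)
    \<comment> \<open>Since \<open>exp (m * y)\<close> is at least
      \<open>(m * y)\<^sup>2 / 2\<close>, the estimates will give
      \<open>y \<le> 4 * D / m\<^sup>2\<close>. The summand 1 ensures \<open>1 \<le> y\<close>, used
      in \<open>1 + y \<le> 2 * y\<close>.\<close>
    obtain b where b: "b \<in> I" "\<sigma> * Re b < - (4 * D / m\<^sup>2 + 1)"
      using freq_unbounded[OF \<sigma>] by blast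
    define y where "y = - \<sigma> * Re b"
    have y: "y > 4 * D / m\<^sup>2 + 1" using b by (simp add: y_def)
    have "0 \<le> 4 * D / m\<^sup>2" using D0 by simp
    then have y1: "1 \<le> y" using y by linarith
    have cb: "cmod b = y"
    proof -
      have "cmod b = \<bar>Re b\<bar>" using b freq_real by (metis in_Reals_norm subsetD complex_is_Real_iff norm_of_real of_real_Re)
      also have "\<dots> = \<bar>y\<bar>" using \<sigma> by (auto simp: y_def)
      finally show ?thesis using y1 by simp
    qed
    have e: "exp (Re k * Re (b - a)) = exp (m * y) * exp (m * \<sigma> * Re a)"
      unfolding \<sigma>m y_def by (simp add: algebra_simps flip: exp_add)
    have "g * exp (Re k * Re (b - a)) \<le> cmod (\<phi> b) * ((1 + cmod b) * L) * exp (Re k * Re (b - a))"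
      using g_le[OF b(1)] by (intro mult_right_mono) auto
    also have "\<dots> = cmod (\<phi> b) * exp (Re k * Re (b - a)) * ((1 + cmod b) * L)" by (simp only: mult_ac)
    also have "\<dots> \<le> B / cmod c * ((1 + cmod b) * L)"
      using \<phi>_le[OF b(1)] L0 by (intro mult_right_mono) auto
    finally have "g * (exp (m * y) * exp (m * \<sigma> * Re a)) \<le> B / cmod c * ((1 + y) * L)"
      unfolding e cb .
    then have "g * (exp (m * y) * exp (m * \<sigma> * Re a)) * (exp (- m * \<sigma> * Re a) / g) \<le>
        B / cmod c * ((1 + y) * L) * (exp (- m * \<sigma> * Re a) / g)"
      using g0 by (intro mult_right_mono) auto
    also have "g * (exp (m * y) * exp (m * \<sigma> * Re a)) * (exp (- m * \<sigma> * Re a) / g) = exp (m * y)"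
      using g0 by (simp add: exp_minus)
    also have "B / cmod c * ((1 + y) * L) * (exp (- m * \<sigma> * Re a) / g) = D * (1 + y)"
      by (simp add: D_def)
    finally have "exp (m * y) \<le> D * (1 + y)" .
    also have "\<dots> \<le> D * (2 * y)" using y1 D0 by (intro mult_left_mono) auto
    finally have "exp (m * y) \<le> D * (2 * y)" .
    moreover have "(m * y)\<^sup>2 / 2 \<le> exp (m * y)"
      using exp_lower_Taylor_quadratic[of "m * y"] m y1
      by (smt (verit) mult_nonneg_nonneg)
    ultimately have "(m * y)\<^sup>2 / 2 \<le> D * (2 * y)" by linarith
    then have "m\<^sup>2 * y * y \<le> 4 * D * y" by (simp add: power2_eq_square mult_ac)
    then have "m\<^sup>2 * y \<le> 4 * D" using y1 by simp
    then have "y \<le> 4 * D / m\<^sup>2" using m by (simp add: pos_le_divide_eq mult.commute)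
    then show False using y by linarith
  qed
  have "cmod (\<phi> b) \<le> B / cmod c" if "b \<in> I" for b using \<phi>_le[OF that] Rek by simp
  then show ?thesis using that a(1) \<phi> by blast
qed

end

section \<open>The mixed system\<close>

text \<open>\<open>\<phi> b\<close> is the derivative at \<open>b\<close> of
  \<open>(z - a) * ft (d a) z\<close>, recorded through the identity in which it is used.
  Orthogonality to \<open>w\<close> is fixed only at frequencies outside \<open>Z\<close>; at points
  of \<open>Z\<close> it is supplied where needed.\<close>

locale mixed_systems =
  R: riesz_exponentials Z d K + W: dual_exponentials \<Lambda> w
  for Z \<Lambda> d w K +
  fixes \<phi> :: "complex \<Rightarrow> complex" and a :: complex and M :: real and h :: "real \<Rightarrow> complex"
  assumes a: "a \<in> Z"
    and \<phi>_nz: "\<And>b. b \<in> Z \<Longrightarrow> \<phi> b \<noteq> 0"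
    and \<phi>_le: "\<And>b. b \<in> Z \<Longrightarrow> cmod (\<phi> b) \<le> M"
    and \<phi>: "\<And>b z. b \<in> Z \<Longrightarrow> (z - a) * ft (d a) z = \<phi> b * ((z - b) * ft (d b) z)"
    and h: "h \<in> L2"
    and orth: "\<And>\<mu>. \<mu> \<in> \<Lambda> - Z \<Longrightarrow> inner_L2 (w \<mu>) h = 0"
begin

definition \<beta> where "\<beta> \<zeta> = inner_L2 (d \<zeta>) h"

lemma expansion_dual:
  assumes "\<mu> \<in> \<Lambda>" "inner_L2 (w \<mu>) h = 0"
  shows "((\<lambda>\<zeta>. ft (w \<mu>) \<zeta> * \<beta> \<zeta>) has_sum 0) Z"
  using R.expansion[OF W.dual_L2[OF assms(1)] h] assms by (simp add: \<beta>_def)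

lemma \<phi>_mult_dual:
  assumes "b \<in> Z" "z \<notin> Z"
  shows "\<phi> b * ft (d b) z = (z - a) * ft (d a) z / (z - b)"
proof -
  have "z - b \<noteq> 0" using assms by auto
  then show ?thesis
    unfolding nonzero_eq_divide_eq[OF \<open>z - b \<noteq> 0\<close>] \<phi>[OF assms(1)] by (simp only: mult_ac)
qed

lemma \<beta>_bound: "\<zeta> \<in> Z \<Longrightarrow> (cmod (\<beta> \<zeta>))\<^sup>2 \<le> K * (norm_L2 h)\<^sup>2"
  using R.dual_bessel[OF h, of "{\<zeta>}"] by (simp add: \<beta>_def)

text \<open>The auxiliary \<open>ft f\<close> is the product of \<open>ft (w \<nu>)\<close> with an entire function that takes the
  values \<open>\<phi> \<beta>\<close>; it vanishes on \<open>\<Lambda> - {\<nu>}\<close>.\<close>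
lemma \<phi>_\<beta>_const:
  assumes \<nu>: "\<nu> \<in> \<Lambda>" "inner_L2 (w \<nu>) h = 0"
  shows "\<exists>C. \<forall>\<zeta>\<in>Z. \<zeta> \<notin> \<Lambda> \<or> \<zeta> = \<nu> \<longrightarrow> \<phi> \<zeta> * \<beta> \<zeta> = C"
proof -
  define x where "x = ft (w \<nu>)"
  have wL: "w \<nu> \<in> L2" by (rule W.dual_L2[OF \<nu>(1)])
  define c where "c \<zeta> = x \<zeta> * \<phi> \<zeta> * \<beta> \<zeta>" for \<zeta>
  define B where "B = M\<^sup>2 * (K * (norm_L2 h)\<^sup>2)"
  have B0: "0 \<le> B" using R.K_nonneg by (simp add: B_def)
  obtain f where f: "f \<in> L2" "\<And>\<zeta>. \<zeta> \<in> Z \<Longrightarrow> ft f \<zeta> = c \<zeta>"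
  proof -
    \<comment> \<open>Bounded \<open>\<phi>\<close> and \<open>\<beta>\<close> keep the data square
      summable, since the values of \<open>x\<close> on \<open>Z\<close> are so by the Bessel
      bound.\<close>
    have "\<exists>k\<in>L2. (\<forall>\<mu>\<in>Z. ft k \<mu> = c \<mu>) \<and> (norm_L2 k)\<^sup>2 \<le> K * (B * (K * (norm_L2 (w \<nu>))\<^sup>2))"
    proof (rule R.interpolation)
      fix A assume A: "finite A" "A \<subseteq> Z"
      have "(\<Sum>\<mu>\<in>A. (cmod (c \<mu>))\<^sup>2) \<le> (\<Sum>\<mu>\<in>A. B * (cmod (x \<mu>))\<^sup>2)"
      proof (rule sum_mono)
        fix \<mu> assume "\<mu> \<in> A"
        then have \<mu>: "\<mu> \<in> Z" using A by auto
        have "(cmod (\<phi> \<mu>))\<^sup>2 \<le> M\<^sup>2" using \<phi>_le[OF \<mu>] by (intro power_mono) auto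
        then have "(cmod (\<phi> \<mu>))\<^sup>2 * (cmod (\<beta> \<mu>))\<^sup>2 \<le> B"
          unfolding B_def using \<beta>_bound[OF \<mu>] by (intro mult_mono) auto
        then have "(cmod (\<phi> \<mu>))\<^sup>2 * (cmod (\<beta> \<mu>))\<^sup>2 * (cmod (x \<mu>))\<^sup>2 \<le> B * (cmod (x \<mu>))\<^sup>2"
          by (rule mult_right_mono) simp
        then show "(cmod (c \<mu>))\<^sup>2 \<le> B * (cmod (x \<mu>))\<^sup>2"
          by (simp add: c_def norm_mult power_mult_distrib mult_ac)
      qed
      also have "\<dots> = B * (\<Sum>\<mu>\<in>A. (cmod (x \<mu>))\<^sup>2)" by (simp add: sum_distrib_left)
      also have "\<dots> \<le> B * (K * (norm_L2 (w \<nu>))\<^sup>2)"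
        unfolding x_def using R.bessel[OF wL A] B0 by (rule mult_left_mono)
      finally show "(\<Sum>\<mu>\<in>A. (cmod (c \<mu>))\<^sup>2) \<le> B * (K * (norm_L2 (w \<nu>))\<^sup>2)" .
    qed
    then show ?thesis using that by blast
  qed
  have f0: "ft f \<mu> = 0" if \<mu>: "\<mu> \<in> \<Lambda>" "\<mu> \<noteq> \<nu>" for \<mu>
  proof (cases "\<mu> \<in> Z")
    case True
    then show ?thesis using f(2)[OF True] \<mu> \<nu> by (simp add: c_def x_def W.ft_dual)
  next
    case False
    obtain \<theta> where \<theta>: "\<theta> \<noteq> 0" "\<And>z. (z - \<nu>) * ft (w \<nu>) z = \<theta> * ((z - \<mu>) * ft (w \<mu>) z)"
      by (rule W.ft_dual_ratio[OF \<nu>(1) \<mu>(1)]) (rule that)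
    define P where "P = (\<mu> - a) * ft (d a) \<mu> / (\<mu> - \<nu>)"
    \<comment> \<open>The two orthogonality relations, weighted so that partial fractions merge them
      into the expansion of \<open>ft f\<close> at \<open>\<mu>\<close>.\<close>
    have "((\<lambda>\<zeta>. P * (x \<zeta> * \<beta> \<zeta>) + - (P * \<theta>) * (ft (w \<mu>) \<zeta> * \<beta> \<zeta>)) has_sum (P * 0 + - (P * \<theta>) * 0)) Z"
      unfolding x_def using orth \<mu> \<nu> False
      by (intro has_sum_add has_sum_cmult_right expansion_dual) auto
    moreover have "P * (x \<zeta> * \<beta> \<zeta>) + - (P * \<theta>) * (ft (w \<mu>) \<zeta> * \<beta> \<zeta>) = ft f \<zeta> * ft (d \<zeta>) \<mu>" if \<zeta>: "\<zeta> \<in> Z" for \<zeta>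
    proof -
      have ne: "\<mu> - \<zeta> \<noteq> 0" "\<mu> - \<nu> \<noteq> 0" using \<zeta> False \<mu> by auto
      have "(\<zeta> - \<nu>) * x \<zeta> = \<theta> * ((\<zeta> - \<mu>) * ft (w \<mu>) \<zeta>)" using \<theta>(2)[of \<zeta>] by (simp add: x_def)
      then have "(\<mu> - \<nu>) * x \<zeta> = (\<mu> - \<zeta>) * (x \<zeta> - \<theta> * ft (w \<mu>) \<zeta>)" by (simp add: algebra_simps)
      then have x: "x \<zeta> / (\<mu> - \<zeta>) = (x \<zeta> - \<theta> * ft (w \<mu>) \<zeta>) / (\<mu> - \<nu>)"
        unfolding frac_eq_eq[OF ne] by (simp only: mult_ac)
      have "ft f \<zeta> * ft (d \<zeta>) \<mu> = x \<zeta> * \<beta> \<zeta> * (\<phi> \<zeta> * ft (d \<zeta>) \<mu>)" using f(2)[OF \<zeta>] by (simp add: c_def)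
      also have "\<dots> = (x \<zeta> / (\<mu> - \<zeta>)) * \<beta> \<zeta> * ((\<mu> - a) * ft (d a) \<mu>)"
        unfolding \<phi>_mult_dual[OF \<zeta> False] by simp
      also have "\<dots> = P * (x \<zeta> * \<beta> \<zeta>) + - (P * \<theta>) * (ft (w \<mu>) \<zeta> * \<beta> \<zeta>)"
        unfolding x P_def by (simp add: diff_divide_distrib algebra_simps)
      finally show ?thesis ..
    qed
    ultimately have "((\<lambda>\<zeta>. ft f \<zeta> * ft (d \<zeta>) \<mu>) has_sum 0) Z"
      by (subst (asm) has_sum_cong) auto
    then show ?thesis using R.ft_expansion[OF f(1), of \<mu>] has_sum_unique by blast
  qed
  define C where "C = ft f \<nu>"
  have fC: "ft f z = C * x z" for z
  proof -
    have "ft f z = ft (\<lambda>t. C * w \<nu> t) z"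
      by (rule W.ft_eq) (use f(1) wL f0 \<nu> in \<open>auto simp: L2_cmult ft_cmult W.ft_dual C_def\<close>)
    then show ?thesis by (simp add: ft_cmult x_def)
  qed
  have "\<phi> \<zeta> * \<beta> \<zeta> = C" if \<zeta>: "\<zeta> \<in> Z" "\<zeta> \<notin> \<Lambda> \<or> \<zeta> = \<nu>" for \<zeta>
  proof -
    have "x \<zeta> \<noteq> 0" unfolding x_def using \<zeta>(2) W.ft_dual_nonzero[OF \<nu>(1)] W.ft_dual[OF \<nu>(1) \<nu>(1)] by auto
    moreover have "x \<zeta> * (\<phi> \<zeta> * \<beta> \<zeta>) = x \<zeta> * C" using fC[of \<zeta>] f(2)[OF \<zeta>(1)] by (simp add: c_def mult_ac)
    ultimately show ?thesis by simp
  qed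
  then show ?thesis by blast
qed

text \<open>In the finite case the orthogonality relations make \<open>(z - \<nu>) ft (w \<nu>) z\<close> itself
  the transform of a function, although it vanishes on \<open>\<Lambda>\<close>.\<close>
lemma \<phi>_\<beta>_const_eq_0:
  assumes N: "N \<subseteq> Z" and \<nu>: "\<nu> \<in> \<Lambda>" and \<zeta>1: "\<zeta>1 \<in> N" "\<zeta>1 \<notin> \<Lambda>"
    and Z0: "\<And>\<zeta> \<mu>. \<zeta> \<in> Z - N \<Longrightarrow> \<mu> \<in> insert \<nu> (\<Lambda> - Z) \<Longrightarrow> ft (w \<mu>) \<zeta> = 0"
    and C: "\<And>\<zeta>. \<zeta> \<in> N \<Longrightarrow> \<phi> \<zeta> * \<beta> \<zeta> = C"
  shows "C = 0"
proof (rule ccontr)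
  assume C0: "C \<noteq> 0"
  show False
  proof (cases "finite N")
    case False
    have "0 < cmod (\<phi> \<zeta>1)" "cmod (\<phi> \<zeta>1) \<le> M" using \<phi>_nz \<phi>_le N \<zeta>1 by auto
    then have M0: "0 < M" by linarith
    \<comment> \<open>On \<open>N\<close> the modulus of \<open>\<beta>\<close> is at least
      \<open>cmod C / M\<close>, which the Bessel bound for the dual system allows only finitely
      often.\<close>
    define \<delta> where "\<delta> = (cmod C / M)\<^sup>2"
    have \<delta>: "0 < \<delta>" using C0 M0 by (simp add: \<delta>_def)
    obtain n where n: "K * (norm_L2 h)\<^sup>2 < real n * \<delta>" using reals_Archimedean3[OF \<delta>] by blast
    obtain A where A: "finite A" "card A = n" "A \<subseteq> N" using infinite_arbitrarily_large[OF False] by blast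
    have "real n * \<delta> = (\<Sum>\<zeta>\<in>A. \<delta>)" using A by simp
    also have "\<dots> \<le> (\<Sum>\<zeta>\<in>A. (cmod (\<beta> \<zeta>))\<^sup>2)"
    proof (rule sum_mono)
      fix \<zeta> assume "\<zeta> \<in> A"
      then have \<zeta>: "\<zeta> \<in> N" "\<zeta> \<in> Z" using A N by auto
      have "cmod C = cmod (\<phi> \<zeta>) * cmod (\<beta> \<zeta>)" using C[OF \<zeta>(1)] by (metis norm_mult)
      also have "\<dots> \<le> M * cmod (\<beta> \<zeta>)" using \<phi>_le[OF \<zeta>(2)] by (intro mult_right_mono) auto
      finally have "cmod C / M \<le> cmod (\<beta> \<zeta>)" using M0 by (simp add: pos_divide_le_eq mult.commute)
      then show "\<delta> \<le> (cmod (\<beta> \<zeta>))\<^sup>2" unfolding \<delta>_def using M0 by (intro power_mono) auto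
    qed
    also have "\<dots> \<le> K * (norm_L2 h)\<^sup>2" unfolding \<beta>_def using A N by (intro R.dual_bessel h) auto
    finally show False using n by simp
  next
    case True
    define x where "x = ft (w \<nu>)"
    \<comment> \<open>A factor \<open>\<zeta> - \<nu>\<close> would spoil square summability in
      general; here the data vanish off the finite set \<open>N\<close>.\<close>
    define c where "c \<zeta> = (\<zeta> - \<nu>) * x \<zeta>" for \<zeta>
    have c0: "c \<zeta> = 0" if "\<zeta> \<in> Z - N" for \<zeta> using Z0[OF that, of \<nu>] by (simp add: c_def x_def)
    have "\<exists>k\<in>L2. (\<forall>\<mu>\<in>Z. ft k \<mu> = c \<mu>) \<and> (norm_L2 k)\<^sup>2 \<le> K * (\<Sum>\<mu>\<in>N. (cmod (c \<mu>))\<^sup>2)"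
    proof (rule R.interpolation)
      fix A assume A: "finite A" "A \<subseteq> Z"
      have "(\<Sum>\<mu>\<in>A. (cmod (c \<mu>))\<^sup>2) = (\<Sum>\<mu>\<in>A \<inter> N. (cmod (c \<mu>))\<^sup>2)"
        using A c0 by (intro sum.mono_neutral_right) auto
      also have "\<dots> \<le> (\<Sum>\<mu>\<in>N. (cmod (c \<mu>))\<^sup>2)" using True by (intro sum_mono2) auto
      finally show "(\<Sum>\<mu>\<in>A. (cmod (c \<mu>))\<^sup>2) \<le> (\<Sum>\<mu>\<in>N. (cmod (c \<mu>))\<^sup>2)" .
    qed
    then obtain q where q: "q \<in> L2" "\<And>\<zeta>. \<zeta> \<in> Z \<Longrightarrow> ft q \<zeta> = c \<zeta>" by blast
    have "ft q \<mu> = 0" if \<mu>: "\<mu> \<in> \<Lambda>" for \<mu>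
    proof (cases "\<mu> \<in> Z")
      case True
      then show ?thesis using q(2) \<nu> \<mu> by (simp add: c_def x_def W.ft_dual)
    next
      case False
      obtain \<theta> where \<theta>: "\<theta> \<noteq> 0" "\<And>z. (z - \<nu>) * ft (w \<nu>) z = \<theta> * ((z - \<mu>) * ft (w \<mu>) z)"
        by (rule W.ft_dual_ratio[OF \<nu> \<mu>]) (rule that)
      \<comment> \<open>On \<open>N\<close> one has \<open>\<beta> = C / \<phi>\<close>, so division
        by \<open>C\<close> turns the relation for \<open>w \<mu>\<close> into the expansion of
        \<open>ft q\<close> at \<open>\<mu>\<close>.\<close>
      define P where "P = - (\<theta> * ((\<mu> - a) * ft (d a) \<mu>) / C)"
      have "((\<lambda>\<zeta>. P * (ft (w \<mu>) \<zeta> * \<beta> \<zeta>)) has_sum P * 0) Z"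
        using orth \<mu> False by (intro has_sum_cmult_right expansion_dual) auto
      moreover have "P * (ft (w \<mu>) \<zeta> * \<beta> \<zeta>) = ft q \<zeta> * ft (d \<zeta>) \<mu>" if \<zeta>: "\<zeta> \<in> Z" for \<zeta>
      proof (cases "\<zeta> \<in> N")
        case False
        then show ?thesis using c0[of \<zeta>] Z0[of \<zeta> \<mu>] q(2)[OF \<zeta>] \<zeta> \<mu> \<open>\<mu> \<notin> Z\<close> by simp
      next
        case True
        have ne: "\<mu> - \<zeta> \<noteq> 0" using \<zeta> \<open>\<mu> \<notin> Z\<close> by auto
        have "C * (ft q \<zeta> * ft (d \<zeta>) \<mu>) = c \<zeta> * \<beta> \<zeta> * (\<phi> \<zeta> * ft (d \<zeta>) \<mu>)"
          using C[OF True] q(2)[OF \<zeta>] by (simp add: mult_ac)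
        also have "c \<zeta> = - (\<theta> * ft (w \<mu>) \<zeta>) * (\<mu> - \<zeta>)"
          using \<theta>(2)[of \<zeta>] by (simp add: c_def x_def algebra_simps)
        also have "\<phi> \<zeta> * ft (d \<zeta>) \<mu> = (\<mu> - a) * ft (d a) \<mu> / (\<mu> - \<zeta>)" by (rule \<phi>_mult_dual[OF \<zeta> \<open>\<mu> \<notin> Z\<close>])
        also have "- (\<theta> * ft (w \<mu>) \<zeta>) * (\<mu> - \<zeta>) * \<beta> \<zeta> * ((\<mu> - a) * ft (d a) \<mu> / (\<mu> - \<zeta>))
            = - (\<theta> * ((\<mu> - a) * ft (d a) \<mu>)) * (ft (w \<mu>) \<zeta> * \<beta> \<zeta>)"
          using ne by simp
        finally show ?thesis using C0 by (simp add: P_def field_simps)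
      qed
      ultimately have "((\<lambda>\<zeta>. ft q \<zeta> * ft (d \<zeta>) \<mu>) has_sum 0) Z"
        by (subst (asm) has_sum_cong) auto
      then show ?thesis using R.ft_expansion[OF q(1), of \<mu>] has_sum_unique by blast
    qed
    then have "ft q \<zeta>1 = 0" by (rule W.ft_eq_0[OF q(1)])
    then have "(\<zeta>1 - \<nu>) * x \<zeta>1 = 0" using q(2)[of \<zeta>1] N \<zeta>1 by (auto simp: c_def)
    then show False using W.ft_dual_nonzero[OF \<nu> \<zeta>1(2)] \<nu> \<zeta>1 by (auto simp: x_def)
  qed
qed

lemma orthogonal_eq_0:
  assumes Z: "Z = Y \<union> N" "Y \<inter> N = {}" and Y: "Y \<subseteq> \<Lambda>"
    and h_Y: "\<And>\<mu>. \<mu> \<in> Y \<Longrightarrow> ft h \<mu> = 0"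
    and h_w: "\<And>\<mu>. \<mu> \<in> \<Lambda> - Y \<Longrightarrow> inner_L2 (w \<mu>) h = 0"
  shows "norm_L2 h = 0"
proof -
  have "\<beta> \<zeta> = 0" if \<zeta>: "\<zeta> \<in> N" for \<zeta>
  proof (cases "N \<subseteq> \<Lambda>")
    case True
    \<comment> \<open>Now \<open>Z\<close> is part of \<open>\<Lambda>\<close>; for
      \<open>\<mu>\<close> in \<open>\<Lambda>\<close> outside \<open>Z\<close> the transform of
      \<open>w \<mu>\<close> would vanish on all of \<open>Z\<close>, against completeness.\<close>
    have "\<Lambda> \<subseteq> Z"
    proof
      fix \<mu> assume \<mu>: "\<mu> \<in> \<Lambda>"
      show "\<mu> \<in> Z"
      proof (rule ccontr)
        assume "\<mu> \<notin> Z"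
        then have "ft (w \<mu>) \<nu> = 0" if "\<nu> \<in> Z" for \<nu> using that True Y Z \<mu> W.ft_dual[OF \<mu>, of \<nu>] by auto
        then have "ft (w \<mu>) \<mu> = 0" by (rule R.ft_eq_0[OF W.dual_L2[OF \<mu>]])
        then show False using W.ft_dual[OF \<mu> \<mu>] by simp
      qed
    qed
    then have ZL: "Z = \<Lambda>" using True Y Z by auto
    have "norm_L2 (\<lambda>t. d \<zeta> t - w \<zeta> t) = 0"
      using \<zeta> Z ZL by (intro R.norm_diff_eq_0 R.dual_L2 W.dual_L2) (auto simp: R.ft_dual W.ft_dual)
    then have "\<beta> \<zeta> = inner_L2 (w \<zeta>) h"
      unfolding \<beta>_def using \<zeta> Z ZL by (intro inner_L2_eq_L2 R.dual_L2 W.dual_L2 h) auto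
    then show ?thesis using h_w[of \<zeta>] \<zeta> Z ZL by auto
  next
    case False
    then obtain \<zeta>1 where \<zeta>1: "\<zeta>1 \<in> N" "\<zeta>1 \<notin> \<Lambda>" by auto
    have "\<Lambda> - Y \<noteq> {}"
    proof
      assume "\<Lambda> - Y = {}"
      then have "ft (d \<zeta>1) \<mu> = 0" if "\<mu> \<in> \<Lambda>" for \<mu> using that \<zeta>1 Z by (subst R.ft_dual) auto
      moreover have "d \<zeta>1 \<in> L2" using \<zeta>1 Z by (intro R.dual_L2) auto
      ultimately have "ft (d \<zeta>1) \<zeta>1 = 0" using W.ft_eq_0[of "d \<zeta>1" \<zeta>1] by blast
      then show False using R.ft_dual[of \<zeta>1 \<zeta>1] \<zeta>1 Z by simp
    qed
    then obtain \<nu> where \<nu>: "\<nu> \<in> \<Lambda> - Y" by auto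
    define C where "C = \<phi> \<zeta>1 * \<beta> \<zeta>1"
    have C: "\<phi> \<zeta>' * \<beta> \<zeta>' = C" if \<zeta>': "\<zeta>' \<in> N" for \<zeta>'
    proof -
      \<comment> \<open>A point of \<open>N\<close> in \<open>\<Lambda>\<close> has to be the
        comparison frequency itself; the value at \<open>\<zeta>1\<close> shows that the constant
        does not change.\<close>
      define \<nu>' where "\<nu>' = (if \<zeta>' \<in> \<Lambda> then \<zeta>' else \<nu>)"
      have \<nu>': "\<nu>' \<in> \<Lambda> - Y" using \<nu> \<zeta>' Z by (auto simp: \<nu>'_def)
      have "\<exists>C. \<forall>\<zeta>\<in>Z. \<zeta> \<notin> \<Lambda> \<or> \<zeta> = \<nu>' \<longrightarrow> \<phi> \<zeta> * \<beta> \<zeta> = C"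
        using \<nu>' h_w by (intro \<phi>_\<beta>_const) auto
      then obtain C' where C': "\<And>\<zeta>. \<zeta> \<in> Z \<Longrightarrow> \<zeta> \<notin> \<Lambda> \<or> \<zeta> = \<nu>' \<Longrightarrow> \<phi> \<zeta> * \<beta> \<zeta> = C'" by blast
      have "\<phi> \<zeta>' * \<beta> \<zeta>' = C'" using \<zeta>' Z by (intro C') (auto simp: \<nu>'_def)
      moreover have "C = C'" unfolding C_def using \<zeta>1 Z by (intro C') auto
      ultimately show ?thesis by simp
    qed
    have "C = 0"
    proof (rule \<phi>_\<beta>_const_eq_0[of N \<nu> \<zeta>1 C])
      show "ft (w \<mu>) \<zeta>' = 0" if "\<zeta>' \<in> Z - N" "\<mu> \<in> insert \<nu> (\<Lambda> - Z)" for \<zeta>' \<mu>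
        using that Z Y \<nu> by (subst W.ft_dual) auto
    qed (use Z \<nu> \<zeta>1 C in auto)
    then show ?thesis using C[OF \<zeta>] \<phi>_nz[of \<zeta>] \<zeta> Z by auto
  qed
  \<comment> \<open>In the expansion of \<open>(h, h)\<close> every term has a vanishing factor: the
    transform on \<open>Y\<close>, \<open>\<beta>\<close> on \<open>N\<close>.\<close>
  then have "((\<lambda>\<mu>. ft h \<mu> * inner_L2 (d \<mu>) h) has_sum inner_L2 h h) Z \<longleftrightarrow> ((\<lambda>\<mu>. 0) has_sum inner_L2 h h) Z"
    using h_Y Z by (intro has_sum_cong) (auto simp: \<beta>_def)
  then have "((\<lambda>\<mu>. 0) has_sum inner_L2 h h) Z" using R.expansion[OF h h] by simp
  then have "inner_L2 h h = 0" using has_sum_0[of Z "\<lambda>_. 0"] has_sum_unique by blast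
  then show ?thesis by (simp add: inner_L2_self)
qed

end

theorem theorem5p1:
  fixes \<Lambda> \<Lambda>1 \<Lambda>2' :: "complex set"
    and w :: "complex \<Rightarrow> real \<Rightarrow> complex"
    and F :: "complex \<Rightarrow> complex"
  assumes "\<Lambda> \<subseteq> \<real>"
    and "complete_L2 (expo ` \<Lambda>)"
    and "minimal_L2 \<Lambda> expo"
    and "biorthogonal \<Lambda> expo w"
    and "\<Lambda>1 \<subseteq> \<Lambda>"
    and "\<Lambda>2' \<subseteq> \<real>"
    and "\<Lambda>1 \<inter> \<Lambda>2' = {}"
    and "riesz_basis (\<Lambda>1 \<union> \<Lambda>2') expo"
    and "generating_function (\<Lambda>1 \<union> \<Lambda>2') F"
    and "bdd_above ((\<lambda>\<zeta>. cmod (deriv F \<zeta>)) ` (\<Lambda>1 \<union> \<Lambda>2'))"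
  shows "complete_L2 (expo ` \<Lambda>1 \<union> w ` (\<Lambda> - \<Lambda>1))"
proof (rule complete_L2_I)
  have wL: "w \<mu> \<in> L2" if "\<mu> \<in> \<Lambda>" for \<mu> using assms(4) that by (auto simp: biorthogonal_def)
  then show "expo ` \<Lambda>1 \<union> w ` (\<Lambda> - \<Lambda>1) \<subseteq> L2" using expo_L2 by auto
  fix h assume h: "h \<in> L2" and h_orth: "\<And>v. v \<in> expo ` \<Lambda>1 \<union> w ` (\<Lambda> - \<Lambda>1) \<Longrightarrow> inner_L2 v h = 0"
  have Z_real: "\<Lambda>1 \<union> \<Lambda>2' \<subseteq> \<real>" using assms(1,5,6) by auto
  obtain d K where R: "riesz_exponentials (\<Lambda>1 \<union> \<Lambda>2') d K"
    by (rule riesz_basis_exponentials[OF Z_real assms(8)]) (rule that)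
  have W: "dual_exponentials \<Lambda> w"
  proof
    show "norm_L2 f = 0" if "f \<in> L2" "\<And>\<mu>. \<mu> \<in> \<Lambda> \<Longrightarrow> ft f \<mu> = 0" for f
      by (rule complete_L2_expo[OF assms(2,1) that])
    show "ft (w \<mu>) \<nu> = (if \<mu> = \<nu> then 1 else 0)" if "\<mu> \<in> \<Lambda>" "\<nu> \<in> \<Lambda>" for \<mu> \<nu>
    proof -
      have "inner_L2 (expo \<nu>) (w \<mu>) = (if \<nu> = \<mu> then 1 else 0)" using assms(4) that by (auto simp: biorthogonal_def)
      then have "cnj (inner_L2 (expo \<nu>) (w \<mu>)) = (if \<mu> = \<nu> then 1 else 0)" by auto
      then show ?thesis using that assms(1) by (simp add: ft_real inner_L2_cnj subset_iff)
    qed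
  qed (use assms(1) wL in auto)
  obtain a \<phi> M where \<phi>: "a \<in> \<Lambda>1 \<union> \<Lambda>2'" "\<And>b. b \<in> \<Lambda>1 \<union> \<Lambda>2' \<Longrightarrow> \<phi> b \<noteq> 0"
    "\<And>b. b \<in> \<Lambda>1 \<union> \<Lambda>2' \<Longrightarrow> cmod (\<phi> b) \<le> M"
    "\<And>b z. b \<in> \<Lambda>1 \<union> \<Lambda>2' \<Longrightarrow> (z - a) * ft (d a) z = \<phi> b * ((z - b) * ft (d b) z)"
    by (rule riesz_exponentials.ratio_bounded[OF R assms(9,10)]) (rule that)
  interpret mixed_systems "\<Lambda>1 \<union> \<Lambda>2'" \<Lambda> d w K \<phi> a M h
  proof -
    interpret R: riesz_exponentials "\<Lambda>1 \<union> \<Lambda>2'" d K by (rule R)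
    interpret W: dual_exponentials \<Lambda> w by (rule W)
    show "mixed_systems (\<Lambda>1 \<union> \<Lambda>2') \<Lambda> d w K \<phi> a M h"
      by unfold_locales (use \<phi> h h_orth in blast)+
  qed
  show "norm_L2 h = 0"
  proof (rule orthogonal_eq_0[OF refl assms(7,5)])
    fix \<mu> assume \<mu>: "\<mu> \<in> \<Lambda>1"
    have "inner_L2 (expo \<mu>) h = 0" using \<mu> by (intro h_orth) auto
    then have "inner_L2 h (expo \<mu>) = 0" by (metis inner_L2_cnj complex_cnj_zero)
    then show "ft h \<mu> = 0" using \<mu> Z_real by (subst ft_real) auto
  qed (use h_orth in auto)
qed

end
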